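(* Let $n\ge2$ and let $N\ge[\frac n2]+1$ be an integer. Suppose $a(x,t)$ is a function on $\mathbb{R}^n\times\mathbb{R}$, $2\pi$-periodic in $t$, which is once differentiable in the $x$-variable and $N$ times differentiable in the $t$-variable. Assume that for $j=0,1,\ldots,N$ and $i=1,2,\ldots,n$ both $\frac{\partial^j}{\partial t^j}a(x,t)$ and $\frac{\partial^j}{\partial t^j}\frac{\partial}{\partial x_i}a(x,t)$ are bounded functions on $\mathbb{R}^n\times\mathbb{R}$. Then for every $p>2$ and every $w\in A_{p/2}(\mathbb{R}^n)$ there is a constant $C$ such that $$\int_{\mathbb{R}^n}|\hat a(x,H)f(x)|^pw(x)\,dx\le C\int_{\mathbb{R}^n}|f(x)|^pw(x)\,dx$$ for all $f\in L^p(\mathbb{R}^n,w\,dx)$.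
   Context: $H=-\Delta_{\mathbb{R}^n}+|x|^2$ is the Hermite operator on $\mathbb{R}^n$, with spectral resolution $H=\sum_{k=0}^\infty(2k+n)P_k$, where $P_k$ is the orthogonal projection of $L^2(\mathbb{R}^n)$ onto the $k$-th eigenspace of $H$, with eigenvalue $2k+n$. For a bounded function $a(x,t)$ on $\mathbb{R}^n\times\mathbb{R}$ that is $2\pi$-periodic in $t$, put $\hat a(x,k)=\int_0^{2\pi}a(x,t)e^{-ikt}\,dt$ and $\hat a(x,H)f(x)=\sum_{k=0}^\infty\hat a(x,2k+n)P_kf(x)$. $A_q(\mathbb{R}^n)$ is Muckenhoupt's class of weights, and $[\cdot]$ denotes the integer part. The inequality is understood for the extension of $\hat a(x,H)$ to $L^p(\mathbb{R}^n,w\,dx)$. *)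

theory Defs
  imports "HOL-Analysis.Analysis"
begin

subsection \<open>Derivatives\<close>

definition partial :: "'n::finite \<Rightarrow> (real^'n \<Rightarrow> complex) \<Rightarrow> real^'n \<Rightarrow> complex" where
  "partial i f x = frechet_derivative f (at x) (axis i 1)"

definition C1 :: "(real^'n::finite \<Rightarrow> complex) \<Rightarrow> bool" where
  "C1 f \<longleftrightarrow> (\<forall>x. f differentiable (at x)) \<and> (\<forall>i. continuous_on UNIV (partial i f))"

definition C2 :: "(real^'n::finite \<Rightarrow> complex) \<Rightarrow> bool" where
  "C2 f \<longleftrightarrow> C1 f \<and> (\<forall>i. C1 (partial i f))"

definition nderiv :: "nat \<Rightarrow> (real \<Rightarrow> complex) \<Rightarrow> real \<Rightarrow> complex" where
  "nderiv j g = ((\<lambda>h t. vector_derivative h (at t)) ^^ j) g"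

definition times_differentiable :: "nat \<Rightarrow> (real \<Rightarrow> complex) \<Rightarrow> bool" where
  "times_differentiable N g \<longleftrightarrow> (\<forall>j<N. \<forall>t. nderiv j g differentiable (at t))"

subsection \<open>The Hermite operator and its spectral projections\<close>

definition square_integrable :: "(real^'n::finite \<Rightarrow> complex) \<Rightarrow> bool" where
  "square_integrable f \<longleftrightarrow>
     f \<in> borel_measurable lebesgue \<and> integrable lebesgue (\<lambda>x. (cmod (f x))\<^sup>2)"

definition hermite_op :: "(real^'n::finite \<Rightarrow> complex) \<Rightarrow> real^'n \<Rightarrow> complex" where
  "hermite_op f x = - (\<Sum>i\<in>UNIV. partial i (partial i f) x) + complex_of_real ((norm x)\<^sup>2) * f x"

text \<open>By elliptic regularity every eigenfunction of the self-adjoint realisation of the Hermite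
  operator has a smooth representative, so the eigenspace consists of the square-integrable
  classical solutions. Taking the continuous representative makes pointwise values of elements
  of the eigenspace meaningful.\<close>

definition hermite_eigenspace :: "nat \<Rightarrow> (real^'n::finite \<Rightarrow> complex) set" where
  "hermite_eigenspace k =
     {u. C2 u \<and> square_integrable u \<and> (\<forall>x. hermite_op u x = of_nat (2 * k + CARD('n)) * u x)}"

text \<open>Orthogonal projection of a square-integrable function onto the eigenspace.\<close>

definition hermite_proj ::
    "nat \<Rightarrow> (real^'n::finite \<Rightarrow> complex) \<Rightarrow> real^'n \<Rightarrow> complex" where
  "hermite_proj k f = (THE g. g \<in> hermite_eigenspace k \<and>
     (\<forall>h\<in>hermite_eigenspace k. (LINT x|lebesgue. (f x - g x) * cnj (h x)) = 0))"

subsection \<open>The pseudo-multiplier\<close>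

definition fourier_coeff :: "(real^'n::finite \<Rightarrow> real \<Rightarrow> complex) \<Rightarrow> real^'n \<Rightarrow> nat \<Rightarrow> complex" where
  "fourier_coeff a x k = (LINT t:{0..2*pi}|lebesgue. a x t * cis (- (real k * t)))"

text \<open>Only meaningful for square-integrable \<open>f\<close>. For the symbols considered here the series then
  converges absolutely at every \<open>x\<close>, because of the decay of the Fourier coefficients.\<close>

definition pseudo_multiplier ::
    "(real^'n::finite \<Rightarrow> real \<Rightarrow> complex) \<Rightarrow> (real^'n \<Rightarrow> complex) \<Rightarrow> real^'n \<Rightarrow> complex" where
  "pseudo_multiplier a f x =
     (\<Sum>k. fourier_coeff a x (2 * k + CARD('n)) * hermite_proj k f x)"

subsection \<open>Weights and weighted spaces\<close>

text \<open>Muckenhoupt's class \<open>A\<^sub>q\<close> for \<open>1 < q\<close>. The integrability conditions are explicit since the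
  Bochner integral of a non-integrable function is 0.\<close>

definition muckenhoupt :: "real \<Rightarrow> (real^'n::finite \<Rightarrow> real) set" where
  "muckenhoupt q = {w.
     w \<in> borel_measurable lebesgue \<and> (AE x in lebesgue. 0 < w x) \<and>
     (\<forall>c r. set_integrable lebesgue (ball c r) w \<and>
            set_integrable lebesgue (ball c r) (\<lambda>x. w x powr (- 1 / (q - 1)))) \<and>
     (\<exists>C. \<forall>c. \<forall>r>0.
        ((LINT x:ball c r|lebesgue. w x) / measure lebesgue (ball c r)) *
        ((LINT x:ball c r|lebesgue. w x powr (- 1 / (q - 1))) / measure lebesgue (ball c r))
          powr (q - 1) \<le> C)}"

definition weighted_Lp ::
    "real \<Rightarrow> (real^'n::finite \<Rightarrow> real) \<Rightarrow> (real^'n \<Rightarrow> complex) set" where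
  "weighted_Lp p w = {f. f \<in> borel_measurable lebesgue \<and>
     integrable lebesgue (\<lambda>x. cmod (f x) powr p * w x)}"

text \<open>A linear operator on the weighted space (functions modulo null sets) that agrees with the
  pseudo-multiplier on all square-integrable elements. These are dense, so at most one such
  operator is bounded.\<close>

definition extends_pseudo_multiplier ::
    "(real^'n::finite \<Rightarrow> real \<Rightarrow> complex) \<Rightarrow> real \<Rightarrow> (real^'n \<Rightarrow> real) \<Rightarrow>
     ((real^'n \<Rightarrow> complex) \<Rightarrow> (real^'n \<Rightarrow> complex)) \<Rightarrow> bool" where
  "extends_pseudo_multiplier a p w T \<longleftrightarrow>
     (\<forall>f\<in>weighted_Lp p w. T f \<in> weighted_Lp p w) \<and>
     (\<forall>f\<in>weighted_Lp p w. \<forall>g\<in>weighted_Lp p w.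
        AE x in lebesgue. T (\<lambda>y. f y + g y) x = T f x + T g x) \<and>
     (\<forall>c. \<forall>f\<in>weighted_Lp p w. AE x in lebesgue. T (\<lambda>y. c * f y) x = c * T f x) \<and>
     (\<forall>f\<in>weighted_Lp p w. square_integrable f \<longrightarrow>
        (AE x in lebesgue. T f x = pseudo_multiplier a f x))"

end

theory Submission
  imports Defs "HOL-Probability.Distributions"
begin

text \<open>The operator is controlled pointwise by a quadratic mean of \<open>f\<close> with polynomially decaying
weight, and such means are bounded on the weighted space.

\<^emph>\<open>Reduction to a multiplier at each point.\<close> Put \<open>l = n div 2 + 1\<close>, so \<open>l \<le> N\<close> and \<open>n < 2 l\<close>.
Integrating by parts \<open>l\<close> times in \<open>t\<close> gives \<open>|m\<^sub>k| \<le> M / (k + 1)\<^sup>l\<close> for the Fourier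
coefficients \<open>m\<^sub>k\<close> of \<open>a(x,\<cdot>)\<close> at the frequencies \<open>2k + n\<close>, with \<open>M\<close> independent of \<open>x\<close>
(\<open>fourier_coeff_bound\<close>). From then on \<open>x\<close> is a parameter: the value of the operator at \<open>x\<close> is
the series of the \<open>m\<^sub>k P\<^sub>k f(x)\<close>, and it suffices to treat arbitrary sequences with this decay.

\<^emph>\<open>Kernel estimate.\<close> With the normalized products \<open>h\<^sub>\<alpha>\<close> of one-dimensional Hermite functions,
the series has the kernel \<open>K(x,y)\<close>, the sum over \<open>\<alpha>\<close> of \<open>m\<close> at \<open>|\<alpha>|\<close> times
\<open>h\<^sub>\<alpha>(x) h\<^sub>\<alpha>(y)\<close>. The weight \<open>(1 + |x - y|)\<close> to the power \<open>2 l\<close> is at most a constant times one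
plus the \<open>2 l\<close>-th powers of all coordinates of \<open>x\<close> and \<open>y\<close>. Multiplication of \<open>h\<^sub>\<alpha>\<close> by a
coordinate shifts \<open>\<alpha>\<close> to a neighbour and costs the square root of the degree, so by
orthonormality the weighted integral of \<open>|K(x,y)|\<^sup>2\<close> over \<open>y\<close> is at most \<open>C M\<^sup>2\<close> times a sum over
\<open>\<alpha>\<close> of squares \<open>h\<^sub>\<alpha>(x)\<^sup>2\<close> with negative powers of the degree (\<open>Herm_expansion_weighted\<close>).
This last sum is bounded uniformly in \<open>x\<close> (\<open>sum_hweight_bounded\<close>), thanks to the bound
\<open>h\<^sub>0\<^sup>2 + \<dots> + h\<^sub>K\<^sup>2 \<le> sqrt (2 (K + 1))\<close> on the line (\<open>sum_herm_sq_le\<close>) and to \<open>n < 2 l\<close>.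
The Cauchy-Schwarz inequality now shows that the series converges and that its square is at most
\<open>C M\<^sup>2\<close> times the integral of \<open>|f(y)|\<^sup>2\<close> against the reciprocal weight
(\<open>hproj_series_bound\<close>).

\<^emph>\<open>Weighted bound.\<close> As \<open>n < 2 l\<close>, the last integral is at most a geometrically weighted sum of averages
of \<open>|f|\<^sup>2\<close> over balls of radius \<open>2\<^sup>j\<close> with \<open>j \<ge> 0\<close>. For \<open>q = p / 2 > 1\<close> and a weight in \<open>A\<^sub>q\<close>, the
\<open>q\<close>-th power of an average of \<open>g\<close> is at most a constant times the average of \<open>g\<^sup>q\<close> with respect to
the measure \<open>w dx\<close>, and averaging over balls of one fixed radius with respect to any such measure
is bounded on \<open>L\<^sup>1\<close> with a constant depending on the dimension alone. Every scale is therefore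
bounded on \<open>L\<^sup>q(w)\<close> uniformly in \<open>j\<close>, without a maximal function, and the scales can be summed
(\<open>muckenhoupt_tail_bound\<close>).

\<^emph>\<open>The spectral projections.\<close> They are given through classical solutions of the eigenvalue
equation. Green's identity with a cutoff shows that such a solution is orthogonal to the
\<open>h\<^sub>\<alpha>\<close> belonging to other eigenvalues, and the \<open>h\<^sub>\<alpha>\<close> form a complete system; hence the
\<open>k\<close>-th eigenspace is spanned by the \<open>h\<^sub>\<alpha>\<close> with \<open>|\<alpha>| = k\<close> and \<open>P\<^sub>k f\<close> is the finite sum of the
\<open>\<langle>f, h\<^sub>\<alpha>\<rangle> h\<^sub>\<alpha>\<close> (\<open>hermite_proj_eq_hproj\<close>). That sum makes sense for every \<open>f\<close> in the weighted space,
which defines the extension of the operator.\<close>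

section \<open>Integrals of derivatives\<close>

lemma integrable_dominated:
  fixes f :: "'a \<Rightarrow> 'b::{banach, second_countable_topology}" and g :: "'a \<Rightarrow> real"
  assumes "integrable M g" "f \<in> borel_measurable M" "\<And>x. norm (f x) \<le> g x"
  shows "integrable M f"
  by (rule Bochner_Integration.integrable_bound[OF assms(1,2)])
     (use order_trans[OF assms(3) abs_ge_self] in \<open>auto intro: AE_I2\<close>)

lemma integral_lborel_translate:
  fixes f :: "'a::euclidean_space \<Rightarrow> 'b::{banach, second_countable_topology}"
  assumes "f \<in> borel_measurable borel"
  shows "integral\<^sup>L lborel (\<lambda>x. f (c + x)) = integral\<^sup>L lborel f"
proof -
  have "integral\<^sup>L lborel f = integral\<^sup>L (distr lborel borel ((+) c)) f"
    by (simp add: lborel_distr_plus)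
  also have "\<dots> = integral\<^sup>L lborel (\<lambda>x. f (c + x))"
    using assms by (subst integral_distr) auto
  finally show ?thesis by simp
qed

lemma integrable_lborel_translate:
  fixes f :: "'a::euclidean_space \<Rightarrow> 'b::{banach, second_countable_topology}"
  assumes "integrable lborel f"
  shows "integrable lborel (\<lambda>x. f (c + x))"
proof -
  have "integrable (distr lborel borel ((+) c)) f"
    using assms by (simp add: lborel_distr_plus)
  then show ?thesis
    by (subst (asm) integrable_distr_eq) (use assms in auto)
qed

text \<open>By translation invariance every difference quotient of \<open>F\<close> along \<open>v\<close> has integral 0, and the
  mean value theorem dominates the quotients by \<open>G\<close>. This covers both decaying functions on the
  line and compactly supported functions in several variables.\<close>

lemma integral_directional_derivative_eq_0:
  fixes F F' :: "'a::euclidean_space \<Rightarrow> 'b::euclidean_space"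
  assumes F: "integrable lborel F" and F': "F' \<in> borel_measurable borel"
    and d: "\<And>x s. ((\<lambda>s. F (x + s *\<^sub>R v)) has_vector_derivative F' (x + s *\<^sub>R v)) (at s)"
    and G: "integrable lborel G"
    and dom: "\<And>x s. 0 \<le> s \<Longrightarrow> s \<le> 1 \<Longrightarrow> norm (F' (x + s *\<^sub>R v)) \<le> G x"
  shows "integral\<^sup>L lborel F' = 0"
proof -
  have Fm[measurable]: "F \<in> borel_measurable borel" using F by auto
  define D where "D n x = real (Suc n) *\<^sub>R (F ((1 / real (Suc n)) *\<^sub>R v + x) - F x)" for n x
  have "(\<lambda>n. integral\<^sup>L lborel (D n)) \<longlonglongrightarrow> integral\<^sup>L lborel F'"
  proof (rule integral_dominated_convergence[where w=G])
    show "F' \<in> borel_measurable lborel" "\<And>n. D n \<in> borel_measurable lborel"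
      using F' by (auto simp: D_def[abs_def])
    show "integrable lborel G" by fact
    show "AE x in lborel. (\<lambda>n. D n x) \<longlonglongrightarrow> F' x"
    proof (rule AE_I2)
      fix x
      have "((\<lambda>s. (1 / norm (s - 0)) *\<^sub>R (F (x + s *\<^sub>R v) - (F (x + 0 *\<^sub>R v) + (s - 0) *\<^sub>R F' (x + 0 *\<^sub>R v)))) \<longlongrightarrow> 0) (at 0)"
        using d[of x 0] unfolding has_vector_derivative_def has_derivative_within by auto
      moreover have "filterlim (\<lambda>n. 1 / real (Suc n)) (at 0) sequentially"
        unfolding filterlim_at using LIMSEQ_inverse_real_of_nat by (auto simp: inverse_eq_divide)
      ultimately have "((\<lambda>n. (1 / norm ((1 / real (Suc n)) - 0)) *\<^sub>R (F (x + (1 / real (Suc n)) *\<^sub>R v) - (F (x + 0 *\<^sub>R v) + ((1 / real (Suc n)) - 0) *\<^sub>R F' (x + 0 *\<^sub>R v)))) \<longlonglongrightarrow> 0)"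
        by (rule filterlim_compose)
      also have "(\<lambda>n. (1 / norm ((1 / real (Suc n)) - 0)) *\<^sub>R (F (x + (1 / real (Suc n)) *\<^sub>R v) - (F (x + 0 *\<^sub>R v) + ((1 / real (Suc n)) - 0) *\<^sub>R F' (x + 0 *\<^sub>R v))))
        = (\<lambda>n. D n x - F' x)"
        unfolding D_def by (rule ext) (simp add: algebra_simps scaleR_diff_right del: of_nat_Suc)
      finally show "(\<lambda>n. D n x) \<longlonglongrightarrow> F' x" using LIM_zero_iff by blast
    qed
    show "AE x in lborel. norm (D n x) \<le> G x" for n
    proof (rule AE_I2)
      fix x
      define t where "t = 1 / real (Suc n)"
      have t: "0 < t" "t \<le> 1" by (auto simp: t_def)
      have "norm (F (x + t *\<^sub>R v) - F (x + 0 *\<^sub>R v)) \<le> G x * norm (t - 0)"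
      proof (rule differentiable_bound[of "{0..t}" "\<lambda>s. F (x + s *\<^sub>R v)" "\<lambda>s h. h *\<^sub>R F' (x + s *\<^sub>R v)" "G x"])
        show "convex {0..t}" by simp
        show "((\<lambda>s. F (x + s *\<^sub>R v)) has_derivative (\<lambda>h. h *\<^sub>R F' (x + s *\<^sub>R v))) (at s within {0..t})" if "s \<in> {0..t}" for s
          using d[of x s] by (auto simp: has_vector_derivative_def intro: has_derivative_at_withinI)
        show "onorm (\<lambda>h. h *\<^sub>R F' (x + s *\<^sub>R v)) \<le> G x" if "s \<in> {0..t}" for s
          using dom[of s x] that t by (intro onorm_le) (auto simp: mult.commute[of "G x"] intro!: mult_left_mono)
      qed (use t in auto)
      then have "norm (F (x + t *\<^sub>R v) - F x) \<le> G x * t" using t by simp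
      moreover have "norm (D n x) = norm (F (x + t *\<^sub>R v) - F x) / t"
        by (simp add: D_def t_def add.commute del: of_nat_Suc)
      ultimately show "norm (D n x) \<le> G x" using t by (simp add: pos_divide_le_eq)
    qed
  qed
  moreover have "integral\<^sup>L lborel (D n) = 0" for n
    unfolding D_def using F integrable_lborel_translate[OF F] integral_lborel_translate[OF Fm]
    by (subst integral_scaleR_right) (auto simp: Bochner_Integration.integral_diff)
  ultimately show ?thesis by (simp add: LIMSEQ_const_iff)
qed

section \<open>Hermite functions on the line\<close>

text \<open>The recursion of the Hermite polynomials, scaled so that all functions have unit \<open>L\<^sup>2\<close> norm;
  the constant \<open>sqrt (sqrt pi)\<close> normalizes the Gaussian. Only the recursion and the first function
  are ever needed, so polynomials and factorials do not appear.\<close>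

fun herm :: "nat \<Rightarrow> real \<Rightarrow> real" where
  "herm 0 x = exp (- x\<^sup>2 / 2) / sqrt (sqrt pi)"
| "herm (Suc 0) x = sqrt 2 * x * herm 0 x"
| "herm (Suc (Suc k)) x =
     (sqrt 2 * x * herm (Suc k) x - sqrt (Suc k) * herm k x) / sqrt (Suc (Suc k))"

text \<open>For \<open>k = 0\<close> the term with the truncated index \<open>k - 1\<close> is multiplied by \<open>sqrt 0\<close>.\<close>

lemma herm_three_term:
  "sqrt 2 * x * herm k x = sqrt (Suc k) * herm (Suc k) x + sqrt k * herm (k - 1) x"
proof (cases k)
  case (Suc j)
  have "sqrt (Suc (Suc j)) * herm (Suc (Suc j)) x = sqrt 2 * x * herm (Suc j) x - sqrt (Suc j) * herm j x"
    by (simp del: of_nat_Suc)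
  then show ?thesis using Suc by (simp del: of_nat_Suc herm.simps)
qed simp

lemma herm_deriv_aux:
  "(herm k has_real_derivative (sqrt 2 * sqrt k * herm (k - 1) x - x * herm k x)) (at x)"
proof (induction k x rule: herm.induct)
  case (1 x)
  have "((\<lambda>x. exp (- x\<^sup>2 / 2) * (1 / sqrt (sqrt pi))) has_real_derivative
      (- x * exp (- x\<^sup>2 / 2)) * (1 / sqrt (sqrt pi))) (at x)"
    by (intro DERIV_cmult_right) (auto intro!: derivative_eq_intros)
  moreover have "herm 0 = (\<lambda>x. exp (- x\<^sup>2 / 2) * (1 / sqrt (sqrt pi)))"
    by (rule ext) simp
  ultimately have "(herm 0 has_real_derivative (- x * exp (- x\<^sup>2 / 2)) * (1 / sqrt (sqrt pi))) (at x)"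
    by (simp only:)
  then show ?case by (rule DERIV_cong) simp
next
  case (2 x)
  have "(herm 0 has_real_derivative (- x * herm 0 x)) (at x)" using 2 by (rule DERIV_cong) simp
  then show ?case unfolding herm.simps(2)[abs_def]
    by (auto intro!: derivative_eq_intros simp del: herm.simps(1) simp: algebra_simps)
next
  case (3 k x)
  note [simp del] = of_nat_Suc herm.simps
  define b where "b = sqrt (Suc (Suc k))"
  define a where "a = sqrt (Suc k)"
  have ab: "b > 0" "b * b = a * a + 1" by (auto simp: a_def b_def of_nat_Suc)
  have D: "(herm (Suc (Suc k)) has_real_derivative
     ((sqrt 2 * (herm (Suc k) x + x * (sqrt 2 * a * herm k x - x * herm (Suc k) x)) -
       a * (sqrt 2 * sqrt k * herm (k - 1) x - x * herm k x)) / b)) (at x)"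
    using 3 ab(1) unfolding herm.simps(3)[abs_def] a_def[symmetric] b_def[symmetric]
    by (auto intro!: derivative_eq_intros simp: field_simps)
  have E: "b * herm (Suc (Suc k)) x = sqrt 2 * x * herm (Suc k) x - a * herm k x"
    using herm_three_term[of x "Suc k"] by (simp add: a_def b_def)
  have E2: "sqrt k * herm (k - 1) x = sqrt 2 * x * herm k x - a * herm (Suc k) x"
    using herm_three_term[of x k] by (simp add: a_def)
  have "(sqrt 2 * (herm (Suc k) x + x * (sqrt 2 * a * herm k x - x * herm (Suc k) x)) -
       a * (sqrt 2 * (sqrt k * herm (k - 1) x) - x * herm k x))
     = sqrt 2 * (b * b) * herm (Suc k) x - x * (b * herm (Suc (Suc k)) x)"
    unfolding E E2 ab(2) by (simp add: algebra_simps)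
  then have "(sqrt 2 * (herm (Suc k) x + x * (sqrt 2 * a * herm k x - x * herm (Suc k) x)) -
       a * (sqrt 2 * sqrt k * herm (k - 1) x - x * herm k x)) / b
     = sqrt 2 * b * herm (Suc k) x - x * herm (Suc (Suc k)) x"
    using ab(1) by (simp add: field_simps)
  with D show ?case by (simp add: b_def)
qed

declare herm.simps [simp del]

text \<open>Half the difference of the annihilation and creation operators; unlike the two forms below
  it involves no multiplication by \<open>x\<close>, so that it telescopes in sums over \<open>k\<close>.\<close>

definition dherm :: "nat \<Rightarrow> real \<Rightarrow> real" where
  "dherm k x = (sqrt k * herm (k - 1) x - sqrt (Suc k) * herm (Suc k) x) / sqrt 2"

text \<open>The annihilation operator \<open>d/dx + x\<close> lowers the index and the creation operator \<open>x - d/dx\<close>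
  raises it.\<close>

lemma dherm_eq:
  "dherm k x = sqrt 2 * sqrt k * herm (k - 1) x - x * herm k x"
  "dherm k x = x * herm k x - sqrt 2 * sqrt (Suc k) * herm (Suc k) x"
proof -
  have x: "x * herm k x = (sqrt (Suc k) * herm (Suc k) x + sqrt k * herm (k - 1) x) / sqrt 2"
    using herm_three_term[of x k] by (simp add: field_simps)
  show "dherm k x = sqrt 2 * sqrt k * herm (k - 1) x - x * herm k x"
    "dherm k x = x * herm k x - sqrt 2 * sqrt (Suc k) * herm (Suc k) x"
    unfolding x dherm_def by (simp_all add: field_simps)
qed

lemma herm_has_derivative: "(herm k has_real_derivative dherm k x) (at x)"
  using herm_deriv_aux by (simp add: dherm_eq(1))

lemma continuous_herm: "continuous_on UNIV (herm k)"
  by (intro continuous_at_imp_continuous_on ballI DERIV_isCont[OF herm_has_derivative])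

lemma measurable_herm[measurable]: "herm k \<in> borel_measurable borel"
  using continuous_herm by (rule borel_measurable_continuous_onI)

lemma power_div_fact_le_exp:
  assumes "(x::real) \<ge> 0"
  shows "x ^ n / fact n \<le> exp x"
proof -
  have "(\<Sum>k\<in>{n}. x ^ k /\<^sub>R fact k) \<le> (\<Sum>k. x ^ k /\<^sub>R fact k)"
    by (rule sum_le_suminf) (use assms summable_exp_generic[of x] in auto)
  then show ?thesis by (simp add: exp_def divide_inverse mult.commute)
qed

lemma power_times_exp_bounded:
  assumes "c > 0"
  shows "\<exists>C. \<forall>x::real. \<bar>x\<bar> ^ m \<le> C * exp (c * x\<^sup>2)"
proof -
  have "\<bar>x\<bar> ^ m \<le> (1 + fact m / c ^ m) * exp (c * x\<^sup>2)" for x :: real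
  proof (cases "\<bar>x\<bar> \<le> 1")
    case True
    then have "\<bar>x\<bar> ^ m \<le> 1" by (simp add: power_le_one)
    also have "1 \<le> (1 + fact m / c ^ m) * 1" using assms by simp
    also have "\<dots> \<le> (1 + fact m / c ^ m) * exp (c * x\<^sup>2)" using assms by (intro mult_left_mono) auto
    finally show ?thesis .
  next
    case False
    then have "1 \<le> \<bar>x\<bar> ^ m" by (intro one_le_power) simp
    then have "\<bar>x\<bar> ^ m \<le> (\<bar>x\<bar> ^ m) * \<bar>x\<bar> ^ m"
      by (metis mult_left_mono mult.right_neutral abs_ge_zero zero_le_power)
    also have "\<dots> = (\<bar>x\<bar> * \<bar>x\<bar>) ^ m" by (simp only: power_mult_distrib)
    also have "\<dots> = (c * x\<^sup>2) ^ m / c ^ m" using assms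
      by (simp add: power_mult_distrib[of c] abs_mult_self_eq power2_eq_square)
    also have "\<dots> \<le> (fact m * exp (c * x\<^sup>2)) / c ^ m"
    proof -
      have "(c * x\<^sup>2) ^ m / fact m \<le> exp (c * x\<^sup>2)"
        using assms by (intro power_div_fact_le_exp) auto
      then show ?thesis using assms by (simp add: field_simps)
    qed
    also have "\<dots> \<le> (1 + fact m / c ^ m) * exp (c * x\<^sup>2)" using assms by (simp add: algebra_simps)
    finally show ?thesis .
  qed
  then show ?thesis by blast
qed

text \<open>The recursion multiplies by \<open>x\<close>, so all powers of \<open>x\<close> are carried through the induction.
  They are paid for by half of the exponent of the Gaussian.\<close>

lemma herm_decay: "\<exists>C. \<forall>x. \<bar>x\<bar> ^ m * \<bar>herm k x\<bar> \<le> C * exp (- x\<^sup>2 / 4)"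
proof (induction k arbitrary: m rule: less_induct)
  case (less k)
  show ?case
  proof (cases k)
    case 0
    obtain C where C: "\<bar>x\<bar> ^ m \<le> C * exp ((1/4) * x\<^sup>2)" for x :: real
      using power_times_exp_bounded[of "1/4" m] by auto
    have "\<bar>x\<bar> ^ m * \<bar>herm 0 x\<bar> \<le> (C / sqrt (sqrt pi)) * exp (- x\<^sup>2 / 4)" for x
    proof -
      have "\<bar>x\<bar> ^ m * \<bar>herm 0 x\<bar> \<le> C * exp ((1/4) * x\<^sup>2) * \<bar>herm 0 x\<bar>"
        using C by (intro mult_right_mono) auto
      also have "\<dots> = (C / sqrt (sqrt pi)) * (exp ((1/4) * x\<^sup>2) * exp (- x\<^sup>2 / 2))"
        by (simp add: herm.simps)
      also have "exp ((1/4) * x\<^sup>2) * exp (- x\<^sup>2 / 2) = exp (- x\<^sup>2 / 4)"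
        by (simp add: exp_add[symmetric] del: exp_add)
      finally show ?thesis .
    qed
    then show ?thesis using 0 by blast
  next
    case (Suc j)
    obtain C where C: "\<bar>x\<bar> ^ Suc m * \<bar>herm j x\<bar> \<le> C * exp (- x\<^sup>2 / 4)" for x
      using less[of j "Suc m"] Suc by blast
    obtain D where D: "\<bar>x\<bar> ^ m * \<bar>herm (j - 1) x\<bar> \<le> D * exp (- x\<^sup>2 / 4)" for x
    proof -
      have "j - 1 < k" using Suc by simp
      from less[OF this, of m] show ?thesis using that by blast
    qed
    define b where "b = sqrt (Suc j)"
    define a where "a = sqrt j"
    have ab: "b > 0" "a \<ge> 0" by (auto simp: a_def b_def)
    have "\<bar>x\<bar> ^ m * \<bar>herm k x\<bar> \<le> ((sqrt 2 * C + a * D) / b) * exp (- x\<^sup>2 / 4)" for x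
    proof -
      have "b * herm k x = sqrt 2 * x * herm j x - a * herm (j - 1) x"
        using herm_three_term[of x j] by (simp add: a_def b_def Suc)
      then have "b * \<bar>herm k x\<bar> = \<bar>sqrt 2 * x * herm j x - a * herm (j - 1) x\<bar>"
        using ab by (metis abs_mult abs_of_pos)
      also have "\<dots> \<le> sqrt 2 * \<bar>x\<bar> * \<bar>herm j x\<bar> + a * \<bar>herm (j - 1) x\<bar>"
        using ab abs_triangle_ineq4[of "sqrt 2 * x * herm j x" "a * herm (j - 1) x"] by (simp add: abs_mult)
      finally have "\<bar>x\<bar> ^ m * (b * \<bar>herm k x\<bar>) \<le> \<bar>x\<bar> ^ m * (sqrt 2 * \<bar>x\<bar> * \<bar>herm j x\<bar> + a * \<bar>herm (j - 1) x\<bar>)"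
        by (intro mult_left_mono) auto
      also have "\<dots> = sqrt 2 * (\<bar>x\<bar> ^ Suc m * \<bar>herm j x\<bar>) + a * (\<bar>x\<bar> ^ m * \<bar>herm (j - 1) x\<bar>)"
        by (simp add: algebra_simps)
      also have "\<dots> \<le> sqrt 2 * (C * exp (- x\<^sup>2 / 4)) + a * (D * exp (- x\<^sup>2 / 4))"
        using C[of x] D[of x] ab by (intro add_mono mult_left_mono) auto
      finally show ?thesis using ab by (simp add: field_simps)
    qed
    then show ?thesis by blast
  qed
qed

lemma dherm_decay: "\<exists>C. \<forall>x. \<bar>dherm k x\<bar> \<le> C * exp (- x\<^sup>2 / 4)"
proof -
  obtain C where C: "\<And>x. \<bar>herm (k - 1) x\<bar> \<le> C * exp (- x\<^sup>2 / 4)" using herm_decay[of 0 "k - 1"] by auto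
  obtain D where D: "\<And>x. \<bar>x\<bar> * \<bar>herm k x\<bar> \<le> D * exp (- x\<^sup>2 / 4)" using herm_decay[of 1 k] by auto
  have "\<bar>dherm k x\<bar> \<le> (sqrt 2 * sqrt k * C + D) * exp (- x\<^sup>2 / 4)" for x
  proof -
    have "\<bar>dherm k x\<bar> \<le> sqrt 2 * sqrt k * \<bar>herm (k - 1) x\<bar> + \<bar>x\<bar> * \<bar>herm k x\<bar>"
      unfolding dherm_eq(1)
      using abs_triangle_ineq4[of "sqrt 2 * sqrt k * herm (k - 1) x" "x * herm k x"] by (simp add: abs_mult)
    also have "\<dots> \<le> sqrt 2 * sqrt k * (C * exp (- x\<^sup>2 / 4)) + D * exp (- x\<^sup>2 / 4)"
      by (intro add_mono mult_left_mono C D) auto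
    finally show ?thesis by (simp add: algebra_simps)
  qed
  then show ?thesis by blast
qed

lemma mult_gaussian_bounds:
  fixes u v :: real
  assumes "\<bar>u\<bar> \<le> C * exp (- x\<^sup>2 / 4)" "\<bar>v\<bar> \<le> D * exp (- x\<^sup>2 / 4)"
  shows "\<bar>u * v\<bar> \<le> C * D * exp (- x\<^sup>2 / 2)"
proof -
  have "\<bar>u * v\<bar> \<le> (C * exp (- x\<^sup>2 / 4)) * (D * exp (- x\<^sup>2 / 4))"
    unfolding abs_mult using assms by (intro mult_mono) auto
  also have "\<dots> = C * D * (exp (- x\<^sup>2 / 4) * exp (- x\<^sup>2 / 4))" by simp
  also have "exp (- x\<^sup>2 / 4) * exp (- x\<^sup>2 / 4) = exp (- x\<^sup>2 / 2)"
    by (simp add: exp_add[symmetric] del: exp_add)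
  finally show ?thesis .
qed

lemma gaussian_integrable_real:
  assumes "c > 0" shows "integrable lborel (\<lambda>x::real. exp (- c * x\<^sup>2))"
proof -
  have "integrable lborel (\<lambda>x. sqrt (2 * pi * (1 / sqrt (2 * c))\<^sup>2) * normal_density 0 (1 / sqrt (2 * c)) x)"
    using assms by (intro integrable_mult_right integrable_normal_density) auto
  also have "(\<lambda>x. sqrt (2 * pi * (1 / sqrt (2 * c))\<^sup>2) * normal_density 0 (1 / sqrt (2 * c)) x) = (\<lambda>x. exp (- c * x\<^sup>2))"
    using assms by (rule_tac ext) (simp add: normal_density_def field_simps real_sqrt_divide)
  finally show ?thesis .
qed

lemma gaussian_integral_real: "integral\<^sup>L lborel (\<lambda>x::real. exp (- x\<^sup>2)) = sqrt pi"
  using has_bochner_integral_even_function[OF gaussian_moment_0]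
  by (simp add: has_bochner_integral_iff)

lemma integrable_herm_mult: "integrable lborel (\<lambda>x. herm j x * herm k x)"
proof -
  obtain C where C: "\<And>x. \<bar>herm j x\<bar> \<le> C * exp (- x\<^sup>2 / 4)" using herm_decay[of 0 j] by auto
  obtain D where D: "\<And>x. \<bar>herm k x\<bar> \<le> D * exp (- x\<^sup>2 / 4)" using herm_decay[of 0 k] by auto
  have "integrable lborel (\<lambda>x::real. C * D * exp (- (1/2) * x\<^sup>2))"
    by (intro integrable_mult_right gaussian_integrable_real) auto
  then show ?thesis
    by (rule integrable_dominated) (use mult_gaussian_bounds[OF C D] in auto)
qed

text \<open>This is the adjointness of the annihilation and creation operators, in the form of
  integration by parts.\<close>

lemma integral_deriv_herm_mult:
  "integral\<^sup>L lborel (\<lambda>x. herm j x * dherm k x + dherm j x * herm k x) = 0"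
proof -
  let ?g = "\<lambda>x. herm j x * dherm k x + dherm j x * herm k x"
  obtain A where A: "\<And>x. \<bar>herm j x\<bar> \<le> A * exp (- x\<^sup>2 / 4)" using herm_decay[of 0 j] by auto
  obtain B where B: "\<And>x. \<bar>dherm k x\<bar> \<le> B * exp (- x\<^sup>2 / 4)" using dherm_decay by blast
  obtain A' where A': "\<And>x. \<bar>dherm j x\<bar> \<le> A' * exp (- x\<^sup>2 / 4)" using dherm_decay by blast
  obtain B' where B': "\<And>x. \<bar>herm k x\<bar> \<le> B' * exp (- x\<^sup>2 / 4)" using herm_decay[of 0 k] by auto
  define C where "C = A * B + A' * B'"
  have g: "\<bar>?g x\<bar> \<le> C * exp (- x\<^sup>2 / 2)" for x
    using mult_gaussian_bounds[OF A B, of x] mult_gaussian_bounds[OF A' B', of x]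
      abs_triangle_ineq[of "herm j x * dherm k x" "dherm j x * herm k x"] unfolding C_def distrib_right by linarith
  have C0: "C \<ge> 0" using order_trans[OF abs_ge_zero g[of 0]] by simp
  show ?thesis
  proof (rule integral_directional_derivative_eq_0[where v=1 and F="\<lambda>x. herm j x * herm k x"
      and G = "\<lambda>x. (C * exp (1 / 2)) * exp (- x\<^sup>2 / 4)"])
    show "integrable lborel (\<lambda>x. herm j x * herm k x)" by (rule integrable_herm_mult)
    show "?g \<in> borel_measurable borel" unfolding dherm_def by measurable
    fix x s :: real
    have "((\<lambda>x. herm j x * herm k x) has_real_derivative dherm j (s + x) * herm k (s + x) + dherm k (s + x) * herm j (s + x)) (at (s + x))"
      by (intro DERIV_mult herm_has_derivative)
    then show "((\<lambda>s. herm j (x + s *\<^sub>R 1) * herm k (x + s *\<^sub>R 1)) has_vector_derivative ?g (x + s *\<^sub>R 1)) (at s)"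
      unfolding DERIV_shift by (simp add: has_real_derivative_iff_has_vector_derivative algebra_simps)
  next
    have "integrable lborel (\<lambda>x::real. (C * exp (1 / 2)) * exp (- (1/4) * x\<^sup>2))"
      by (intro integrable_mult_right gaussian_integrable_real) auto
    then show "integrable lborel (\<lambda>x::real. (C * exp (1 / 2)) * exp (- x\<^sup>2 / 4))" by simp
    fix x s :: real assume s: "0 \<le> s" "s \<le> 1"
    have "norm (?g (x + s)) \<le> C * exp (- (x + s)\<^sup>2 / 2)" using g[of "x + s"] by simp
    also have "\<dots> \<le> C * exp (1 / 2 + - x\<^sup>2 / 4)"
    proof -
      \<comment> \<open>This square yields \<open>(x + s)\<^sup>2 / 2 \<ge> x\<^sup>2 / 4 - s\<^sup>2 / 2\<close>.\<close>
      have "0 \<le> (x + 2 * s)\<^sup>2" by simp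
      moreover have "s\<^sup>2 \<le> 1" using s by (simp add: power_le_one)
      ultimately have "- (x + s)\<^sup>2 / 2 \<le> 1 / 2 + - x\<^sup>2 / 4" by (simp add: power2_eq_square field_simps)
      then show ?thesis using C0 by (intro mult_left_mono) auto
    qed
    finally show "norm (?g (x + s *\<^sub>R 1)) \<le> (C * exp (1 / 2)) * exp (- x\<^sup>2 / 4)"
      unfolding exp_add by (simp add: mult.assoc)
  qed
qed

text \<open>In the derivative of the product, the lowering form is used for one factor and the raising
  form for the other, so that the terms containing \<open>x\<close> cancel.\<close>

lemma herm_inner_recursion:
  "sqrt (Suc j) * integral\<^sup>L lborel (\<lambda>x. herm (Suc j) x * herm k x) =
   sqrt k * integral\<^sup>L lborel (\<lambda>x. herm j x * herm (k - 1) x)"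
proof -
  note [simp] = integrable_herm_mult
  have "herm j x * dherm k x + dherm j x * herm k x
    = sqrt 2 * (sqrt k * (herm j x * herm (k - 1) x)) - sqrt 2 * (sqrt (Suc j) * (herm (Suc j) x * herm k x))" for x
    unfolding dherm_eq(1)[of k] dherm_eq(2)[of j] by (simp add: algebra_simps)
  from integral_deriv_herm_mult[of j k, unfolded this]
  have "sqrt 2 * (sqrt k * integral\<^sup>L lborel (\<lambda>x. herm j x * herm (k - 1) x))
     - sqrt 2 * (sqrt (Suc j) * integral\<^sup>L lborel (\<lambda>x. herm (Suc j) x * herm k x)) = 0"
    by (subst (asm) Bochner_Integration.integral_diff) auto
  then show ?thesis by simp
qed

text \<open>The recursion lowers both indices together until one of them is 0, and then it annihilates
  the product unless the other is 0 as well.\<close>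

lemma herm_orthonormal:
  "integral\<^sup>L lborel (\<lambda>x. herm j x * herm k x) = (if j = k then 1 else 0)"
proof (induction j arbitrary: k)
  case 0
  show ?case
  proof (cases k)
    case 0
    have "(\<lambda>x. herm 0 x * herm 0 x) = (\<lambda>x. exp (- x\<^sup>2) * (1 / sqrt pi))"
      by (rule ext) (simp add: herm.simps exp_add[symmetric] del: exp_add)
    then show ?thesis using 0 by (simp add: gaussian_integral_real)
  next
    case (Suc k')
    have "sqrt (Suc k') * integral\<^sup>L lborel (\<lambda>x. herm (Suc k') x * herm 0 x) = 0"
      using herm_inner_recursion[of k' 0] by simp
    then show ?thesis using Suc by (simp add: mult.commute)
  qed
next
  case (Suc j)
  show ?case
  proof (cases k)
    case 0
    then show ?thesis using herm_inner_recursion[of j 0] by simp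
  next
    case (Suc k')
    then have "sqrt (Suc j) * integral\<^sup>L lborel (\<lambda>x. herm (Suc j) x * herm k x) = sqrt (Suc k') * (if j = k' then 1 else 0)"
      using herm_inner_recursion[of j k] Suc.IH[of k'] by simp
    then show ?thesis using Suc by (auto split: if_splits)
  qed
qed

lemma integral_abs_herm_mult_le: 
  shows "integral\<^sup>L lborel (\<lambda>x. \<bar>herm j x * herm k x\<bar>) \<le> 1"
proof -
  have "integral\<^sup>L lborel (\<lambda>x. \<bar>herm j x * herm k x\<bar>) \<le> integral\<^sup>L lborel (\<lambda>x. (1/2) * (herm j x * herm j x) + (1/2) * (herm k x * herm k x))"
  proof (rule integral_mono)
    show "\<bar>herm j x * herm k x\<bar> \<le> (1/2) * (herm j x * herm j x) + (1/2) * (herm k x * herm k x)" for x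
      using sum_squares_bound[of "\<bar>herm j x\<bar>" "\<bar>herm k x\<bar>"] by (simp add: abs_mult power2_eq_square)
  qed (intro Bochner_Integration.integrable_add integrable_mult_right integrable_herm_mult integrable_abs)+
  also have "\<dots> = 1"
    by (subst Bochner_Integration.integral_add) (auto simp: integrable_herm_mult herm_orthonormal)
  finally show ?thesis .
qed

text \<open>The derivative of the sum telescopes to \<open>- sqrt (2 (K + 1)) h\<^sub>K h\<^sub>K\<^sub>+\<^sub>1\<close>, the integral of
  \<open>|h\<^sub>K h\<^sub>K\<^sub>+\<^sub>1|\<close> is at most 1, and the sum vanishes at infinity. This growth like the square root
  of \<open>K\<close>, uniformly in \<open>x\<close>, is the source of the condition \<open>n < 2 l\<close> in several variables.\<close>

lemma sum_herm_sq_le: "(\<Sum>k\<le>K. (herm k x)\<^sup>2) \<le> sqrt (2 * Suc K)"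
proof -
  define S where "S x = (\<Sum>k\<le>K. (herm k x)\<^sup>2)" for x
  define g where "g x = - sqrt (2 * Suc K) * (herm K x * herm (Suc K) x)" for x
  have D: "(S has_real_derivative g x) (at x)" for x
  proof -
    have "(S has_real_derivative (\<Sum>k\<le>K. 2 * herm k x * ((sqrt k * herm (k - 1) x - sqrt (Suc k) * herm (Suc k) x) / sqrt 2))) (at x)"
      unfolding S_def dherm_def[symmetric] by (auto intro!: derivative_eq_intros herm_has_derivative simp: mult_ac)
    moreover have "(\<Sum>k\<le>n. 2 * herm k x * ((sqrt k * herm (k - 1) x - sqrt (Suc k) * herm (Suc k) x) / sqrt 2))
      = - sqrt 2 * sqrt (Suc n) * (herm n x * herm (Suc n) x)" for n
    proof (induction n)
      case 0 
      have "2 / sqrt 2 = sqrt (2::real)" by (rule real_div_sqrt) simp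
      then show ?case by (simp add: field_simps)
    next
      case (Suc n)
      have h: "2 / sqrt 2 = sqrt (2::real)" by (rule real_div_sqrt) simp
      have "2 * herm (Suc n) x * ((sqrt (Suc n) * herm n x - sqrt (Suc (Suc n)) * herm (Suc (Suc n)) x) / sqrt 2)
        = (2 / sqrt 2) * (herm (Suc n) x * (sqrt (Suc n) * herm n x - sqrt (Suc (Suc n)) * herm (Suc (Suc n)) x))"
        by simp
      then show ?case using Suc unfolding h by (simp add: algebra_simps del: of_nat_Suc)
    qed
    moreover have "sqrt (2 * Suc K) = sqrt 2 * sqrt (Suc K)"
      by (simp add: real_sqrt_mult[symmetric])
    ultimately show ?thesis unfolding g_def by (simp only: minus_mult_left)
  qed
  have gi: "integrable lborel g" unfolding g_def by (intro integrable_mult_right integrable_herm_mult)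
  have gc: "continuous_on UNIV g" unfolding g_def by (intro continuous_intros continuous_herm)
  have main: "S x \<le> S b + sqrt (2 * Suc K)" if "x \<le> b" for b
  proof -
    have "has_bochner_integral lborel (\<lambda>t. indicator {x..b} t *\<^sub>R g t) (S b - S x)"
      using that D gc
      by (intro has_bochner_integral_FTC_Icc) 
        (auto simp: has_real_derivative_iff_has_vector_derivative[symmetric] 
          intro: has_field_derivative_at_within continuous_on_subset)
    then have "S b - S x = integral\<^sup>L lborel (\<lambda>t. indicator {x..b} t *\<^sub>R g t)"
      by (simp add: has_bochner_integral_iff)
    then have "S x - S b = integral\<^sup>L lborel (\<lambda>t. indicator {x..b} t *\<^sub>R (- g t))" by simp
    also have "\<dots> \<le> integral\<^sup>L lborel (\<lambda>t. sqrt (2 * Suc K) * \<bar>herm K t * herm (Suc K) t\<bar>)"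
    proof (rule integral_mono)
      show "integrable lborel (\<lambda>t. indicat_real {x..b} t *\<^sub>R - g t)"
        using gi by (intro integrable_mult_indicator) auto
      show "integrable lborel (\<lambda>t. sqrt (2 * Suc K) * \<bar>herm K t * herm (Suc K) t\<bar>)"
        by (intro integrable_mult_right integrable_abs integrable_herm_mult)
      show "indicat_real {x..b} t *\<^sub>R - g t \<le> sqrt (2 * Suc K) * \<bar>herm K t * herm (Suc K) t\<bar>" for t
        by (auto simp: g_def indicator_def intro!: mult_left_mono simp del: of_nat_Suc)
    qed
    also have "\<dots> = sqrt (2 * Suc K) * integral\<^sup>L lborel (\<lambda>t. \<bar>herm K t * herm (Suc K) t\<bar>)" by simp
    also have "\<dots> \<le> sqrt (2 * Suc K) * 1" by (intro mult_left_mono integral_abs_herm_mult_le) auto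
    finally show ?thesis by simp
  qed
  have "((\<lambda>b. S b + sqrt (2 * Suc K)) \<longlongrightarrow> 0 + sqrt (2 * Suc K)) at_top"
  proof (intro tendsto_intros)
    have "(herm k \<longlongrightarrow> 0) at_top" for k
    proof -
      obtain C where C: "\<bar>t\<bar> * \<bar>herm k t\<bar> \<le> C * exp (- t\<^sup>2 / 4)" for t using herm_decay[of 1 k] by auto
      have C0: "0 \<le> C" using C[of 0] by simp
      show ?thesis
      proof (rule Lim_null_comparison)
        have "\<bar>herm k t\<bar> \<le> C / t" if "t > 0" for t
        proof -
          have "t * \<bar>herm k t\<bar> \<le> C * exp (- t\<^sup>2 / 4)" using C[of t] that by simp
          also have "\<dots> \<le> C * 1" using C0 by (intro mult_left_mono) auto
          finally show ?thesis using that by (simp add: field_simps)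
        qed
        then show "\<forall>\<^sub>F t in at_top. norm (herm k t) \<le> C / t"
          by (intro eventually_mono[OF eventually_gt_at_top[of 0]]) simp
        show "((\<lambda>t. C / t) \<longlongrightarrow> 0) at_top"
          by (intro tendsto_divide_0[OF tendsto_const] filterlim_at_top_imp_at_infinity filterlim_ident)
      qed
    qed
    then have "((\<lambda>b. \<Sum>k\<le>K. (herm k b)\<^sup>2) \<longlongrightarrow> (\<Sum>k\<le>K. 0\<^sup>2)) at_top" by (intro tendsto_intros)
    then show "(S \<longlongrightarrow> 0) at_top" by (simp add: S_def[abs_def])
  qed
  then have "S x \<le> 0 + sqrt (2 * Suc K)"
    by (rule tendsto_lowerbound) (use main in \<open>auto intro!: eventually_at_top_linorderI[of x]\<close>)
  then show ?thesis by (simp add: S_def)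
qed

text \<open>Abel summation: the weighted sum of \<open>v - u\<close> is at least the last weight times its unweighted
  sum.\<close>

lemma sum_weighted_le_by_partial_sums:
  fixes u v w :: "nat \<Rightarrow> real"
  assumes "\<And>n. (\<Sum>k\<le>n. u k) \<le> (\<Sum>k\<le>n. v k)"
    and w0: "\<And>k. 0 \<le> w k" and dec: "\<And>k. w (Suc k) \<le> w k"
  shows "(\<Sum>k\<le>n. w k * u k) \<le> (\<Sum>k\<le>n. w k * v k)"
proof -
  have D: "0 \<le> (\<Sum>k\<le>n. v k - u k)" for n using assms(1)[of n] by (simp add: sum_subtractf)
  have "w n * (\<Sum>k\<le>n. v k - u k) \<le> (\<Sum>k\<le>n. w k * (v k - u k))"
  proof (induction n)
    case (Suc n)
    have "w (Suc n) * (\<Sum>k\<le>n. v k - u k) \<le> w n * (\<Sum>k\<le>n. v k - u k)"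
      using D dec by (intro mult_right_mono) auto
    with Suc show ?case by (simp add: algebra_simps)
  qed simp
  moreover have "0 \<le> w n * (\<Sum>k\<le>n. v k - u k)" using D w0 by auto
  ultimately have "0 \<le> (\<Sum>k\<le>n. w k * (v k - u k))" by linarith
  then show ?thesis by (simp add: algebra_simps sum_subtractf)
qed

text \<open>The bound on partial sums is compared with the sequence \<open>v\<close> whose partial sums equal \<open>sqrt
  (2 (K + 1))\<close>. As \<open>v\<close> decays like \<open>k\<close> to the power \<open>- 1 / 2\<close>, the condition on \<open>\<theta>\<close> is exactly
  what makes the weighted series of \<open>v\<close> converge.\<close>

lemma sum_herm_sq_weighted_bounded:
  assumes "\<theta> > 1 / 2"
  shows "\<exists>C\<ge>0. \<forall>x n. (\<Sum>k\<le>n. real (Suc k) powr (- \<theta>) * (herm k x)\<^sup>2) \<le> C"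
proof -
  define v where "v k = sqrt 2 * (sqrt (Suc k) - sqrt k)" for k
  have V: "(\<Sum>k\<le>n. v k) = sqrt (2 * Suc n)" for n
  proof -
    have "(\<Sum>k\<le>n. v k) = sqrt 2 * sqrt (Suc n)" by (induction n) (auto simp: v_def algebra_simps)
    then show ?thesis by (simp add: real_sqrt_mult[symmetric])
  qed
  have vle: "v k \<le> sqrt 2 * real (Suc k) powr (- 1 / 2)" for k
  proof -
    have "(sqrt (Suc k) - sqrt k) * sqrt (Suc k) = Suc k - sqrt k * sqrt (Suc k)"
      by (simp add: algebra_simps del: of_nat_Suc)
    also have "\<dots> \<le> Suc k - sqrt k * sqrt k" by (intro diff_left_mono mult_left_mono) auto
    also have "\<dots> = 1" by simp
    finally have "sqrt (Suc k) - sqrt k \<le> 1 / sqrt (Suc k)" by (simp add: pos_le_divide_eq)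
    also have "\<dots> = real (Suc k) powr (- 1 / 2)" 
      using powr_minus[of "real (Suc k)" "1/2"] by (simp add: powr_half_sqrt inverse_eq_divide del: of_nat_Suc)
    finally show ?thesis unfolding v_def by (intro mult_left_mono) auto
  qed
  have sm: "summable (\<lambda>k. real (Suc k) powr (- (\<theta> + 1 / 2)))"
    using assms by (subst summable_Suc_iff) (simp add: summable_real_powr_iff)
  define C where "C = sqrt 2 * (\<Sum>k. real (Suc k) powr (- (\<theta> + 1 / 2)))"
  have "(\<Sum>k\<le>n. real (Suc k) powr (- \<theta>) * (herm k x)\<^sup>2) \<le> C" for x n
  proof -
    have "(\<Sum>k\<le>n. real (Suc k) powr (- \<theta>) * (herm k x)\<^sup>2) \<le> (\<Sum>k\<le>n. real (Suc k) powr (- \<theta>) * v k)"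
    proof (rule sum_weighted_le_by_partial_sums)
      show "(\<Sum>k\<le>n. (herm k x)\<^sup>2) \<le> (\<Sum>k\<le>n. v k)" for n using sum_herm_sq_le V by metis
      show "real (Suc (Suc k)) powr - \<theta> \<le> real (Suc k) powr - \<theta>" for k
        using assms by (intro powr_mono2') auto
    qed auto
    also have "\<dots> \<le> (\<Sum>k\<le>n. sqrt 2 * real (Suc k) powr (- (\<theta> + 1 / 2)))"
    proof (rule sum_mono)
      fix k
      have "real (Suc k) powr (- \<theta>) * v k \<le> real (Suc k) powr (- \<theta>) * (sqrt 2 * real (Suc k) powr (- 1 / 2))"
        by (intro mult_left_mono vle) auto
      also have "\<dots> = sqrt 2 * (real (Suc k) powr (- \<theta>) * real (Suc k) powr (- 1 / 2))" by simp
      also have "real (Suc k) powr (- \<theta>) * real (Suc k) powr (- 1 / 2) = real (Suc k) powr (- (\<theta> + 1 / 2))"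
        by (simp add: powr_add[symmetric] del: of_nat_Suc)
      finally show "real (Suc k) powr (- \<theta>) * v k \<le> sqrt 2 * real (Suc k) powr (- (\<theta> + 1 / 2))" .
    qed
    also have "\<dots> = sqrt 2 * (\<Sum>k\<le>n. real (Suc k) powr (- (\<theta> + 1 / 2)))" by (simp only: sum_distrib_left)
    also have "\<dots> \<le> C" unfolding C_def
      by (intro mult_left_mono sum_le_suminf sm) auto
    finally show ?thesis .
  qed
  moreover have "C \<ge> 0" unfolding C_def by (intro mult_nonneg_nonneg suminf_nonneg sm) auto
  ultimately show ?thesis by blast
qed

lemma dherm_has_derivative:
  "(dherm k has_real_derivative (x\<^sup>2 - (2 * k + 1)) * herm k x) (at x)"
proof -
  have e1: "dherm k = (\<lambda>x. sqrt 2 * sqrt k * herm (k - 1) x - x * herm k x)"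
    by (rule ext) (rule dherm_eq(1))
  have e2: "((\<lambda>x. sqrt 2 * sqrt k * herm (k - 1) x - x * herm k x) has_real_derivative
     sqrt 2 * sqrt k * dherm (k - 1) x - (1 * herm k x + dherm k x * x)) (at x)"
    by (intro DERIV_diff DERIV_cmult DERIV_mult herm_has_derivative DERIV_ident)
  have e3: "sqrt 2 * sqrt k * dherm (k - 1) x - (1 * herm k x + dherm k x * x) = (x\<^sup>2 - (2 * real k + 1)) * herm k x"
  proof (cases k)
    case 0 then show ?thesis by (simp add: dherm_eq(1) algebra_simps power2_eq_square)
  next
    case (Suc j)
    have "sqrt 2 * sqrt k * dherm (k - 1) x = sqrt 2 * sqrt k * (x * herm j x) - (sqrt 2 * sqrt 2) * (sqrt k * sqrt k) * herm k x"
      using Suc unfolding dherm_eq(2)[of "k - 1"] by (simp add: algebra_simps del: of_nat_Suc real_sqrt_mult_self)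
    then show ?thesis using Suc by (simp add: dherm_eq(1) algebra_simps power2_eq_square)
  qed
  show ?thesis using e2 unfolding e3 by (subst e1)
qed

lemma continuous_dherm: "continuous_on UNIV (dherm k)"
  by (intro continuous_at_imp_continuous_on ballI DERIV_isCont[OF dherm_has_derivative])

section \<open>Products of functions of one coordinate\<close>

text \<open>Hermite functions, their partial derivatives and Gaussians all have this form, so that their
  integrals and derivatives reduce to one variable.\<close>

definition prodfun :: "('n::finite \<Rightarrow> real \<Rightarrow> real) \<Rightarrow> real^'n \<Rightarrow> real" where
  "prodfun f x = (\<Prod>i\<in>UNIV. f i (x $ i))"

lemma prodfun_split: "prodfun f x = f i (x $ i) * (\<Prod>j\<in>UNIV - {i}. f j (x $ j))"
  unfolding prodfun_def by (subst prod.remove[of _ i]) auto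

lemma prodfun_upd: "prodfun (f(i := g)) x = g (x $ i) * (\<Prod>j\<in>UNIV - {i}. f j (x $ j))"
  by (subst prodfun_split[of _ _ i]) (auto intro!: prod.cong)

lemma prodfun_mult: "prodfun f x * prodfun g x = prodfun (\<lambda>i t. f i t * g i t) x"
  by (simp add: prodfun_def prod.distrib)

lemma continuous_prodfun:
  assumes "\<And>i. continuous_on UNIV (f i)"
  shows "continuous_on UNIV (prodfun f)"
proof -
  have "continuous_on UNIV (\<lambda>x. f i (x $ i))" for i
    by (rule continuous_on_compose2[OF assms[of i]]) (auto intro!: continuous_intros)
  then show ?thesis unfolding prodfun_def[abs_def] by (intro continuous_intros) auto
qed

lemma Basis_vec_eq: "(Basis :: (real^'n::finite) set) = range (\<lambda>i. axis i 1)"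
  by (auto simp: Basis_vec_def)

lemma prodfun_integral:
  fixes f :: "'n::finite \<Rightarrow> real \<Rightarrow> real"
  assumes int: "\<And>i. integrable lborel (f i)"
  shows "integrable lborel (prodfun f)" "integral\<^sup>L lborel (prodfun f) = (\<Prod>i\<in>UNIV. integral\<^sup>L lborel (f i))"
proof -
  interpret product_sigma_finite "\<lambda>_::real^'n. lborel :: real measure"
    by (standard)
  \<comment> \<open>Lebesgue measure is the product over the set \<open>Basis\<close>; \<open>ax\<close> translates coordinates into basis
    vectors.\<close>
  define ax where "ax = (\<lambda>i::'n. axis i (1::real))"
  have inj: "inj ax" by (auto simp: ax_def inj_def axis_eq_axis)
  define g where "g b = f (inv ax b)" for b
  have gax: "g (ax i) = f i" for i using inj by (simp add: g_def)
  have B: "Basis = ax ` UNIV" by (simp add: ax_def Basis_vec_eq)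
  have fm[measurable]: "f i \<in> borel_measurable borel" for i using int[of i] by auto
  have gint: "integrable lborel (g b)" for b using int by (simp add: g_def)
  have pf: "prodfun f (\<Sum>b\<in>Basis. y b *\<^sub>R b) = (\<Prod>b\<in>Basis. g b (y b))" for y
  proof -
    have "(\<Sum>b\<in>Basis. y b *\<^sub>R b) $ i = y (ax i)" for i
    proof -
      have "(\<Sum>b\<in>Basis. y b *\<^sub>R b) $ i = (\<Sum>b\<in>Basis. y b *\<^sub>R b) \<bullet> ax i"
        by (simp add: ax_def inner_axis)
      also have "\<dots> = y (ax i)" by (rule inner_sum_left_Basis) (simp add: B)
      finally show ?thesis .
    qed
    then have "prodfun f (\<Sum>b\<in>Basis. y b *\<^sub>R b) = (\<Prod>i\<in>UNIV. g (ax i) (y (ax i)))"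
      by (simp add: prodfun_def gax)
    also have "\<dots> = (\<Prod>b\<in>Basis. g b (y b))"
      unfolding B using inj by (simp add: prod.reindex)
    finally show ?thesis .
  qed
  have pm[measurable]: "prodfun f \<in> borel_measurable borel"
  proof -
    have "(\<lambda>x. f i (x $ i)) \<in> borel_measurable borel" for i
      by (rule measurable_compose[OF _ fm]) (auto intro!: borel_measurable_continuous_onI continuous_intros)
    then show ?thesis unfolding prodfun_def[abs_def] by measurable
  qed
  have mm: "(\<lambda>f. \<Sum>b\<in>Basis. f b *\<^sub>R b) \<in> measurable (\<Pi>\<^sub>M b\<in>Basis. lborel) (borel :: (real^'n) measure)"
    by measurable
  have "integrable (\<Pi>\<^sub>M b\<in>Basis. lborel) (\<lambda>y. \<Prod>b\<in>Basis. g b (y b))"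
    by (intro product_integrable_prod gint) auto
  then show "integrable lborel (prodfun f)"
    by (subst lborel_eq, subst integrable_distr_eq[OF mm pm]) (simp add: pf)
  have "integral\<^sup>L lborel (prodfun f) = integral\<^sup>L (\<Pi>\<^sub>M b\<in>Basis. lborel) (\<lambda>y. \<Prod>b\<in>Basis. g b (y b))"
    by (subst lborel_eq, subst integral_distr[OF mm pm]) (simp add: pf)
  also have "\<dots> = (\<Prod>b\<in>Basis. integral\<^sup>L lborel (g b))"
    by (intro product_integral_prod gint) auto
  also have "\<dots> = (\<Prod>i\<in>UNIV. integral\<^sup>L lborel (f i))"
    unfolding B using inj by (simp add: prod.reindex gax)
  finally show "integral\<^sup>L lborel (prodfun f) = (\<Prod>i\<in>UNIV. integral\<^sup>L lborel (f i))" .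
qed

lemma norm_sq_vec: "(norm (x :: real^'n::finite))\<^sup>2 = (\<Sum>i\<in>UNIV. (x $ i)\<^sup>2)"
  by (simp add: norm_vec_def L2_set_def sum_nonneg)

abbreviation gauss :: "real \<Rightarrow> 'a::real_normed_vector \<Rightarrow> real" where
  "gauss s x \<equiv> exp (- s * (norm x)\<^sup>2)"

lemma exp_norm_sq_eq_prodfun:
  "exp (c * (norm (x :: real^'n::finite))\<^sup>2) = prodfun (\<lambda>_ t. exp (c * t\<^sup>2)) x"
  by (simp add: prodfun_def norm_sq_vec exp_sum sum_distrib_left)

lemma gaussian_integrable:
  assumes "c > 0" shows "integrable lborel (\<lambda>x::real^'n::finite. gauss c x)"
  unfolding exp_norm_sq_eq_prodfun using prodfun_integral(1)[OF gaussian_integrable_real[OF assms]] by simp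

lemma partial_eqI:
  assumes "(f has_derivative f') (at x)" shows "partial i f x = f' (axis i 1)"
  using frechet_derivative_at[OF assms] by (simp add: partial_def)

lemma prodfun_has_derivative:
  assumes "\<And>j t. (f j has_real_derivative f' j t) (at t)"
  shows "((\<lambda>x. complex_of_real (prodfun f x)) has_derivative
     (\<lambda>h. complex_of_real (\<Sum>i\<in>UNIV. h $ i * prodfun (f(i := f' i)) x))) (at x)"
proof -
  have "((\<lambda>x. f i (x $ i)) has_derivative (\<lambda>h. h $ i * f' i (x $ i))) (at x)" for i
  proof -
    have "((\<lambda>x. x $ i) has_derivative (\<lambda>h. h $ i)) (at x)"
      by (intro bounded_linear_imp_has_derivative bounded_linear_vec_nth)
    from has_derivative_compose[OF this assms[of i "x $ i", unfolded has_field_derivative_def]]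
    show ?thesis by (simp add: mult.commute)
  qed
  from has_derivative_prod[where I=UNIV and f="\<lambda>i x. f i (x $ i)" and f'="\<lambda>i h. h $ i * f' i (x $ i)", OF this]
  have "(prodfun f has_derivative (\<lambda>h. \<Sum>i\<in>UNIV. h $ i * f' i (x $ i) * (\<Prod>j\<in>UNIV - {i}. f j (x $ j)))) (at x)"
    unfolding prodfun_def[abs_def] by simp
  then have "(prodfun f has_derivative (\<lambda>h. \<Sum>i\<in>UNIV. h $ i * prodfun (f(i := f' i)) x)) (at x)"
    by (simp add: prodfun_upd mult.assoc)
  from bounded_linear.has_derivative[OF bounded_linear_of_real this] show ?thesis .
qed

lemma prodfun_partial:
  assumes "\<And>j t. (f j has_real_derivative f' j t) (at t)"
  shows "partial i (\<lambda>x. complex_of_real (prodfun f x)) = (\<lambda>x. complex_of_real (prodfun (f(i := f' i)) x))"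
proof
  fix x :: "real^'a"
  show "partial i (\<lambda>x. complex_of_real (prodfun f x)) x = complex_of_real (prodfun (f(i := f' i)) x)"
    by (subst partial_eqI[OF prodfun_has_derivative[OF assms]])
       (simp add: axis_def if_distrib[of "\<lambda>a. a * _"] cong: if_cong)
qed

lemma prodfun_C1:
  assumes "\<And>j t. (f j has_real_derivative f' j t) (at t)" and "\<And>j. continuous_on UNIV (f' j)"
  shows "C1 (\<lambda>x. complex_of_real (prodfun f x))"
  unfolding C1_def prodfun_partial[OF assms(1)]
proof (intro conjI allI)
  show "(\<lambda>x. complex_of_real (prodfun f x)) differentiable at x" for x
    using prodfun_has_derivative[of f f', OF assms(1)] unfolding differentiable_def by blast
  have "continuous_on UNIV (f j)" for j
    by (intro continuous_at_imp_continuous_on ballI DERIV_isCont[OF assms(1)])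
  then show "continuous_on UNIV (\<lambda>x. complex_of_real (prodfun (f(i := f' i)) x))" for i
    using assms(2) by (intro continuous_intros continuous_prodfun) auto
qed

section \<open>Hermite functions of several variables\<close>

definition Herm :: "('n::finite \<Rightarrow> nat) \<Rightarrow> real^'n \<Rightarrow> real" where
  "Herm \<alpha> = prodfun (\<lambda>i. herm (\<alpha> i))"

definition deg :: "('n::finite \<Rightarrow> nat) \<Rightarrow> nat" where
  "deg \<alpha> = (\<Sum>i\<in>UNIV. \<alpha> i)"

text \<open>Comparable to the eigenvalue \<open>2 |\<alpha>| + n\<close> and never 0; decay of multipliers is measured in
  it.\<close>

abbreviation deg1 :: "('n::finite \<Rightarrow> nat) \<Rightarrow> real" where
  "deg1 \<alpha> \<equiv> real (Suc (deg \<alpha>))"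

abbreviation cHerm :: "('n::finite \<Rightarrow> nat) \<Rightarrow> real^'n \<Rightarrow> complex" where
  "cHerm \<alpha> x \<equiv> complex_of_real (Herm \<alpha> x)"

lemma finite_deg: "finite {\<alpha> :: 'n::finite \<Rightarrow> nat. deg \<alpha> = k}"
proof (rule finite_subset)
  show "{\<alpha> :: 'n \<Rightarrow> nat. deg \<alpha> = k} \<subseteq> PiE UNIV (\<lambda>_. {..k})"
    unfolding deg_def by (auto simp: PiE_def intro: member_le_sum[of _ UNIV, simplified])
qed (auto intro: finite_PiE)

lemma deg_upd_Suc: "deg (\<alpha>(i := Suc (\<alpha> i))) = Suc (deg \<alpha>)"
  unfolding deg_def by (subst (1 2) sum.remove[of _ i]) auto

lemma deg_upd_pred: "0 < \<alpha> i \<Longrightarrow> Suc (deg (\<alpha>(i := \<alpha> i - 1))) = deg \<alpha>"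
  unfolding deg_def by (subst (1 2) sum.remove[of _ i]) auto

lemma deg_ge: "\<alpha> i \<le> deg \<alpha>"
  unfolding deg_def by (rule member_le_sum) auto

lemma continuous_Herm: "continuous_on UNIV (Herm \<alpha>)"
  unfolding Herm_def by (intro continuous_prodfun continuous_herm)

lemma measurable_Herm[measurable]: "Herm \<alpha> \<in> borel_measurable borel"
  by (intro borel_measurable_continuous_onI continuous_Herm)

lemma Herm_three_term:
  "sqrt 2 * x $ i * Herm \<alpha> x =
     sqrt (Suc (\<alpha> i)) * Herm (\<alpha>(i := Suc (\<alpha> i))) x + sqrt (\<alpha> i) * Herm (\<alpha>(i := \<alpha> i - 1)) x"
proof -
  have *: "Herm (\<alpha>(i := k)) x = herm k (x $ i) * (\<Prod>j\<in>UNIV - {i}. herm (\<alpha> j) (x $ j))" for k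
    unfolding Herm_def by (subst prodfun_split[of _ _ i]) (auto intro!: prod.cong)
  have "sqrt 2 * x $ i * Herm \<alpha> x = (sqrt 2 * x $ i * herm (\<alpha> i) (x $ i)) * (\<Prod>j\<in>UNIV - {i}. herm (\<alpha> j) (x $ j))"
    using *[of "\<alpha> i"] by simp
  also note herm_three_term
  finally show ?thesis unfolding * by (simp add: algebra_simps)
qed

lemma Herm_decay: "\<exists>C. \<forall>x. \<bar>Herm \<alpha> x\<bar> \<le> C * exp (- (norm x)\<^sup>2 / 4)"
proof -
  have "\<forall>k. \<exists>C. \<forall>x. \<bar>herm k x\<bar> \<le> C * exp (- x\<^sup>2 / 4)" using herm_decay[of 0] by simp
  then obtain C where C: "\<bar>herm k x\<bar> \<le> C k * exp (- x\<^sup>2 / 4)" for k x by metis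
  have "\<bar>Herm \<alpha> x\<bar> \<le> (\<Prod>i\<in>UNIV. C (\<alpha> i)) * exp (- (norm x)\<^sup>2 / 4)" for x
  proof -
    have "\<bar>Herm \<alpha> x\<bar> = (\<Prod>i\<in>UNIV. \<bar>herm (\<alpha> i) (x $ i)\<bar>)" by (simp add: Herm_def prodfun_def abs_prod)
    also have "\<dots> \<le> (\<Prod>i\<in>UNIV. C (\<alpha> i) * exp (- (x $ i)\<^sup>2 / 4))" using C by (intro prod_mono) auto
    also have "\<dots> = (\<Prod>i\<in>UNIV. C (\<alpha> i)) * exp (\<Sum>i\<in>UNIV. - (x $ i)\<^sup>2 / 4)"
      by (simp add: prod.distrib exp_sum)
    also have "(\<Sum>i\<in>UNIV. - (x $ i)\<^sup>2 / 4) = - (norm x)\<^sup>2 / 4"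
      by (simp add: norm_sq_vec sum_negf sum_divide_distrib)
    finally show ?thesis .
  qed
  then show ?thesis by blast
qed

lemma integrable_Herm_mult: "integrable lebesgue (\<lambda>x. Herm \<alpha> x * Herm \<beta> x)"
proof -
  have "integrable lborel (\<lambda>x. Herm \<alpha> x * Herm \<beta> x)"
    unfolding Herm_def prodfun_mult by (intro prodfun_integral integrable_herm_mult)
  then show ?thesis by (subst integrable_completion) auto
qed

lemma Herm_orthonormal:
  "integral\<^sup>L lebesgue (\<lambda>x. Herm \<alpha> x * Herm \<beta> x) = (if \<alpha> = \<beta> then 1 else 0)"
proof -
  have "integral\<^sup>L lebesgue (\<lambda>x. Herm \<alpha> x * Herm \<beta> x) = integral\<^sup>L lborel (\<lambda>x. Herm \<alpha> x * Herm \<beta> x)"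
    by (rule integral_completion) measurable
  also have "\<dots> = (\<Prod>i\<in>UNIV. if \<alpha> i = \<beta> i then 1 else 0)"
    unfolding Herm_def prodfun_mult
    by (subst prodfun_integral(2)) (auto simp: integrable_herm_mult herm_orthonormal)
  also have "\<dots> = (if \<alpha> = \<beta> then 1 else 0)" by (auto simp: fun_eq_iff)
  finally show ?thesis .
qed

lemma Herm_partial:
  "partial i (\<lambda>x. cHerm \<alpha> x) = (\<lambda>x. complex_of_real (prodfun ((\<lambda>i. herm (\<alpha> i))(i := dherm (\<alpha> i))) x))"
  unfolding Herm_def by (rule prodfun_partial) (rule herm_has_derivative)

lemma dHerm_eq: "prodfun ((\<lambda>i. herm (\<alpha> i))(i := dherm (\<alpha> i))) x =
   (sqrt (\<alpha> i) * Herm (\<alpha>(i := \<alpha> i - 1)) x - sqrt (Suc (\<alpha> i)) * Herm (\<alpha>(i := Suc (\<alpha> i))) x) / sqrt 2"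
proof -
  have *: "Herm (\<alpha>(i := k)) x = herm k (x $ i) * (\<Prod>j\<in>UNIV - {i}. herm (\<alpha> j) (x $ j))" for k
    unfolding Herm_def by (subst prodfun_split[of _ _ i]) (auto intro!: prod.cong)
  show ?thesis unfolding prodfun_upd * dherm_def by (simp add: algebra_simps add_divide_distrib diff_divide_distrib)
qed

lemma Herm_dfactor:
  "((((\<lambda>i. herm (\<alpha> i))(i := dherm (\<alpha> i))) j) has_real_derivative
     ((\<lambda>i. dherm (\<alpha> i))(i := \<lambda>x. (x\<^sup>2 - (2 * \<alpha> i + 1)) * herm (\<alpha> i) x)) j t) (at t)"
  using herm_has_derivative dherm_has_derivative by auto

lemma Herm_C2: "C2 (\<lambda>x. cHerm \<alpha> x)"
proof -
  have "C1 (\<lambda>x. cHerm \<alpha> x)"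
    unfolding Herm_def by (rule prodfun_C1[OF herm_has_derivative continuous_dherm])
  moreover have "C1 (partial i (\<lambda>x. cHerm \<alpha> x))" for i
    unfolding Herm_partial
    by (rule prodfun_C1[OF Herm_dfactor]) (auto intro!: continuous_intros continuous_dherm continuous_herm)
  ultimately show ?thesis by (simp add: C2_def)
qed

lemma Herm_partial_partial:
  "partial i (partial i (\<lambda>x. cHerm \<alpha> x)) x
     = complex_of_real (((x $ i)\<^sup>2 - (2 * \<alpha> i + 1)) * Herm \<alpha> x)"
proof -
  have "partial i (partial i (\<lambda>x. cHerm \<alpha> x)) x =
    complex_of_real (prodfun ((\<lambda>i. herm (\<alpha> i))(i := \<lambda>x. (x\<^sup>2 - (2 * \<alpha> i + 1)) * herm (\<alpha> i) x)) x)"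
    unfolding Herm_partial by (subst prodfun_partial[OF Herm_dfactor]) (simp add: add.commute)
  also have "prodfun ((\<lambda>i. herm (\<alpha> i))(i := \<lambda>x. (x\<^sup>2 - (2 * \<alpha> i + 1)) * herm (\<alpha> i) x)) x =
     ((x $ i)\<^sup>2 - (2 * \<alpha> i + 1)) * Herm \<alpha> x"
    unfolding prodfun_upd by (simp add: Herm_def prodfun_split[of _ x i])
  finally show ?thesis .
qed

lemma Herm_eigen:
  "hermite_op (\<lambda>x::real^'n::finite. cHerm \<alpha> x) x
     = of_nat (2 * deg \<alpha> + CARD('n)) * cHerm \<alpha> x"
proof -
  have "(\<Sum>i\<in>UNIV. ((x $ i)\<^sup>2 - (2 * \<alpha> i + 1)) * Herm \<alpha> x) = ((norm x)\<^sup>2 - (2 * deg \<alpha> + CARD('n))) * Herm \<alpha> x"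
    by (simp add: sum_distrib_right[symmetric] norm_sq_vec sum_subtractf sum.distrib deg_def sum_distrib_left)
  then have *: "(\<Sum>i\<in>UNIV. complex_of_real (((x $ i)\<^sup>2 - (2 * \<alpha> i + 1)) * Herm \<alpha> x)) = complex_of_real (((norm x)\<^sup>2 - (2 * deg \<alpha> + CARD('n))) * Herm \<alpha> x)"
    unfolding of_real_sum[symmetric] by simp
  show ?thesis unfolding hermite_op_def Herm_partial_partial * by (simp add: algebra_simps)
qed

lemma Herm_sq_integrable: "square_integrable (\<lambda>x. cHerm \<alpha> x)"
  unfolding square_integrable_def
proof
  show "(\<lambda>x. cHerm \<alpha> x) \<in> borel_measurable lebesgue"
    by (rule measurable_completion) measurable
  show "integrable lebesgue (\<lambda>x. (cmod (cHerm \<alpha> x))\<^sup>2)"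
    using integrable_Herm_mult[of \<alpha> \<alpha>] by (simp add: power2_eq_square)
qed

lemma Herm_in_eigenspace: "(\<lambda>x. cHerm \<alpha> x) \<in> hermite_eigenspace (deg \<alpha>)"
  unfolding hermite_eigenspace_def using Herm_C2 Herm_sq_integrable Herm_eigen by blast

section \<open>Weighted estimates for Hermite expansions\<close>

text \<open>Every \<open>\<alpha>\<^sub>i + 1\<close> is at most \<open>|\<alpha>| + 1\<close>, so the \<open>l\<close>-th power of the latter dominates the
  product of the \<open>(\<alpha>\<^sub>i + 1)\<close> to the power \<open>\<theta> = l / n\<close>. The sum is then at most a product of \<open>n\<close>
  sums on the line, which are bounded because \<open>\<theta> > 1 / 2\<close>.\<close>

lemma sum_Herm_sq_bounded:
  assumes "CARD('n::finite) < 2 * l"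
  shows "\<exists>C. \<forall>(x::real^'n) A. finite A \<longrightarrow> (\<Sum>\<alpha>\<in>A. (Herm \<alpha> x)\<^sup>2 / deg1 \<alpha> ^ l) \<le> C"
proof -
  define n where "n = CARD('n)"
  have n: "n > 0" by (simp add: n_def)
  define \<theta> where "\<theta> = real l / real n"
  have "\<theta> > 1 / 2" using assms n unfolding \<theta>_def n_def[symmetric] by (simp add: field_simps)
  then obtain C where C: "C \<ge> 0" "\<And>x m. (\<Sum>k\<le>m. real (Suc k) powr (- \<theta>) * (herm k x)\<^sup>2) \<le> C"
    using sum_herm_sq_weighted_bounded by blast
  have "(\<Sum>\<alpha>\<in>A. (Herm \<alpha> x)\<^sup>2 / deg1 \<alpha> ^ l) \<le> C ^ n" if A: "finite A" for x :: "real^'n" and A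
  proof -
    define g where "g i k = real (Suc k) powr (- \<theta>) * (herm k (x $ i))\<^sup>2" for i k
    define K where "K = Max (insert 0 (deg ` A))"
    have sub: "A \<subseteq> PiE UNIV (\<lambda>_. {..K})"
    proof
      fix \<alpha> assume "\<alpha> \<in> A"
      then have "deg \<alpha> \<le> K" unfolding K_def using A by (intro Max_ge) auto
      then show "\<alpha> \<in> PiE UNIV (\<lambda>_. {..K})" using deg_ge order_trans by (fastforce simp: PiE_def)
    qed
    have "(Herm \<alpha> x)\<^sup>2 / deg1 \<alpha> ^ l \<le> (\<Prod>i\<in>UNIV. g i (\<alpha> i))" for \<alpha>
    proof -
      define S where "S = deg1 \<alpha>"
      have S: "S > 0" by (simp add: S_def)
      have "(\<Prod>i\<in>(UNIV::'n set). real (Suc (\<alpha> i)) powr \<theta>) \<le> (\<Prod>i\<in>(UNIV::'n set). S powr \<theta>)"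
        using deg_ge[of \<alpha>] by (intro prod_mono conjI powr_mono2) (auto simp: S_def \<theta>_def)
      also have "\<dots> = S powr (\<theta> * n)" using S by (simp add: n_def powr_powr[symmetric] powr_realpow)
      also have "\<theta> * n = l" using n by (simp add: \<theta>_def)
      also have "S powr l = S ^ l" using S by (simp add: powr_realpow)
      finally have P: "(\<Prod>i\<in>(UNIV::'n set). real (Suc (\<alpha> i)) powr \<theta>) \<le> S ^ l" .
      have P0: "0 < (\<Prod>i\<in>(UNIV::'n set). real (Suc (\<alpha> i)) powr \<theta>)" by (intro prod_pos) auto
      have "(Herm \<alpha> x)\<^sup>2 / S ^ l \<le> (Herm \<alpha> x)\<^sup>2 / (\<Prod>i\<in>(UNIV::'n set). real (Suc (\<alpha> i)) powr \<theta>)"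
        using P P0 S by (intro divide_left_mono) auto
      also have "\<dots> = (\<Prod>i\<in>UNIV. g i (\<alpha> i))"
        by (simp add: g_def prod.distrib Herm_def prodfun_def prod_power_distrib powr_minus
              prod_inversef[symmetric] divide_inverse mult.commute o_def)
      finally show ?thesis unfolding S_def .
    qed
    then have "(\<Sum>\<alpha>\<in>A. (Herm \<alpha> x)\<^sup>2 / deg1 \<alpha> ^ l) \<le> (\<Sum>\<alpha>\<in>A. \<Prod>i\<in>UNIV. g i (\<alpha> i))"
      by (intro sum_mono) auto
    also have "\<dots> \<le> (\<Sum>\<alpha>\<in>PiE UNIV (\<lambda>_. {..K}). \<Prod>i\<in>UNIV. g i (\<alpha> i))"
      using sub by (intro sum_mono2 finite_PiE) (auto simp: g_def intro!: prod_nonneg)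
    also have "\<dots> = (\<Prod>i\<in>UNIV. \<Sum>k\<le>K. g i k)" by (rule prod_sum_PiE[symmetric]) auto
    also have "\<dots> \<le> (\<Prod>i\<in>(UNIV::'n set). C)"
      using C(2)[of _ K] by (intro prod_mono conjI) (auto simp: g_def intro!: sum_nonneg)
    also have "\<dots> = C ^ n" by (simp add: n_def)
    finally show ?thesis .
  qed
  then show ?thesis by blast
qed

lemma inj_on_upd_Suc: "inj (\<lambda>\<alpha> :: 'n \<Rightarrow> nat. \<alpha>(i := Suc (\<alpha> i)))"
proof (rule injI)
  fix \<alpha> \<beta> :: "'n \<Rightarrow> nat" assume e: "\<alpha>(i := Suc (\<alpha> i)) = \<beta>(i := Suc (\<beta> i))"
  show "\<alpha> = \<beta>"
  proof
    fix j show "\<alpha> j = \<beta> j" using fun_cong[OF e, of j] by (cases "j = i") auto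
  qed
qed

lemma inj_on_upd_pred: "inj_on (\<lambda>\<alpha> :: 'n \<Rightarrow> nat. \<alpha>(i := \<alpha> i - 1)) {\<alpha>. 0 < \<alpha> i}"
proof (rule inj_onI)
  fix \<alpha> \<beta> :: "'n \<Rightarrow> nat" assume p: "\<alpha> \<in> {\<alpha>. 0 < \<alpha> i}" "\<beta> \<in> {\<alpha>. 0 < \<alpha> i}" and e: "\<alpha>(i := \<alpha> i - 1) = \<beta>(i := \<beta> i - 1)"
  show "\<alpha> = \<beta>"
  proof
    fix j show "\<alpha> j = \<beta> j" using fun_cong[OF e, of j] p by (cases "j = i") auto
  qed
qed

lemma coordinate_sq_Herm_le:
  "(x $ i)\<^sup>2 * (Herm \<alpha> x)\<^sup>2 \<le>
     real (Suc (\<alpha> i)) * (Herm (\<alpha>(i := Suc (\<alpha> i))) x)\<^sup>2 + real (\<alpha> i) * (Herm (\<alpha>(i := \<alpha> i - 1)) x)\<^sup>2"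
proof -
  define p where "p = sqrt (Suc (\<alpha> i)) * Herm (\<alpha>(i := Suc (\<alpha> i))) x"
  define q where "q = sqrt (\<alpha> i) * Herm (\<alpha>(i := \<alpha> i - 1)) x"
  have "2 * ((x $ i)\<^sup>2 * (Herm \<alpha> x)\<^sup>2) = (sqrt 2 * x $ i * Herm \<alpha> x)\<^sup>2" by (simp add: power_mult_distrib)
  also have "\<dots> = (p + q)\<^sup>2" by (simp add: Herm_three_term p_def q_def)
  also have "\<dots> \<le> 2 * (p\<^sup>2 + q\<^sup>2)" using sum_squares_bound[of p q] by (simp add: power2_sum)
  finally have "(x $ i)\<^sup>2 * (Herm \<alpha> x)\<^sup>2 \<le> p\<^sup>2 + q\<^sup>2" by simp
  then show ?thesis by (simp add: p_def q_def power_mult_distrib)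
qed

text \<open>A factor \<open>x\<^sub>i\<^sup>2\<close> moves \<open>\<alpha>\<close> to its two neighbours in direction \<open>i\<close> and costs one factor \<open>|\<alpha>|
  + 1\<close>, which the additional power in the denominator pays. The moves are injective, so the sums
  over the neighbours are again sums over finite sets of multi-indices. The power of 2 appears
  since raising the degree may double \<open>|\<alpha>| + 1\<close>.\<close>

lemma sum_coordinate_Herm_sq_bounded:
  assumes "CARD('n::finite) < 2 * l"
  shows "\<exists>C. \<forall>(x::real^'n) A. finite A \<longrightarrow>
    (\<Sum>\<alpha>\<in>A. (x $ i) ^ (2 * m) * (Herm \<alpha> x)\<^sup>2 / deg1 \<alpha> ^ (l + m)) \<le> C"
proof (induction m)
  case 0
  then show ?case using sum_Herm_sq_bounded[OF assms] by simp
next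
  case (Suc m)
  define g where "g \<alpha> x = (x $ i) ^ (2 * m) * (Herm \<alpha> x)\<^sup>2 / deg1 \<alpha> ^ (l + m)" for \<alpha> and x :: "real^'n"
  have g0: "0 \<le> g \<alpha> x" for \<alpha> x by (simp add: g_def)
  obtain C where C: "finite A \<Longrightarrow> (\<Sum>\<alpha>\<in>A. g \<alpha> x) \<le> C" for x A using Suc by (auto simp: g_def)
  have "(\<Sum>\<alpha>\<in>A. (x $ i) ^ (2 * Suc m) * (Herm \<alpha> x)\<^sup>2 / deg1 \<alpha> ^ (l + Suc m)) \<le> 2 ^ (l + m) * C + C"
    if A: "finite A" for x A
  proof -
    let ?up = "\<lambda>\<alpha>. \<alpha>(i := Suc (\<alpha> i))" and ?dn = "\<lambda>\<alpha>. \<alpha>(i := \<alpha> i - 1)"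
    have tm: "(x $ i) ^ (2 * Suc m) * (Herm \<alpha> x)\<^sup>2 / deg1 \<alpha> ^ (l + Suc m) \<le>
       2 ^ (l + m) * g (?up \<alpha>) x + (if 0 < \<alpha> i then g (?dn \<alpha>) x else 0)" for \<alpha>
    proof -
      define S where "S = deg1 \<alpha>"
      have S: "S \<ge> 1" by (simp add: S_def)
      have a: "real (Suc (\<alpha> i)) \<le> S" "real (\<alpha> i) \<le> S" using deg_ge[of \<alpha> i] by (auto simp: S_def)
      have "(x $ i) ^ (2 * Suc m) * (Herm \<alpha> x)\<^sup>2 / S ^ (l + Suc m) = (x $ i) ^ (2 * m) / S ^ (l + Suc m) * ((x $ i)\<^sup>2 * (Herm \<alpha> x)\<^sup>2)"
        by (simp add: power2_eq_square)
      also have "\<dots> \<le> (x $ i) ^ (2 * m) / S ^ (l + Suc m) * (real (Suc (\<alpha> i)) * (Herm (?up \<alpha>) x)\<^sup>2 + real (\<alpha> i) * (Herm (?dn \<alpha>) x)\<^sup>2)"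
        using S by (intro mult_left_mono coordinate_sq_Herm_le) auto
      also have "\<dots> \<le> (x $ i) ^ (2 * m) / S ^ (l + Suc m) * (S * (Herm (?up \<alpha>) x)\<^sup>2 + (if 0 < \<alpha> i then S * (Herm (?dn \<alpha>) x)\<^sup>2 else 0))"
        using S a by (intro mult_left_mono add_mono) (auto intro!: mult_right_mono)
      also have "\<dots> = (x $ i) ^ (2 * m) * (Herm (?up \<alpha>) x)\<^sup>2 / S ^ (l + m) +
         (if 0 < \<alpha> i then (x $ i) ^ (2 * m) * (Herm (?dn \<alpha>) x)\<^sup>2 / S ^ (l + m) else 0)"
        using S by (auto simp: field_simps)
      also have "\<dots> \<le> 2 ^ (l + m) * g (?up \<alpha>) x + (if 0 < \<alpha> i then g (?dn \<alpha>) x else 0)"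
      proof (intro add_mono)
        have "deg1 (?up \<alpha>) ^ (l + m) \<le> (2 * S) ^ (l + m)"
          by (intro power_mono) (auto simp: deg_upd_Suc S_def)
        then have "1 / S ^ (l + m) \<le> 2 ^ (l + m) / deg1 (?up \<alpha>) ^ (l + m)"
          using S by (simp add: field_simps power_mult_distrib del: of_nat_Suc)
        then have "(x $ i) ^ (2 * m) * (Herm (?up \<alpha>) x)\<^sup>2 * (1 / S ^ (l + m)) \<le>
            (x $ i) ^ (2 * m) * (Herm (?up \<alpha>) x)\<^sup>2 * (2 ^ (l + m) / deg1 (?up \<alpha>) ^ (l + m))"
          by (intro mult_left_mono) auto
        then show "(x $ i) ^ (2 * m) * (Herm (?up \<alpha>) x)\<^sup>2 / S ^ (l + m) \<le> 2 ^ (l + m) * g (?up \<alpha>) x"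
          by (simp add: g_def mult_ac)
        show "(if 0 < \<alpha> i then (x $ i) ^ (2 * m) * (Herm (?dn \<alpha>) x)\<^sup>2 / S ^ (l + m) else 0) \<le> (if 0 < \<alpha> i then g (?dn \<alpha>) x else 0)"
        proof (cases "0 < \<alpha> i")
          case True
          have "deg1 (?dn \<alpha>) ^ (l + m) \<le> S ^ (l + m)"
            using deg_upd_pred[of \<alpha> i, OF True] by (intro power_mono) (auto simp: S_def)
          then show ?thesis using True unfolding g_def by (auto intro!: divide_left_mono simp del: of_nat_Suc simp: S_def)
        qed simp
      qed
      finally show ?thesis unfolding S_def .
    qed
    have "(\<Sum>\<alpha>\<in>A. (x $ i) ^ (2 * Suc m) * (Herm \<alpha> x)\<^sup>2 / deg1 \<alpha> ^ (l + Suc m)) \<le>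
      (\<Sum>\<alpha>\<in>A. 2 ^ (l + m) * g (?up \<alpha>) x + (if 0 < \<alpha> i then g (?dn \<alpha>) x else 0))"
      by (intro sum_mono tm)
    also have "\<dots> = 2 ^ (l + m) * (\<Sum>\<alpha>\<in>A. g (?up \<alpha>) x) + (\<Sum>\<alpha>\<in>A \<inter> {\<alpha>. 0 < \<alpha> i}. g (?dn \<alpha>) x)"
      using A by (simp add: sum.distrib sum_distrib_left sum.inter_restrict del: One_nat_def)
    also have "(\<Sum>\<alpha>\<in>A. g (?up \<alpha>) x) = (\<Sum>\<alpha>\<in>?up ` A. g \<alpha> x)"
      by (subst sum.reindex) (auto intro: inj_on_subset[OF inj_on_upd_Suc])
    also have "(\<Sum>\<alpha>\<in>A \<inter> {\<alpha>. 0 < \<alpha> i}. g (?dn \<alpha>) x) = (\<Sum>\<alpha>\<in>?dn ` (A \<inter> {\<alpha>. 0 < \<alpha> i}). g \<alpha> x)"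
      by (subst sum.reindex[OF inj_on_subset[OF inj_on_upd_pred]]) (auto simp: o_def)
    also have "2 ^ (l + m) * (\<Sum>\<alpha>\<in>?up ` A. g \<alpha> x) + (\<Sum>\<alpha>\<in>?dn ` (A \<inter> {\<alpha>. 0 < \<alpha> i}). g \<alpha> x) \<le> 2 ^ (l + m) * C + C"
      using A by (intro add_mono mult_left_mono C) auto
    finally show ?thesis .
  qed
  then show ?case by blast
qed

text \<open>Parseval's identity. The index map \<open>\<phi>\<close> leaves room for shifted multi-indices: multiplying an
  expansion by a coordinate keeps the index set and changes only \<open>\<phi>\<close> and the coefficients.\<close>

lemma Herm_expansion_L2:
  assumes B: "finite B" and inj: "inj_on \<phi> B"
  shows "integrable lebesgue (\<lambda>y. (\<Sum>b\<in>B. d b * Herm (\<phi> b) y)\<^sup>2)"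
    "integral\<^sup>L lebesgue (\<lambda>y. (\<Sum>b\<in>B. d b * Herm (\<phi> b) y)\<^sup>2) = (\<Sum>b\<in>B. (d b :: real)\<^sup>2)"
proof -
  have eq: "(\<lambda>y. (\<Sum>b\<in>B. d b * Herm (\<phi> b) y)\<^sup>2) = (\<lambda>y. \<Sum>b\<in>B. \<Sum>c\<in>B. d b * d c * (Herm (\<phi> b) y * Herm (\<phi> c) y))"
    by (rule ext) (simp add: power2_eq_square sum_product mult_ac)
  show "integrable lebesgue (\<lambda>y. (\<Sum>b\<in>B. d b * Herm (\<phi> b) y)\<^sup>2)"
    unfolding eq by (intro Bochner_Integration.integrable_sum integrable_mult_right integrable_Herm_mult)
  have "integral\<^sup>L lebesgue (\<lambda>y. (\<Sum>b\<in>B. d b * Herm (\<phi> b) y)\<^sup>2) = (\<Sum>b\<in>B. \<Sum>c\<in>B. d b * d c * (if \<phi> b = \<phi> c then 1 else 0))"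
    unfolding eq by (simp add: Bochner_Integration.integral_sum integrable_Herm_mult Herm_orthonormal)
  also have "\<dots> = (\<Sum>b\<in>B. \<Sum>c\<in>B. if b = c then d b * d c else 0)"
    using inj by (intro sum.cong refl) (auto simp: inj_on_eq_iff)
  also have "\<dots> = (\<Sum>b\<in>B. (d b)\<^sup>2)" using B by (simp add: power2_eq_square)
  finally show "integral\<^sup>L lebesgue (\<lambda>y. (\<Sum>b\<in>B. d b * Herm (\<phi> b) y)\<^sup>2) = (\<Sum>b\<in>B. (d b)\<^sup>2)" .
qed

text \<open>The contribution of \<open>h\<^sub>\<alpha>\<close> at the point \<open>x\<close> to the weighted kernel estimate: the first term
  comes from the powers of \<open>y\<close> in the weight, the second from the powers of \<open>x\<close>.\<close>

definition hweight :: "nat \<Rightarrow> ('n::finite \<Rightarrow> nat) \<Rightarrow> real^'n \<Rightarrow> real" where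
  "hweight l \<alpha> x = (Herm \<alpha> x)\<^sup>2 / deg1 \<alpha> ^ l +
     (\<Sum>i\<in>UNIV. (x $ i) ^ (2 * l) * (Herm \<alpha> x)\<^sup>2 / deg1 \<alpha> ^ (l + l))"

lemma hweight_nonneg: "0 \<le> hweight l \<alpha> x"
  unfolding hweight_def by (intro add_nonneg_nonneg sum_nonneg) auto

lemma sum_hweight_bounded:
  assumes "CARD('n::finite) < 2 * l"
  shows "\<exists>C. \<forall>(x::real^'n) A. finite A \<longrightarrow> (\<Sum>\<alpha>\<in>A. hweight l \<alpha> x) \<le> C"
proof -
  obtain C where C: "\<And>(x::real^'n) A. finite A \<Longrightarrow> (\<Sum>\<alpha>\<in>A. (Herm \<alpha> x)\<^sup>2 / deg1 \<alpha> ^ l) \<le> C"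
    using sum_Herm_sq_bounded[OF assms] by blast
  have "\<forall>i. \<exists>C. \<forall>(x::real^'n) A. finite A \<longrightarrow>
    (\<Sum>\<alpha>\<in>A. (x $ i) ^ (2 * l) * (Herm \<alpha> x)\<^sup>2 / deg1 \<alpha> ^ (l + l)) \<le> C"
    using sum_coordinate_Herm_sq_bounded[OF assms] by blast
  from choice[OF this] obtain D where DD: "\<forall>i. \<forall>(x::real^'n) A. finite A \<longrightarrow>
    (\<Sum>\<alpha>\<in>A. (x $ i) ^ (2 * l) * (Herm \<alpha> x)\<^sup>2 / deg1 \<alpha> ^ (l + l)) \<le> D i" by (rule exE)
  note D = DD[rule_format]
  have "(\<Sum>\<alpha>\<in>A. hweight l \<alpha> x) \<le> C + (\<Sum>i\<in>UNIV. D i)" if "finite A" for x :: "real^'n" and A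
    unfolding hweight_def sum.distrib using C[OF that] D[OF that]
    by (subst sum.swap) (intro add_mono sum_mono)
  then show ?thesis by blast
qed

text \<open>The kernel of the operator is square integrable in \<open>y\<close> against this weight, and \<open>f\<close> against
  its reciprocal.\<close>

abbreviation wt :: "nat \<Rightarrow> 'a::real_normed_vector \<Rightarrow> 'a \<Rightarrow> real" where
  "wt l x y \<equiv> (1 + norm (x - y)) ^ (2 * l)"

text \<open>An upper bound for a Bochner integral says nothing without integrability, as the integral of
  a non-integrable function is 0; the two are therefore propagated together.\<close>

definition integral_at_most :: "'a measure \<Rightarrow> ('a \<Rightarrow> real) \<Rightarrow> real \<Rightarrow> bool" where
  "integral_at_most M f c \<longleftrightarrow> integrable M f \<and> integral\<^sup>L M f \<le> c"

lemma integral_at_most_add: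
  "integral_at_most M f c \<Longrightarrow> integral_at_most M g d \<Longrightarrow> integral_at_most M (\<lambda>x. f x + g x) (c + d)"
  by (simp add: integral_at_most_def)

lemma integral_at_most_cmult:
  "integral_at_most M f c \<Longrightarrow> 0 \<le> t \<Longrightarrow> integral_at_most M (\<lambda>x. t * f x) (t * c)"
  by (simp add: integral_at_most_def mult_left_mono)

lemma integral_at_most_sum:
  "(\<And>i. i \<in> I \<Longrightarrow> integral_at_most M (f i) (c i)) \<Longrightarrow>
    integral_at_most M (\<lambda>x. \<Sum>i\<in>I. f i x) (\<Sum>i\<in>I. c i)"
  by (auto simp: integral_at_most_def Bochner_Integration.integral_sum intro!: sum_mono)

lemma integral_at_most_weaken: "integral_at_most M f c \<Longrightarrow> c \<le> d \<Longrightarrow> integral_at_most M f d"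
  by (simp add: integral_at_most_def)

lemma integral_at_most_mono:
  assumes "integral_at_most M g c" "f \<in> borel_measurable M" "\<And>x. 0 \<le> f x" "\<And>x. f x \<le> g x" "c \<le> d"
  shows "integral_at_most M f d"
proof -
  have g: "integrable M g" "integral\<^sup>L M g \<le> c" using assms(1) by (auto simp: integral_at_most_def)
  have f: "integrable M f" by (rule integrable_dominated[OF g(1) assms(2)]) (use assms(3,4) in simp)
  have "integral\<^sup>L M f \<le> integral\<^sup>L M g" by (rule integral_mono[OF f g(1) assms(4)])
  then show ?thesis using f g(2) assms(5) by (simp add: integral_at_most_def)
qed

text \<open>Each factor \<open>y\<^sub>i\<^sup>2\<close> splits an expansion into a raised part, for which the doubled degree
  costs \<open>2\<^sup>m\<close>, and a lowered part, which costs nothing.\<close>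

primrec moment_const :: "nat \<Rightarrow> real" where
  "moment_const 0 = 1"
| "moment_const (Suc m) = moment_const m * (2 ^ m + 1)"

lemma moment_const_nonneg: "0 \<le> moment_const m"
  by (induction m) auto

text \<open>By the three-term recursion \<open>y\<^sub>i\<close> times the expansion is the sum \<open>p + q\<close> of an expansion
  with raised and one with lowered indices, whose coefficients have grown by at most the square
  root of \<open>(|\<alpha>| + 1) / 2\<close>; then \<open>(p + q)\<^sup>2 \<le> 2 p\<^sup>2 + 2 q\<^sup>2\<close> and the induction hypothesis applies
  to both.\<close>

lemma Herm_expansion_moment:
  assumes "finite B" "inj_on \<phi> B"
  shows "integral_at_most lebesgue (\<lambda>y. (y $ i) ^ (2 * m) * (\<Sum>b\<in>B. d b * Herm (\<phi> b) y)\<^sup>2)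
     (moment_const m * (\<Sum>b\<in>B. (d b)\<^sup>2 * deg1 (\<phi> b) ^ m))"
  using assms
proof (induction m arbitrary: B \<phi> d)
  case 0
  then show ?case by (simp add: integral_at_most_def Herm_expansion_L2)
next
  case (Suc m)
  note B = Suc.prems(1) and inj = Suc.prems(2)
  let ?up = "\<lambda>\<alpha>. \<alpha>(i := Suc (\<alpha> i))" and ?dn = "\<lambda>\<alpha>. \<alpha>(i := \<alpha> i - 1)"
  define B' where "B' = {b \<in> B. 0 < \<phi> b i}"
  define up where "up b = ?up (\<phi> b)" for b
  define dn where "dn b = ?dn (\<phi> b)" for b
  define d1 where "d1 b = d b * sqrt (Suc (\<phi> b i)) / sqrt 2" for b
  define d2 where "d2 b = d b * sqrt (\<phi> b i) / sqrt 2" for b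
  define p where "p y = (\<Sum>b\<in>B. d1 b * Herm (up b) y)" for y
  define q where "q y = (\<Sum>b\<in>B'. d2 b * Herm (dn b) y)" for y
  define S where "S b = deg1 (\<phi> b)" for b
  have B': "finite B'" "B' \<subseteq> B" using B by (auto simp: B'_def)
  have inj1: "inj_on up B"
    using inj inj_on_upd_Suc[of i] unfolding up_def inj_on_def by blast
  have inj2: "inj_on dn B'"
    using inj inj_on_upd_pred[of i] unfolding dn_def B'_def inj_on_def by blast
  have split: "(y $ i) * (\<Sum>b\<in>B. d b * Herm (\<phi> b) y) = p y + q y" for y
  proof -
    have t: "(y $ i) * (d b * Herm (\<phi> b) y) = d1 b * Herm (up b) y + d2 b * Herm (dn b) y" for b
    proof -
      have "(y $ i) * (d b * Herm (\<phi> b) y) = d b * (sqrt 2 * y $ i * Herm (\<phi> b) y) / sqrt 2" by simp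
      also have "\<dots> = d1 b * Herm (up b) y + d2 b * Herm (dn b) y"
        unfolding Herm_three_term d1_def d2_def up_def dn_def by (simp add: algebra_simps add_divide_distrib)
      finally show ?thesis .
    qed
    have "(\<Sum>b\<in>B. d2 b * Herm (dn b) y) = q y"
      unfolding B'_def q_def using B by (intro sum.mono_neutral_right) (auto simp: d2_def)
    then show ?thesis by (simp add: sum_distrib_left t sum.distrib p_def)
  qed
  have le: "(y $ i) ^ (2 * Suc m) * (\<Sum>b\<in>B. d b * Herm (\<phi> b) y)\<^sup>2
     \<le> 2 * ((y $ i) ^ (2 * m) * (p y)\<^sup>2) + 2 * ((y $ i) ^ (2 * m) * (q y)\<^sup>2)" for y
  proof -
    have "(y $ i) ^ (2 * Suc m) * (\<Sum>b\<in>B. d b * Herm (\<phi> b) y)\<^sup>2 = (y $ i) ^ (2 * m) * ((y $ i) * (\<Sum>b\<in>B. d b * Herm (\<phi> b) y))\<^sup>2"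
      by (simp add: power_mult_distrib power2_eq_square)
    also have "\<dots> \<le> (y $ i) ^ (2 * m) * (2 * ((p y)\<^sup>2 + (q y)\<^sup>2))"
      unfolding split using sum_squares_bound[of "p y" "q y"] by (intro mult_left_mono) (auto simp: power2_sum)
    finally show ?thesis by (simp add: algebra_simps)
  qed
  have a: "real (Suc (\<phi> b i)) \<le> S b" "real (\<phi> b i) \<le> S b" for b using deg_ge[of "\<phi> b" i] by (auto simp: S_def)
  have d1: "(d1 b)\<^sup>2 * deg1 (up b) ^ m \<le> 2 ^ m / 2 * ((d b)\<^sup>2 * S b ^ Suc m)" for b
  proof -
    have "(d1 b)\<^sup>2 \<le> (d b)\<^sup>2 / 2 * S b"
      using mult_left_mono[OF a(1), of "(d b)\<^sup>2 / 2"] by (simp add: d1_def power_mult_distrib power_divide)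
    moreover have "deg1 (up b) ^ m \<le> (2 * S b) ^ m"
      by (intro power_mono) (auto simp: up_def deg_upd_Suc S_def)
    ultimately have "(d1 b)\<^sup>2 * deg1 (up b) ^ m \<le> ((d b)\<^sup>2 / 2 * S b) * (2 * S b) ^ m"
      by (intro mult_mono) (auto simp: S_def)
    then show ?thesis by (simp add: power_mult_distrib mult_ac)
  qed
  have d2: "(d2 b)\<^sup>2 * deg1 (dn b) ^ m \<le> 1 / 2 * ((d b)\<^sup>2 * S b ^ Suc m)" if b: "b \<in> B'" for b
  proof -
    have "(d2 b)\<^sup>2 \<le> (d b)\<^sup>2 / 2 * S b"
      using mult_left_mono[OF a(2), of "(d b)\<^sup>2 / 2"] by (simp add: d2_def power_mult_distrib power_divide)
    moreover have "deg1 (dn b) ^ m \<le> S b ^ m"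
      using deg_upd_pred[of "\<phi> b" i] b by (intro power_mono) (auto simp: dn_def B'_def S_def)
    ultimately have "(d2 b)\<^sup>2 * deg1 (dn b) ^ m \<le> ((d b)\<^sup>2 / 2 * S b) * S b ^ m"
      by (intro mult_mono) (auto simp: S_def)
    then show ?thesis by (simp add: mult_ac)
  qed
  let ?R = "\<Sum>b\<in>B. (d b)\<^sup>2 * S b ^ Suc m"
  have 1: "(\<Sum>b\<in>B. (d1 b)\<^sup>2 * deg1 (up b) ^ m) \<le> 2 ^ m / 2 * ?R"
    unfolding sum_distrib_left by (intro sum_mono d1)
  have "(\<Sum>b\<in>B'. (d2 b)\<^sup>2 * deg1 (dn b) ^ m) \<le> (\<Sum>b\<in>B'. 1 / 2 * ((d b)\<^sup>2 * S b ^ Suc m))"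
    by (intro sum_mono d2)
  also have "\<dots> \<le> 1 / 2 * ?R"
    unfolding sum_distrib_left using B B' by (intro sum_mono2) (auto simp: S_def)
  finally have 2: "(\<Sum>b\<in>B'. (d2 b)\<^sup>2 * deg1 (dn b) ^ m) \<le> 1 / 2 * ?R" .
  show ?case
  proof (rule integral_at_most_mono[OF integral_at_most_add[OF
        integral_at_most_cmult[where t=2, OF Suc.IH[OF B inj1, of d1]]
        integral_at_most_cmult[where t=2, OF Suc.IH[OF B'(1) inj2, of d2]]]])
    show "(\<lambda>y. (y $ i) ^ (2 * Suc m) * (\<Sum>b\<in>B. d b * Herm (\<phi> b) y)\<^sup>2) \<in> borel_measurable lebesgue"
      by (rule measurable_completion) measurable
    show "0 \<le> (y $ i) ^ (2 * Suc m) * (\<Sum>b\<in>B. d b * Herm (\<phi> b) y)\<^sup>2" for y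
      by (intro mult_nonneg_nonneg zero_le_even_power) auto
    let ?X1 = "\<Sum>b\<in>B. (d1 b)\<^sup>2 * deg1 (up b) ^ m" and ?X2 = "\<Sum>b\<in>B'. (d2 b)\<^sup>2 * deg1 (dn b) ^ m"
    have "2 * (moment_const m * ?X1) + 2 * (moment_const m * ?X2) = 2 * (moment_const m * (?X1 + ?X2))"
      by (simp only: distrib_left)
    also have "\<dots> \<le> 2 * (moment_const m * (2 ^ m / 2 * ?R + 1 / 2 * ?R))"
      by (intro mult_left_mono add_mono 1 2 moment_const_nonneg) simp
    also have "\<dots> = moment_const (Suc m) * ?R" by (simp add: algebra_simps)
    finally show "2 * (moment_const m * ?X1) + 2 * (moment_const m * ?X2)
      \<le> moment_const (Suc m) * (\<Sum>b\<in>B. (d b)\<^sup>2 * deg1 (\<phi> b) ^ Suc m)" unfolding S_def .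
  qed (use le in \<open>simp_all add: p_def q_def\<close>)
qed

text \<open>This decouples \<open>x\<close> from \<open>y\<close>. Decay of the kernel away from the diagonal thus follows from
  the growth of Hermite functions under multiplication by coordinates, in \<open>x\<close> and in \<open>y\<close>
  separately, without using any cancellation in \<open>x - y\<close>.\<close>

lemma polynomial_weight_le:
  fixes x y :: "real^'n::finite"
  shows "wt l x y \<le>
     (1 + 2 * real CARD('n)) ^ (2 * l) * (1 + (\<Sum>i\<in>UNIV. (y $ i) ^ (2 * l)) + (\<Sum>i\<in>UNIV. (x $ i) ^ (2 * l)))"
proof -
  \<comment> \<open>Both sides are compared with the power of the largest of 1 and all \<open>|x\<^sub>i|\<close> and \<open>|y\<^sub>i|\<close>.\<close>
  define Z where "Z = insert 1 (range (\<lambda>i. \<bar>x $ i\<bar>) \<union> range (\<lambda>i. \<bar>y $ i\<bar>))"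
  define M where "M = Max Z"
  let ?X = "\<Sum>i\<in>UNIV. (x $ i) ^ (2 * l)" and ?Y = "\<Sum>i\<in>UNIV. (y $ i) ^ (2 * l)"
  have MZ: "M \<in> Z" unfolding M_def by (rule Max_in) (auto simp: Z_def)
  have M: "1 \<le> M" "\<bar>x $ i\<bar> \<le> M" "\<bar>y $ i\<bar> \<le> M" for i
    unfolding M_def by (rule Max_ge; simp add: Z_def)+
  have "norm (x - y) \<le> (\<Sum>i\<in>UNIV. \<bar>(x - y) $ i\<bar>)" by (rule norm_le_l1_cart)
  also have "\<dots> \<le> (\<Sum>i\<in>(UNIV::'n set). 2 * M)"
  proof (rule sum_mono)
    show "\<bar>(x - y) $ i\<bar> \<le> 2 * M" for i using M(2,3)[of i] by simp
  qed
  finally have "1 + norm (x - y) \<le> (1 + 2 * real CARD('n)) * M" using M(1) by (simp add: algebra_simps)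
  then have "wt l x y \<le> ((1 + 2 * real CARD('n)) * M) ^ (2 * l)" by (intro power_mono) auto
  also have "\<dots> = (1 + 2 * real CARD('n)) ^ (2 * l) * M ^ (2 * l)" by (rule power_mult_distrib)
  also have "M ^ (2 * l) \<le> 1 + ?Y + ?X"
  proof -
    have pos: "0 \<le> ?X" "0 \<le> ?Y" by (auto intro!: sum_nonneg zero_le_even_power)
    have sq: "\<bar>z\<bar> ^ (2 * l) = z ^ (2 * l)" for z :: real by (simp add: power_even_abs)
    have le: "\<bar>x $ i\<bar> ^ (2 * l) \<le> ?X" "\<bar>y $ i\<bar> ^ (2 * l) \<le> ?Y" for i
      unfolding sq by (rule member_le_sum; simp add: zero_le_even_power)+
    have "\<bar>x $ i\<bar> ^ (2 * l) \<le> 1 + ?Y + ?X" "\<bar>y $ i\<bar> ^ (2 * l) \<le> 1 + ?Y + ?X" for i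
      using le[of i] pos by linarith+
    then show ?thesis using MZ pos unfolding Z_def by auto
  qed
  finally show ?thesis by (simp add: mult_left_mono)
qed

lemma Herm_expansion_weight:
  fixes x :: "real^'n::finite"
  assumes A: "finite A"
  shows "integral_at_most lebesgue (\<lambda>y. wt l x y * (\<Sum>\<alpha>\<in>A. d \<alpha> * Herm \<alpha> y)\<^sup>2)
    ((1 + 2 * real CARD('n)) ^ (2 * l) * ((1 + (\<Sum>i\<in>UNIV. (x $ i) ^ (2 * l))) * (\<Sum>\<alpha>\<in>A. (d \<alpha>)\<^sup>2)
       + real CARD('n) * moment_const l * (\<Sum>\<alpha>\<in>A. (d \<alpha>)\<^sup>2 * deg1 \<alpha> ^ l)))"
proof -
  define U where "U y = (\<Sum>\<alpha>\<in>A. d \<alpha> * Herm \<alpha> y)" for y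
  define T where "T = (\<Sum>i\<in>UNIV. (x $ i) ^ (2 * l))"
  define E where "E = (1 + 2 * real CARD('n)) ^ (2 * l)"
  have T0: "0 \<le> T" by (simp add: T_def sum_nonneg zero_le_even_power)
  have [measurable]: "U \<in> borel_measurable borel" unfolding U_def[abs_def] by measurable
  have U: "integral_at_most lebesgue (\<lambda>y. (U y)\<^sup>2) (\<Sum>\<alpha>\<in>A. (d \<alpha>)\<^sup>2)"
    unfolding U_def integral_at_most_def using Herm_expansion_L2[OF A, of "\<lambda>b. b" d] by auto
  have "integral_at_most lebesgue (\<lambda>y. (y $ i) ^ (2 * l) * (U y)\<^sup>2) (moment_const l * (\<Sum>\<alpha>\<in>A. (d \<alpha>)\<^sup>2 * deg1 \<alpha> ^ l))" for i
    unfolding U_def using Herm_expansion_moment[OF A, of "\<lambda>b. b"] by simp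
  note Y = integral_at_most_sum[of UNIV, OF this]
  have "integral_at_most lebesgue (\<lambda>y. E * ((1 + T) * (U y)\<^sup>2 + (\<Sum>i\<in>UNIV. (y $ i) ^ (2 * l) * (U y)\<^sup>2)))
     (E * ((1 + T) * (\<Sum>\<alpha>\<in>A. (d \<alpha>)\<^sup>2) + (\<Sum>i\<in>(UNIV::'n set). moment_const l * (\<Sum>\<alpha>\<in>A. (d \<alpha>)\<^sup>2 * deg1 \<alpha> ^ l))))"
    using T0 by (intro integral_at_most_cmult integral_at_most_add U Y) (auto simp: E_def)
  then show ?thesis unfolding T_def[symmetric] E_def[symmetric] U_def[symmetric]
  proof (rule integral_at_most_mono)
    show "(\<lambda>y. wt l x y * (U y)\<^sup>2) \<in> borel_measurable lebesgue"
      by (rule measurable_completion) measurable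
    show "wt l x y * (U y)\<^sup>2 \<le> E * ((1 + T) * (U y)\<^sup>2 + (\<Sum>i\<in>UNIV. (y $ i) ^ (2 * l) * (U y)\<^sup>2))" for y
      using mult_right_mono[OF polynomial_weight_le[of x y l], of "(U y)\<^sup>2"]
      unfolding sum_distrib_right[symmetric] E_def T_def by (simp add: algebra_simps)
  qed (auto simp: mult.assoc)
qed

text \<open>The coefficients of the kernel at fixed \<open>x\<close> are \<open>c\<^sub>\<alpha> h\<^sub>\<alpha>(x)\<close>, with \<open>c\<^sub>\<alpha>\<^sup>2\<close> at most \<open>M\<^sup>2\<close>
  times the degree to the power \<open>- 2 l\<close>. Powers of \<open>x\<close> in the weight keep all of this decay, while
  the powers of \<open>y\<close> lose \<open>l\<close> powers of the degree through the moments; \<open>hweight\<close> records both.\<close>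

lemma Herm_expansion_weighted:
  fixes x :: "real^'n::finite"
  assumes A: "finite A" and c: "\<And>\<alpha>. \<alpha> \<in> A \<Longrightarrow> \<bar>c \<alpha>\<bar> \<le> M / deg1 \<alpha> ^ l"
  shows "integral_at_most lebesgue (\<lambda>y. wt l x y * (\<Sum>\<alpha>\<in>A. c \<alpha> * Herm \<alpha> x * Herm \<alpha> y)\<^sup>2)
      ((1 + 2 * real CARD('n)) ^ (2 * l) * (1 + real CARD('n) * moment_const l) * M\<^sup>2 * (\<Sum>\<alpha>\<in>A. hweight l \<alpha> x))"
proof -
  define d where "d \<alpha> = c \<alpha> * Herm \<alpha> x" for \<alpha>
  define T where "T = (\<Sum>i\<in>UNIV. (x $ i) ^ (2 * l))"
  define k where "k = real CARD('n) * moment_const l"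
  have T0: "0 \<le> T" by (simp add: T_def sum_nonneg zero_le_even_power)
  have k0: "0 \<le> k" by (simp add: k_def moment_const_nonneg)
  define S0 where "S0 = (\<Sum>b\<in>A. (d b)\<^sup>2)"
  define S1 where "S1 = (\<Sum>b\<in>A. (d b)\<^sup>2 * deg1 b ^ l)"
  define H0 where "H0 = (\<Sum>\<alpha>\<in>A. (Herm \<alpha> x)\<^sup>2 / deg1 \<alpha> ^ l)"
  define H1 where "H1 = (\<Sum>\<alpha>\<in>A. T * (Herm \<alpha> x)\<^sup>2 / deg1 \<alpha> ^ (l + l))"
  have H: "(\<Sum>\<alpha>\<in>A. hweight l \<alpha> x) = H0 + H1"
    by (simp only: hweight_def H0_def H1_def sum.distrib T_def sum_distrib_right sum_divide_distrib)
  have d2: "(d b)\<^sup>2 \<le> M\<^sup>2 * ((Herm b x)\<^sup>2 / deg1 b ^ (l + l))" if "b \<in> A" for b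
  proof -
    have "\<bar>c b\<bar>\<^sup>2 \<le> (M / deg1 b ^ l)\<^sup>2" by (rule power_mono[OF c[OF that]]) simp
    also have "\<dots> = M\<^sup>2 / deg1 b ^ (l + l)"
      by (simp add: power_divide power_add power2_eq_square)
    finally have "(c b)\<^sup>2 * (Herm b x)\<^sup>2 \<le> M\<^sup>2 / deg1 b ^ (l + l) * (Herm b x)\<^sup>2"
      by (intro mult_right_mono) auto
    then show ?thesis by (simp add: d_def power_mult_distrib)
  qed
  have S01: "S0 \<le> S1" unfolding S0_def S1_def
  proof (rule sum_mono)
    fix b :: "'n \<Rightarrow> nat"
    have "1 \<le> deg1 b ^ l" by (intro one_le_power) simp
    from mult_left_mono[OF this, of "(d b)\<^sup>2"] show "(d b)\<^sup>2 \<le> (d b)\<^sup>2 * deg1 b ^ l" by simp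
  qed
  have S1: "S1 \<le> M\<^sup>2 * H0"
    unfolding S1_def H0_def sum_distrib_left
  proof (rule sum_mono)
    fix b assume "b \<in> A"
    from mult_right_mono[OF d2[OF this], of "deg1 b ^ l"]
    show "(d b)\<^sup>2 * deg1 b ^ l \<le> M\<^sup>2 * ((Herm b x)\<^sup>2 / deg1 b ^ l)"
      by (simp add: power_add del: of_nat_Suc)
  qed
  have TS0: "T * S0 \<le> M\<^sup>2 * H1"
    unfolding S0_def H1_def sum_distrib_left
  proof (rule sum_mono)
    fix b assume "b \<in> A"
    from mult_left_mono[OF d2[OF this] T0]
    show "T * (d b)\<^sup>2 \<le> M\<^sup>2 * (T * (Herm b x)\<^sup>2 / deg1 b ^ (l + l))"
      by (simp add: mult_ac del: of_nat_Suc)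
  qed
  have "(1 + T) * S0 + k * S1 \<le> (1 + k) * S1 + T * S0" using S01 by (simp add: algebra_simps)
  also have "\<dots> \<le> (1 + k) * (M\<^sup>2 * H0) + M\<^sup>2 * H1" using S1 TS0 k0 by (intro add_mono mult_left_mono) auto
  also have "\<dots> \<le> (1 + k) * (M\<^sup>2 * H0) + (1 + k) * (M\<^sup>2 * H1)"
  proof -
    have "0 \<le> M\<^sup>2 * H1" unfolding H1_def using T0 by (intro mult_nonneg_nonneg sum_nonneg) auto
    then have "1 * (M\<^sup>2 * H1) \<le> (1 + k) * (M\<^sup>2 * H1)" using k0 by (intro mult_right_mono) auto
    then show ?thesis by simp
  qed
  finally have "(1 + T) * S0 + k * S1 \<le> (1 + k) * M\<^sup>2 * (H0 + H1)" by (simp add: algebra_simps)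
  then have le: "(1 + 2 * real CARD('n)) ^ (2 * l) * ((1 + T) * S0 + k * S1)
      \<le> (1 + 2 * real CARD('n)) ^ (2 * l) * (1 + k) * M\<^sup>2 * (H0 + H1)"
    unfolding mult.assoc by (intro mult_left_mono) auto
  show ?thesis
    unfolding H k_def[symmetric]
    by (rule integral_at_most_weaken[OF _ le])
       (use Herm_expansion_weight[OF A, of x l d] in \<open>simp only: T_def S0_def S1_def k_def d_def\<close>)
qed

section \<open>Completeness of the Hermite functions\<close>

lemma poly_le_exp:
  assumes "real_polynomial_function (P :: 'a::real_normed_vector \<Rightarrow> real)" "c > 0"
  shows "\<exists>C. \<forall>x. \<bar>P x\<bar> \<le> C * exp (c * (norm x)\<^sup>2)"
  using assms
proof (induction P arbitrary: c rule: real_polynomial_function.induct)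
  case (linear f)
  obtain C where C: "\<bar>t\<bar> ^ 1 \<le> C * exp (c * t\<^sup>2)" for t :: real
    using power_times_exp_bounded[OF linear(2), of 1] by blast
  obtain K where K: "K \<ge> 0" "\<And>x. norm (f x) \<le> norm x * K"
    using bounded_linear.nonneg_bounded[OF linear(1)] by blast
  have "\<bar>f x\<bar> \<le> (K * C) * exp (c * (norm x)\<^sup>2)" for x
  proof -
    have "\<bar>f x\<bar> \<le> K * norm x" using K(2)[of x] by (simp add: mult.commute)
    also have "\<dots> \<le> K * (C * exp (c * (norm x)\<^sup>2))" using C[of "norm x"] K(1) by (intro mult_left_mono) auto
    finally show ?thesis by simp
  qed
  then show ?case by blast
next
  case (const a)
  have "\<bar>a\<bar> \<le> \<bar>a\<bar> * exp (c * (norm x)\<^sup>2)" for x :: 'a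
    using const mult_left_mono[of 1 "exp (c * (norm x)\<^sup>2)" "\<bar>a\<bar>"] by simp
  then show ?case by blast
next
  case (add f g)
  obtain C where C: "\<And>x. \<bar>f x\<bar> \<le> C * exp (c * (norm x)\<^sup>2)" using add.IH(1)[OF add.prems] by blast
  obtain D where D: "\<And>x. \<bar>g x\<bar> \<le> D * exp (c * (norm x)\<^sup>2)" using add.IH(2)[OF add.prems] by blast
  have "\<bar>f x + g x\<bar> \<le> (C + D) * exp (c * (norm x)\<^sup>2)" for x
    using C[of x] D[of x] abs_triangle_ineq[of "f x" "g x"] by (simp add: algebra_simps)
  then show ?case by blast
next
  case (mult f g)
  have c2: "c / 2 > 0" using mult.prems by simp
  obtain C where C: "\<And>x. \<bar>f x\<bar> \<le> C * exp (c / 2 * (norm x)\<^sup>2)" using mult.IH(1)[OF c2] by blast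
  obtain D where D: "\<And>x. \<bar>g x\<bar> \<le> D * exp (c / 2 * (norm x)\<^sup>2)" using mult.IH(2)[OF c2] by blast
  have "\<bar>f x * g x\<bar> \<le> (C * D) * exp (c * (norm x)\<^sup>2)" for x
  proof -
    have "\<bar>f x * g x\<bar> \<le> (C * exp (c / 2 * (norm x)\<^sup>2)) * (D * exp (c / 2 * (norm x)\<^sup>2))"
      unfolding abs_mult using C[of x] D[of x] by (intro mult_mono) auto
    also have "\<dots> = (C * D) * (exp (c / 2 * (norm x)\<^sup>2) * exp (c / 2 * (norm x)\<^sup>2))" by simp
    also have "exp (c / 2 * (norm x)\<^sup>2) * exp (c / 2 * (norm x)\<^sup>2) = exp (c * (norm x)\<^sup>2)"
      unfolding exp_add[symmetric] by simp
    finally show ?thesis .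
  qed
  then show ?case by blast
qed

lemma continuous_poly: "real_polynomial_function P \<Longrightarrow> continuous_on UNIV P"
  by (meson continuous_at_imp_continuous_on continuous_real_polymonial_function)

lemma integrable_mult_gaussian:
  fixes u :: "real^'n::finite \<Rightarrow> complex"
  assumes u: "u \<in> borel_measurable borel" "integrable lborel (\<lambda>x. (cmod (u x))\<^sup>2)"
    and g: "g \<in> borel_measurable borel" and c: "c > 0"
    and le: "\<And>x. \<bar>g x\<bar> \<le> C * gauss c x"
  shows "integrable lborel (\<lambda>x. u x * complex_of_real (g x))"
proof -
  have i: "integrable lborel (\<lambda>x. (cmod (u x))\<^sup>2 + C\<^sup>2 * gauss (2 * c) (x::real^'n))"
    using c by (intro Bochner_Integration.integrable_add u integrable_mult_right gaussian_integrable) auto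
  show ?thesis
  proof (rule integrable_dominated[OF i])
    show "(\<lambda>x. u x * complex_of_real (g x)) \<in> borel_measurable lborel" using u g by measurable
    show "norm (u x * complex_of_real (g x)) \<le> (cmod (u x))\<^sup>2 + C\<^sup>2 * gauss (2 * c) x" for x
    proof -
      have "norm (u x * complex_of_real (g x)) = cmod (u x) * \<bar>g x\<bar>" by (simp add: norm_mult)
      also have "\<dots> \<le> (cmod (u x))\<^sup>2 + \<bar>g x\<bar>\<^sup>2"
        using sum_squares_bound[of "cmod (u x)" "\<bar>g x\<bar>"] mult_nonneg_nonneg[OF norm_ge_zero[of "u x"] abs_ge_zero[of "g x"]]
        by linarith
      also have "\<bar>g x\<bar>\<^sup>2 \<le> (C * gauss c x)\<^sup>2" using le[of x] by (intro power_mono) auto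
      also have "\<dots> = C\<^sup>2 * (gauss c x * gauss c x)"
        by (simp add: power2_eq_square)
      also have "gauss c x * gauss c x = gauss (2 * c) x"
        unfolding exp_add[symmetric] by simp
      finally show ?thesis by simp
    qed
  qed
qed

text \<open>The linear span. The three-term recursion makes it stable under multiplication by
  coordinates, hence by polynomials.\<close>

inductive_set hspan :: "(real^'n::finite \<Rightarrow> real) set" where
  hspan_Herm: "Herm \<alpha> \<in> hspan"
| hspan_add: "f \<in> hspan \<Longrightarrow> g \<in> hspan \<Longrightarrow> (\<lambda>x. f x + g x) \<in> hspan"
| hspan_scale: "f \<in> hspan \<Longrightarrow> (\<lambda>x. c * f x) \<in> hspan"

lemma hspan_sum:
  assumes "finite I" "\<And>i. i \<in> I \<Longrightarrow> f i \<in> hspan" shows "(\<lambda>x. \<Sum>i\<in>I. f i x) \<in> hspan"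
  using assms
proof (induction I rule: finite_induct)
  case empty
  show ?case using hspan_scale[OF hspan_Herm, of 0] by simp
next
  case (insert i I)
  have "(\<lambda>x. f i x + (\<Sum>i\<in>I. f i x)) \<in> hspan" using insert by (intro hspan_add) auto
  then show ?case using insert by simp
qed

lemma hspan_coordinate: "f \<in> hspan \<Longrightarrow> (\<lambda>x. x $ i * f x) \<in> hspan"
proof (induction rule: hspan.induct)
  case (hspan_Herm \<alpha>)
  have eq: "(\<lambda>x. x $ i * Herm \<alpha> x) = (\<lambda>x. (sqrt (Suc (\<alpha> i)) / sqrt 2) * Herm (\<alpha>(i := Suc (\<alpha> i))) x
     + (sqrt (\<alpha> i) / sqrt 2) * Herm (\<alpha>(i := \<alpha> i - 1)) x)"
  proof
    fix x
    have "x $ i * Herm \<alpha> x = (sqrt 2 * x $ i * Herm \<alpha> x) / sqrt 2" by simp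
    then show "x $ i * Herm \<alpha> x = (sqrt (Suc (\<alpha> i)) / sqrt 2) * Herm (\<alpha>(i := Suc (\<alpha> i))) x
     + (sqrt (\<alpha> i) / sqrt 2) * Herm (\<alpha>(i := \<alpha> i - 1)) x"
      unfolding Herm_three_term by (simp add: add_divide_distrib)
  qed
  show ?case unfolding eq by (intro hspan.intros)
next
  case (hspan_add f g)
  then show ?case using hspan.hspan_add by (fastforce simp: distrib_left)
next
  case (hspan_scale f c)
  from hspan.hspan_scale[OF hspan_scale.IH, of c] show ?case by (simp add: mult.left_commute)
qed

lemma hspan_poly:
  assumes "real_polynomial_function P" "f \<in> hspan" shows "(\<lambda>x. P x * f x) \<in> hspan"
  using assms
proof (induction P arbitrary: f rule: real_polynomial_function.induct)
  case (linear L)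
  have eq: "(\<lambda>x. L x * f x) = (\<lambda>x. \<Sum>i\<in>UNIV. L (axis i 1) * (x $ i * f x))"
  proof
    fix x
    have "L x = L (\<Sum>i\<in>UNIV. x $ i *\<^sub>R axis i 1)" using basis_expansion[of x] by (simp add: scalar_mult_eq_scaleR)
    also have "\<dots> = (\<Sum>i\<in>UNIV. x $ i * L (axis i 1))"
      using linear(1) by (simp add: bounded_linear.linear linear_sum linear_scale)
    finally show "L x * f x = (\<Sum>i\<in>UNIV. L (axis i 1) * (x $ i * f x))"
      by (simp add: sum_distrib_right sum_distrib_left mult_ac)
  qed
  show ?case unfolding eq by (intro hspan_sum finite hspan_scale hspan_coordinate linear.prems)
next
  case (const c)
  then show ?case by (rule hspan_scale)
next
  case (add p q)
  have "(\<lambda>x. p x * f x + q x * f x) \<in> hspan" using add by (intro hspan_add) auto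
  then show ?case by (simp add: distrib_right)
next
  case (mult p q)
  have "(\<lambda>x. p x * (q x * f x)) \<in> hspan" using mult by auto
  then show ?case by (simp add: mult.assoc)
qed

lemma hspan_gaussian: "(\<lambda>x::real^'n::finite. gauss (1 / 2) x) \<in> hspan"
proof -
  define c where "c = (\<Prod>i\<in>(UNIV::'n set). 1 / sqrt (sqrt pi))"
  have c: "c > 0" unfolding c_def by (intro prod_pos) auto
  have "Herm (\<lambda>_. 0) x = c * gauss (1 / 2) x" for x :: "real^'n"
  proof -
    have "Herm (\<lambda>_. 0) x = (\<Prod>i\<in>UNIV. (1 / sqrt (sqrt pi)) * exp (- (1/2) * (x $ i)\<^sup>2))"
      unfolding Herm_def prodfun_def by (simp add: herm.simps)
    also have "\<dots> = c * prodfun (\<lambda>_ t. exp (- (1/2) * t\<^sup>2)) x"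
      unfolding prodfun_def c_def by (rule prod.distrib)
    finally show ?thesis unfolding exp_norm_sq_eq_prodfun .
  qed
  then have eq: "(\<lambda>x::real^'n. gauss (1 / 2) x) = (\<lambda>x. (1 / c) * Herm (\<lambda>_. 0) x)"
    using c by (intro ext) simp
  show ?thesis unfolding eq by (rule hspan_scale[OF hspan_Herm])
qed

lemma hspan_props:
  assumes "f \<in> hspan"
  shows "f \<in> borel_measurable borel" "\<exists>C. \<forall>x. \<bar>f x\<bar> \<le> C * gauss (1 / 4) x"
  using assms
proof (induction rule: hspan.induct)
  case (hspan_Herm \<alpha>)
  { case 1 show ?case by measurable }
  { case 2 show ?case using Herm_decay[of \<alpha>] by simp }
next
  case (hspan_add f g)
  { case 1 show ?case using hspan_add by measurable }
  { case 2
    obtain C where C: "\<And>x. \<bar>f x\<bar> \<le> C * gauss (1 / 4) x" using hspan_add by blast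
    obtain D where D: "\<And>x. \<bar>g x\<bar> \<le> D * gauss (1 / 4) x" using hspan_add by blast
    have "\<bar>f x + g x\<bar> \<le> (C + D) * gauss (1 / 4) x" for x
      using C[of x] D[of x] abs_triangle_ineq[of "f x" "g x"] by (simp add: algebra_simps)
    then show ?case by blast }
next
  case (hspan_scale f c)
  { case 1 show ?case using hspan_scale by measurable }
  { case 2
    obtain C where C: "\<And>x. \<bar>f x\<bar> \<le> C * gauss (1 / 4) x" using hspan_scale by blast
    have "\<bar>c * f x\<bar> \<le> (\<bar>c\<bar> * C) * gauss (1 / 4) x" for x
      using mult_left_mono[OF C[of x], of "\<bar>c\<bar>"] by (simp add: abs_mult)
    then show ?case by blast }
qed

context
  fixes u :: "real^'n::finite \<Rightarrow> complex"
  assumes um: "u \<in> borel_measurable borel" and u2: "integrable lborel (\<lambda>x. (cmod (u x))\<^sup>2)"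
begin

lemma integrable_mult_hspan: "f \<in> hspan \<Longrightarrow> integrable lborel (\<lambda>x. u x * complex_of_real (f x))"
  using hspan_props[of f] integrable_mult_gaussian[OF um u2, of f "1/4"] by auto

lemma integral_mult_hspan_eq_0:
  assumes orth: "\<And>\<alpha>. integral\<^sup>L lborel (\<lambda>x. u x * cHerm \<alpha> x) = 0"
  shows "f \<in> hspan \<Longrightarrow> integral\<^sup>L lborel (\<lambda>x. u x * complex_of_real (f x)) = 0"
proof (induction rule: hspan.induct)
  case (hspan_Herm \<alpha>) show ?case by (rule orth)
next
  case (hspan_add f g)
  then show ?case by (simp add: distrib_left integrable_mult_hspan)
next
  case (hspan_scale f c)
  have "(\<lambda>x. u x * complex_of_real (c * f x)) = (\<lambda>x. complex_of_real c * (u x * complex_of_real (f x)))"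
    by (rule ext) simp
  then show ?case using hspan_scale by simp
qed

lemma integrable_poly_gaussian:
  assumes "real_polynomial_function P" "s > 0"
  shows "integrable lborel (\<lambda>x. u x * complex_of_real (P x * gauss s x))"
proof -
  obtain C where C: "\<And>x. \<bar>P x\<bar> \<le> C * exp (s / 2 * (norm x)\<^sup>2)"
    using poly_le_exp[OF assms(1), of "s / 2"] assms(2) by auto
  show ?thesis
  proof (rule integrable_mult_gaussian[OF um u2, of _ "s / 2" C])
    show "(\<lambda>x. P x * gauss s x) \<in> borel_measurable borel"
      using continuous_poly[OF assms(1)] by (intro borel_measurable_continuous_onI continuous_intros)
    fix x
    have "\<bar>P x * gauss s x\<bar> \<le> C * exp (s / 2 * (norm x)\<^sup>2) * gauss s x"
      unfolding abs_mult using C[of x] by (intro mult_mono) auto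
    also have "\<dots> = C * gauss (s / 2) x"
      unfolding mult.assoc exp_add[symmetric] by (simp add: field_simps)
    finally show "\<bar>P x * gauss s x\<bar> \<le> C * gauss (s / 2) x" .
  qed (use assms in auto)
qed

text \<open>The partial sums of the exponential series of \<open>q\<close> are polynomials and are dominated by \<open>exp
  |q|\<close>, so the vanishing of the moments passes to the limit.\<close>

lemma integral_mult_exp_poly_eq_0:
  assumes V: "\<And>P. real_polynomial_function P \<Longrightarrow> integral\<^sup>L lborel (\<lambda>x. u x * complex_of_real (P x * gauss s x)) = 0"
    and s: "s > 0" and P: "real_polynomial_function P" and q: "real_polynomial_function q"
    and int: "integrable lborel (\<lambda>x. u x * complex_of_real (P x * gauss s x * exp \<bar>q x\<bar>))"
  shows "integral\<^sup>L lborel (\<lambda>x. u x * complex_of_real (P x * gauss s x * exp (q x))) = 0"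
proof -
  define T where "T J x = (\<Sum>j<J. q x ^ j /\<^sub>R fact j)" for J x
  have Tp: "real_polynomial_function (T J)" for J
    unfolding T_def[abs_def] using q
    by (intro real_polynomial_function_sum) (auto intro!: real_polynomial_function_power real_polynomial_function.intros(3,4) simp: divideR_right)
  have meas: "P \<in> borel_measurable borel" "q \<in> borel_measurable borel" "\<And>J. T J \<in> borel_measurable borel"
    using continuous_poly P q Tp by (auto intro!: borel_measurable_continuous_onI)
  note [measurable] = meas um
  have "(\<lambda>J. integral\<^sup>L lborel (\<lambda>x. u x * complex_of_real (P x * gauss s x * T J x)))
     \<longlonglongrightarrow> integral\<^sup>L lborel (\<lambda>x. u x * complex_of_real (P x * gauss s x * exp (q x)))"
  proof (rule integral_dominated_convergence[where w="\<lambda>x. norm (u x * complex_of_real (P x * gauss s x * exp \<bar>q x\<bar>))"])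
    show "integrable lborel (\<lambda>x. norm (u x * complex_of_real (P x * gauss s x * exp \<bar>q x\<bar>)))"
      using int by (rule integrable_norm)
    show "AE x in lborel. (\<lambda>J. u x * complex_of_real (P x * gauss s x * T J x)) \<longlonglongrightarrow> u x * complex_of_real (P x * gauss s x * exp (q x))"
    proof (rule AE_I2)
      fix x
      have "(\<lambda>J. T J x) \<longlonglongrightarrow> exp (q x)"
        unfolding T_def using exp_converges[of "q x"] by (simp add: sums_def)
      then show "(\<lambda>J. u x * complex_of_real (P x * gauss s x * T J x)) \<longlonglongrightarrow> u x * complex_of_real (P x * gauss s x * exp (q x))"
        by (intro tendsto_intros)
    qed
    fix J
    have "norm (u x * complex_of_real (P x * gauss s x * T J x)) \<le> norm (u x * complex_of_real (P x * gauss s x * exp \<bar>q x\<bar>))" for x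
    proof -
      have "\<bar>T J x\<bar> \<le> (\<Sum>j<J. \<bar>q x ^ j /\<^sub>R fact j\<bar>)" unfolding T_def by (rule sum_abs)
      also have "\<dots> = (\<Sum>j<J. \<bar>q x\<bar> ^ j /\<^sub>R fact j)" by (simp add: abs_mult power_abs)
      also have "\<dots> \<le> (\<Sum>j. \<bar>q x\<bar> ^ j /\<^sub>R fact j)"
        by (rule sum_le_suminf) (use summable_exp_generic[of "\<bar>q x\<bar>"] in auto)
      also have "\<dots> = exp \<bar>q x\<bar>" by (simp add: exp_def)
      finally show ?thesis by (simp add: norm_mult abs_mult mult_left_mono)
    qed
    then show "AE x in lborel. norm (u x * complex_of_real (P x * gauss s x * T J x)) \<le> norm (u x * complex_of_real (P x * gauss s x * exp \<bar>q x\<bar>))"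
      by (intro AE_I2)
  qed measurable
  moreover have "integral\<^sup>L lborel (\<lambda>x. u x * complex_of_real (P x * gauss s x * T J x)) = 0" for J
    using V[of "\<lambda>x. P x * T J x"] P Tp[of J] by (simp add: real_polynomial_function.intros(4) mult_ac)
  ultimately show ?thesis by (simp add: LIMSEQ_const_iff)
qed

lemma norm_sq_poly: "real_polynomial_function (\<lambda>x::real^'n. c * (norm x)\<^sup>2)"
proof -
  have "real_polynomial_function (\<lambda>x::real^'n. (x $ i)\<^sup>2)" for i
    by (intro real_polynomial_function_power) (auto intro!: real_polynomial_function.intros(1) bounded_linear_vec_nth)
  then have "real_polynomial_function (\<lambda>x::real^'n. c * (\<Sum>i\<in>UNIV. (x $ i)\<^sup>2))"
    by (intro real_polynomial_function.intros(2,4) real_polynomial_function_sum) auto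
  then show ?thesis by (simp add: norm_sq_vec)
qed

text \<open>Expanding \<open>exp (- (s / 2) |x|\<^sup>2)\<close> in a power series is legitimate because the dominating
  function \<open>exp ((s / 2) |x|\<^sup>2)\<close> leaves a Gaussian of rate \<open>s / 2\<close>. Any factor between 1 and 2
  could replace \<open>3 / 2\<close>; iteration reaches arbitrarily large rates.\<close>

lemma gaussian_rate_step:
  assumes V: "\<And>P. real_polynomial_function P \<Longrightarrow> integral\<^sup>L lborel (\<lambda>x. u x * complex_of_real (P x * gauss s x)) = 0"
    and s: "s > 0" and P: "real_polynomial_function P"
  shows "integral\<^sup>L lborel (\<lambda>x. u x * complex_of_real (P x * gauss (3 / 2 * s) x)) = 0"
proof -
  have e: "gauss s x * exp \<bar>- (s / 2) * (norm x)\<^sup>2\<bar> = gauss (s / 2) x" for x :: "real^'n"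
    unfolding exp_add[symmetric] using s by (simp add: abs_mult field_simps)
  have "integral\<^sup>L lborel (\<lambda>x. u x * complex_of_real (P x * gauss s x * gauss (s / 2) x)) = 0"
  proof (rule integral_mult_exp_poly_eq_0[OF V s P norm_sq_poly])
    show "integrable lborel (\<lambda>x. u x * complex_of_real (P x * gauss s x * exp \<bar>- (s / 2) * (norm x)\<^sup>2\<bar>))"
      unfolding mult.assoc[of "P _"] e using integrable_poly_gaussian[OF P, of "s / 2"] s by simp
  qed
  moreover have e2: "gauss s x * gauss (s / 2) x = gauss (3 / 2 * s) x" for x :: "real^'n"
    unfolding exp_add[symmetric] by (simp add: field_simps)
  ultimately show ?thesis unfolding mult.assoc[of "P _"] e2 by simp
qed

lemma integrable_translated_gaussian:
  assumes "s > 0"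
  shows "integrable lborel (\<lambda>x. u x * complex_of_real (gauss s (x - y)))"
proof (rule integrable_mult_gaussian[OF um u2, of _ "s / 2" "exp (s * (norm y)\<^sup>2)"])
  show "(\<lambda>x. gauss s (x - y)) \<in> borel_measurable borel" by measurable
  fix x
  have "(norm x)\<^sup>2 \<le> (norm (x - y) + norm y)\<^sup>2"
    using norm_triangle_ineq[of "x - y" y] by (intro power_mono) auto
  also have "\<dots> \<le> 2 * (norm (x - y))\<^sup>2 + 2 * (norm y)\<^sup>2"
    using sum_squares_bound[of "norm (x - y)" "norm y"] by (simp add: power2_sum)
  finally have "s * (norm x)\<^sup>2 \<le> s * (2 * (norm (x - y))\<^sup>2 + 2 * (norm y)\<^sup>2)" using assms by simp
  then have "gauss s (x - y) \<le> exp (s * (norm y)\<^sup>2 + - (s / 2) * (norm x)\<^sup>2)"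
    by (simp add: algebra_simps)
  then show "\<bar>gauss s (x - y)\<bar> \<le> exp (s * (norm y)\<^sup>2) * gauss (s / 2) x"
    by (simp only: exp_add abs_exp_cancel)
qed (use assms in auto)

text \<open>Up to a constant, translation by \<open>y\<close> multiplies the Gaussian by the exponential of the
  linear function \<open>2 s (x \<bullet> y)\<close>.\<close>

lemma integral_translated_gaussian_eq_0:
  assumes V: "\<And>P. real_polynomial_function P \<Longrightarrow> integral\<^sup>L lborel (\<lambda>x. u x * complex_of_real (P x * gauss s x)) = 0"
    and s: "s > 0"
  shows "integral\<^sup>L lborel (\<lambda>x. u x * complex_of_real (gauss s (x - y))) = 0"
proof -
  define q where "q x = 2 * s * (x \<bullet> y)" for x
  have q: "real_polynomial_function q" unfolding q_def[abs_def]
    by (intro real_polynomial_function.intros bounded_linear_inner_left)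
  have one: "real_polynomial_function (\<lambda>x::real^'n. 1)" by auto
  have "integral\<^sup>L lborel (\<lambda>x. u x * complex_of_real (1 * gauss s x * exp (q x))) = 0"
  proof (rule integral_mult_exp_poly_eq_0[OF V s one q])
    show "integrable lborel (\<lambda>x. u x * complex_of_real (1 * gauss s x * exp \<bar>q x\<bar>))"
    proof (rule integrable_mult_gaussian[OF um u2, of _ "s / 2" "exp (2 * s * (norm y)\<^sup>2)"])
      show "(\<lambda>x. 1 * gauss s x * exp \<bar>q x\<bar>) \<in> borel_measurable borel"
        unfolding q_def by measurable
      fix x
      have "\<bar>q x\<bar> \<le> 2 * s * (norm x * norm y)"
        using mult_left_mono[OF Cauchy_Schwarz_ineq2[of x y], of "2 * s"] s by (simp add: q_def abs_mult)
      also have "2 * (norm x * norm y) \<le> (norm x)\<^sup>2 / 2 + 2 * (norm y)\<^sup>2"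
        using sum_squares_bound[of "norm x / sqrt 2" "sqrt 2 * norm y"] by (simp add: power_divide power_mult_distrib)
      then have "2 * s * (norm x * norm y) \<le> s * ((norm x)\<^sup>2 / 2 + 2 * (norm y)\<^sup>2)"
        using mult_left_mono[of "2 * (norm x * norm y)" "(norm x)\<^sup>2 / 2 + 2 * (norm y)\<^sup>2" s] s by (simp add: mult_ac)
      finally have "exp (- s * (norm x)\<^sup>2 + \<bar>q x\<bar>) \<le> exp (2 * s * (norm y)\<^sup>2 + - (s / 2) * (norm x)\<^sup>2)"
        by (simp add: algebra_simps)
      then show "\<bar>1 * gauss s x * exp \<bar>q x\<bar>\<bar> \<le> exp (2 * s * (norm y)\<^sup>2) * gauss (s / 2) x"
        by (simp only: exp_add mult_1 abs_mult abs_exp_cancel)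
    qed (use s in auto)
  qed
  moreover have "gauss s (x - y) = gauss s y * (1 * gauss s x * exp (q x))" for x
    unfolding mult_1 exp_add[symmetric] q_def
    by (simp add: power2_norm_eq_inner inner_diff_left inner_diff_right inner_commute algebra_simps)
  ultimately show ?thesis
  proof -
    assume z: "integral\<^sup>L lborel (\<lambda>x. u x * complex_of_real (1 * gauss s x * exp (q x))) = 0"
      and e: "\<And>x. gauss s (x - y) = gauss s y * (1 * gauss s x * exp (q x))"
    have "(\<lambda>x. u x * complex_of_real (gauss s (x - y))) = (\<lambda>x. complex_of_real (gauss s y) * (u x * complex_of_real (1 * gauss s x * exp (q x))))"
      unfolding e by (rule ext) simp
    then show ?thesis using z by simp
  qed
qed

text \<open>Gaussians of rate \<open>1 / 2\<close> times polynomials lie in the span of the \<open>h\<^sub>\<alpha>\<close>. Raising the rate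
  step by step and then translating shows that \<open>u\<close> has integral 0 against a sequence of Gaussians
  concentrating at \<open>y\<close>, and by continuity their normalized integrals against \<open>u\<close> tend to \<open>u y\<close>.\<close>

lemma Herm_complete:
  assumes orth: "\<And>\<alpha>. integral\<^sup>L lborel (\<lambda>x. u x * cHerm \<alpha> x) = 0"
    and cont: "continuous_on UNIV u"
  shows "u y = 0"
proof -
  define s where "s m = 1 / 2 * (3 / 2 :: real) ^ m" for m
  have s0: "s m > 0" for m by (simp add: s_def)
  have V: "real_polynomial_function P \<Longrightarrow> integral\<^sup>L lborel (\<lambda>x. u x * complex_of_real (P x * gauss (s m) x)) = 0" for P m
  proof (induction m arbitrary: P)
    case 0
    have "(\<lambda>x. P x * gauss (1 / 2) x) \<in> hspan" by (rule hspan_poly[OF 0 hspan_gaussian])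
    from integral_mult_hspan_eq_0[OF orth this] show ?case by (simp add: s_def)
  next
    case (Suc m)
    from gaussian_rate_step[OF Suc.IH s0 Suc.prems] show ?case by (simp add: s_def mult_ac)
  qed
  have Z: "integral\<^sup>L lborel (\<lambda>x. u x * complex_of_real (gauss (s m) (x - y))) = 0" for m
    by (rule integral_translated_gaussian_eq_0[OF V s0])
  have gi: "integrable lborel (\<lambda>x. gauss t (x - y))" if "t > 0" for t
    using integrable_lborel_translate[OF gaussian_integrable[OF that], of "- y"] by simp
  have slim: "filterlim s at_top sequentially"
    unfolding s_def by (intro filterlim_tendsto_pos_mult_at_top[OF tendsto_const]
      filterlim_at_infinity_imp_filterlim_at_top[OF filterlim_realpow_sequentially_gt1]) auto
  have "cmod (u y) \<le> \<epsilon>" if \<epsilon>: "\<epsilon> > 0" for \<epsilon>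
  proof -
    obtain \<delta> where \<delta>: "\<delta> > 0" "\<And>x. dist x y < \<delta> \<Longrightarrow> dist (u x) (u y) < \<epsilon>"
      using cont[unfolded continuous_on_iff, rule_format, OF UNIV_I \<epsilon>, of y] by auto
    define D where "D = integral\<^sup>L lborel (\<lambda>x. (cmod (u x) + cmod (u y)) * gauss 1 (x - y))"
    define v where "v = measure lborel (ball y (\<delta> / 2))"
    have v0: "v > 0" unfolding v_def using \<delta>(1) content_ball_pos[of "\<delta>/2" y] by simp
    have ui: "integrable lborel (\<lambda>x. cmod (u x) * gauss t (x - y))" if "t > 0" for t
      using integrable_norm[OF integrable_translated_gaussian[OF that, of y]] by (simp add: norm_mult)
    have Di: "integrable lborel (\<lambda>x. (cmod (u x) + cmod (u y)) * gauss 1 (x - y))"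
      unfolding distrib_right by (intro Bochner_Integration.integrable_add ui integrable_mult_right gi) auto
    \<comment> \<open>Outside the ball of radius \<open>\<delta>\<close> the Gaussian of rate \<open>t\<close> is at most \<open>exp (- (t - 1) \<delta>\<^sup>2)\<close>
      times the Gaussian of rate 1, while the normalizing integral is at least \<open>exp (- t \<delta>\<^sup>2 / 4)
      v\<close> on account of the ball of radius \<open>\<delta> / 2\<close>. The quotient decays with the rate \<open>1 - 1 / 4 =
      3 / 4\<close>.\<close>
    have main: "cmod (u y) \<le> \<epsilon> + exp (\<delta>\<^sup>2) * D / v * exp (- (3 / 4 * \<delta>\<^sup>2) * s m)" if sm: "s m \<ge> 1" for m
    proof -
      define t where "t = s m"
      define c where "c = integral\<^sup>L lborel (\<lambda>x. gauss t (x - y))"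
      have t: "t \<ge> 1" "t > 0" using sm by (auto simp: t_def)
      have "c \<ge> integral\<^sup>L lborel (\<lambda>x. exp (- t * (\<delta> / 2)\<^sup>2) * indicator (ball y (\<delta> / 2)) x)"
        unfolding c_def
      proof (rule integral_mono)
        show "integrable lborel (\<lambda>x. exp (- t * (\<delta> / 2)\<^sup>2) * indicat_real (ball y (\<delta> / 2)) x)"
          by (intro integrable_mult_right integrable_real_indicator emeasure_lborel_ball_finite) simp
        show "integrable lborel (\<lambda>x. gauss t (x - y))" using gi t by simp
        fix x
        show "exp (- t * (\<delta> / 2)\<^sup>2) * indicat_real (ball y (\<delta> / 2)) x \<le> gauss t (x - y)"
        proof (cases "x \<in> ball y (\<delta> / 2)")
          case True
          then have "norm (x - y) \<le> \<delta> / 2" by (simp add: dist_norm norm_minus_commute)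
          then have "(norm (x - y))\<^sup>2 \<le> (\<delta> / 2)\<^sup>2" by (intro power_mono) auto
          then show ?thesis using True t by simp
        qed simp
      qed
      then have cv: "exp (- t * (\<delta> / 2)\<^sup>2) * v \<le> c" by (simp add: v_def)
      have c0: "c > 0" by (rule less_le_trans[OF _ cv]) (use v0 in simp)
      have "complex_of_real c * u y = integral\<^sup>L lborel (\<lambda>x. complex_of_real (gauss t (x - y)) * u y)"
        unfolding c_def by simp
      also have "\<dots> = integral\<^sup>L lborel (\<lambda>x. complex_of_real (gauss t (x - y)) * u y) - integral\<^sup>L lborel (\<lambda>x. u x * complex_of_real (gauss t (x - y)))"
        using Z[of m] by (simp add: t_def)
      also have "\<dots> = integral\<^sup>L lborel (\<lambda>x. complex_of_real (gauss t (x - y)) * u y - u x * complex_of_real (gauss t (x - y)))"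
        using gi[OF t(2)] integrable_translated_gaussian[OF t(2), of y]
        by (subst Bochner_Integration.integral_diff) (auto intro!: integrable_mult_left simp del: of_real_exp)
      also have "cmod \<dots> \<le> integral\<^sup>L lborel (\<lambda>x. cmod (complex_of_real (gauss t (x - y)) * u y - u x * complex_of_real (gauss t (x - y))))"
        by (rule integral_norm_bound)
      also have "\<dots> \<le> integral\<^sup>L lborel (\<lambda>x. \<epsilon> * gauss t (x - y) + exp (- (t - 1) * \<delta>\<^sup>2) * ((cmod (u x) + cmod (u y)) * gauss 1 (x - y)))"
      proof (rule integral_mono)
        show "integrable lborel (\<lambda>x. cmod (complex_of_real (gauss t (x - y)) * u y - u x * complex_of_real (gauss t (x - y))))"
          using gi[OF t(2)] integrable_translated_gaussian[OF t(2), of y]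
          by (intro integrable_norm Bochner_Integration.integrable_diff) (auto intro!: integrable_mult_left simp del: of_real_exp)
        show "integrable lborel (\<lambda>x. \<epsilon> * gauss t (x - y) + exp (- (t - 1) * \<delta>\<^sup>2) * ((cmod (u x) + cmod (u y)) * gauss 1 (x - y)))"
          using gi[OF t(2)] Di by (intro Bochner_Integration.integrable_add integrable_mult_right) auto
        fix x
        define r where "r = norm (x - y)"
        have "cmod (complex_of_real (exp (- t * r\<^sup>2)) * u y - u x * complex_of_real (exp (- t * r\<^sup>2))) = cmod (u x - u y) * exp (- t * r\<^sup>2)"
        proof -
          have "complex_of_real (exp (- t * r\<^sup>2)) * u y - u x * complex_of_real (exp (- t * r\<^sup>2)) = - ((u x - u y) * complex_of_real (exp (- t * r\<^sup>2)))"
            by (simp add: algebra_simps)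
          then show ?thesis by (simp only: norm_minus_cancel norm_mult norm_of_real abs_exp_cancel)
        qed
        also have "\<dots> \<le> \<epsilon> * exp (- t * r\<^sup>2) + exp (- (t - 1) * \<delta>\<^sup>2) * ((cmod (u x) + cmod (u y)) * exp (- 1 * r\<^sup>2))"
        proof (cases "r < \<delta>")
          case True
          then have "cmod (u x - u y) \<le> \<epsilon>" using \<delta>(2)[of x] by (simp add: r_def dist_norm)
          then have "cmod (u x - u y) * exp (- t * r\<^sup>2) \<le> \<epsilon> * exp (- t * r\<^sup>2)" by (intro mult_right_mono) auto
          moreover have "0 \<le> exp (- (t - 1) * \<delta>\<^sup>2) * ((cmod (u x) + cmod (u y)) * exp (- 1 * r\<^sup>2))" by simp
          ultimately show ?thesis by linarith
        next
          case False
          then have "\<delta>\<^sup>2 \<le> r\<^sup>2" using \<delta>(1) by (intro power_mono) auto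
          then have "(t - 1) * \<delta>\<^sup>2 \<le> (t - 1) * r\<^sup>2" using t by (intro mult_left_mono) auto
          then have "exp (- t * r\<^sup>2) \<le> exp (- (t - 1) * \<delta>\<^sup>2 + - 1 * r\<^sup>2)" by (simp add: algebra_simps)
          then have "exp (- t * r\<^sup>2) \<le> exp (- (t - 1) * \<delta>\<^sup>2) * exp (- 1 * r\<^sup>2)" unfolding exp_add .
          then have "cmod (u x - u y) * exp (- t * r\<^sup>2) \<le> (cmod (u x) + cmod (u y)) * (exp (- (t - 1) * \<delta>\<^sup>2) * exp (- 1 * r\<^sup>2))"
            by (intro mult_mono norm_triangle_ineq4) auto
          moreover have "0 \<le> \<epsilon> * exp (- t * r\<^sup>2)" using \<epsilon> by simp
          ultimately show ?thesis by (simp add: mult_ac)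
        qed
        finally show "cmod (complex_of_real (gauss t (x - y)) * u y - u x * complex_of_real (gauss t (x - y)))
           \<le> \<epsilon> * gauss t (x - y) + exp (- (t - 1) * \<delta>\<^sup>2) * ((cmod (u x) + cmod (u y)) * gauss 1 (x - y))"
          unfolding r_def .
      qed
      also have "\<dots> = \<epsilon> * c + exp (- (t - 1) * \<delta>\<^sup>2) * D"
        unfolding c_def D_def using gi[OF t(2)] Di
        by (subst Bochner_Integration.integral_add) (auto intro!: integrable_mult_right)
      finally have 1: "c * cmod (u y) \<le> \<epsilon> * c + exp (- (t - 1) * \<delta>\<^sup>2) * D" using c0 by (simp add: norm_mult)
      have D0: "0 \<le> D" unfolding D_def by (intro integral_nonneg_AE AE_I2) simp
      have "exp (- (t - 1) * \<delta>\<^sup>2) * D = exp (- t * (\<delta> / 2)\<^sup>2) * v * (exp (\<delta>\<^sup>2) * D / v * exp (- (3 / 4 * \<delta>\<^sup>2) * t))"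
      proof -
        have "- (t - 1) * \<delta>\<^sup>2 = - t * (\<delta> / 2)\<^sup>2 + \<delta>\<^sup>2 + - (3 / 4 * \<delta>\<^sup>2) * t" by (simp add: field_simps power2_eq_square)
        then have "exp (- (t - 1) * \<delta>\<^sup>2) = exp (- t * (\<delta> / 2)\<^sup>2) * exp (\<delta>\<^sup>2) * exp (- (3 / 4 * \<delta>\<^sup>2) * t)"
          by (simp only: exp_add)
        then show ?thesis using v0 by simp
      qed
      also have "\<dots> \<le> c * (exp (\<delta>\<^sup>2) * D / v * exp (- (3 / 4 * \<delta>\<^sup>2) * t))"
        using cv D0 v0 by (intro mult_right_mono) auto
      finally have "c * cmod (u y) \<le> c * (\<epsilon> + exp (\<delta>\<^sup>2) * D / v * exp (- (3 / 4 * \<delta>\<^sup>2) * t))"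
        using 1 by (simp add: distrib_left mult.commute)
      then show ?thesis using c0 by (simp add: t_def)
    qed
    have "((\<lambda>m. \<epsilon> + exp (\<delta>\<^sup>2) * D / v * exp (- (3 / 4 * \<delta>\<^sup>2) * s m)) \<longlongrightarrow> \<epsilon> + exp (\<delta>\<^sup>2) * D / v * 0) sequentially"
    proof (intro tendsto_intros)
      have "filterlim (\<lambda>m. - (3 / 4 * \<delta>\<^sup>2) * s m) at_bot sequentially"
        using \<delta>(1) slim by (intro filterlim_tendsto_neg_mult_at_bot[OF tendsto_const]) auto
      then show "((\<lambda>m. exp (- (3 / 4 * \<delta>\<^sup>2) * s m)) \<longlongrightarrow> 0) sequentially"
        by (rule filterlim_compose[OF exp_at_bot])
    qed
    moreover have "\<forall>\<^sub>F m in sequentially. cmod (u y) \<le> \<epsilon> + exp (\<delta>\<^sup>2) * D / v * exp (- (3 / 4 * \<delta>\<^sup>2) * s m)"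
    proof -
      have "\<forall>\<^sub>F m in sequentially. s m \<ge> 1" using slim by (simp add: filterlim_at_top)
      then show ?thesis by (rule eventually_mono) (rule main)
    qed
    ultimately have "cmod (u y) \<le> \<epsilon> + exp (\<delta>\<^sup>2) * D / v * 0"
      by (intro tendsto_lowerbound) auto
    then show ?thesis by simp
  qed
  then have "cmod (u y) \<le> 0" by (rule field_le_epsilon) simp
  then show ?thesis by simp
qed

end

section \<open>The eigenspaces of the Hermite operator\<close>

lemma max_power_has_derivative:
  assumes "k \<ge> 1"
  shows "((\<lambda>t::real. max 0 t ^ Suc k) has_real_derivative (real (Suc k) * max 0 t ^ k)) (at t)"
proof -
  consider "t < 0" | "t = 0" | "t > 0" by linarith
  then show ?thesis
  proof cases
    case 1
    have "((\<lambda>t::real. 0) has_real_derivative 0) (at t)" by simp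
    then have "((\<lambda>t::real. max 0 t ^ Suc k) has_real_derivative 0) (at t)"
      by (rule has_field_derivative_transform_within_open[where S="{..<0}"]) (use 1 in \<open>auto simp: max_def\<close>)
    then show ?thesis by (rule DERIV_cong) (use 1 assms in \<open>simp add: max_def\<close>)
  next
    case 3
    have "((\<lambda>t::real. t ^ Suc k) has_real_derivative real (Suc k) * t ^ k) (at t)"
      using DERIV_pow[of "Suc k" t UNIV] by simp
    then have "((\<lambda>t::real. max 0 t ^ Suc k) has_real_derivative real (Suc k) * t ^ k) (at t)"
      by (rule has_field_derivative_transform_within_open[where S="{0<..}"]) (use 3 in \<open>auto simp: max_def\<close>)
    then show ?thesis by (rule DERIV_cong) (use 3 in \<open>simp add: max_def\<close>)
  next
    case 2
    have "((\<lambda>h. (max 0 (0 + h) ^ Suc k - max 0 (0::real) ^ Suc k) / h) \<longlongrightarrow> 0) (at 0)"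
    proof (rule Lim_null_comparison)
      show "\<forall>\<^sub>F h in at (0::real). norm ((max 0 (0 + h) ^ Suc k - max 0 (0::real) ^ Suc k) / h) \<le> \<bar>h\<bar> ^ k"
        by (intro always_eventually allI) (auto simp: max_def abs_mult power_abs zero_le_power)
      have "((\<lambda>h::real. \<bar>h\<bar> ^ k) \<longlongrightarrow> \<bar>0\<bar> ^ k) (at 0)" by (intro tendsto_intros)
      moreover have "\<bar>0::real\<bar> ^ k = 0" using assms by simp
      ultimately show "((\<lambda>h::real. \<bar>h\<bar> ^ k) \<longlongrightarrow> 0) (at 0)" by (simp only:)
    qed
    then have "((\<lambda>t::real. max 0 t ^ Suc k) has_real_derivative 0) (at 0)" by (simp add: DERIV_def)
    then show ?thesis unfolding 2 by (rule DERIV_cong) (use assms in simp)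
  qed
qed

text \<open>Integration by parts in one direction needs the derivative in this direction only, and the
  derivatives of products and of the cutoff are easier to compute on lines.\<close>

definition dirderiv :: "'a::real_normed_vector \<Rightarrow> ('a \<Rightarrow> complex) \<Rightarrow> ('a \<Rightarrow> complex) \<Rightarrow> bool" where
  "dirderiv v f f' \<longleftrightarrow> (\<forall>x. ((\<lambda>s. f (x + s *\<^sub>R v)) has_vector_derivative f' x) (at 0))"

lemma dirderiv_at:
  assumes "dirderiv v f f'"
  shows "((\<lambda>s. f (x + s *\<^sub>R v)) has_vector_derivative f' (x + s *\<^sub>R v)) (at s)"
proof -
  have "((\<lambda>r. f ((x + s *\<^sub>R v) + r *\<^sub>R v)) has_vector_derivative f' (x + s *\<^sub>R v)) (at (s - s))"
    using assms by (simp add: dirderiv_def)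
  moreover have "((\<lambda>r::real. r - s) has_real_derivative 1) (at s)" by (auto intro!: derivative_eq_intros)
  ultimately have "((\<lambda>r. f ((x + s *\<^sub>R v) + r *\<^sub>R v)) \<circ> (\<lambda>r. r - s) has_vector_derivative 1 *\<^sub>R f' (x + s *\<^sub>R v)) (at s)"
    by (intro vector_diff_chain_at) (auto simp: has_real_derivative_iff_has_vector_derivative)
  then show ?thesis by (simp add: o_def algebra_simps)
qed

lemma dirderiv_mult:
  assumes "dirderiv v f f'" "dirderiv v g g'"
  shows "dirderiv v (\<lambda>x. f x * g x) (\<lambda>x. f x * g' x + f' x * g x)"
  unfolding dirderiv_def
proof
  fix x
  from has_vector_derivative_mult[OF assms[unfolded dirderiv_def, rule_format, of x]]
  show "((\<lambda>s. f (x + s *\<^sub>R v) * g (x + s *\<^sub>R v)) has_vector_derivative f x * g' x + f' x * g x) (at 0)" by simp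
qed

lemma dirderiv_diff:
  assumes "dirderiv v f f'" "dirderiv v g g'"
  shows "dirderiv v (\<lambda>x. f x - g x) (\<lambda>x. f' x - g' x)"
  using assms by (auto simp: dirderiv_def intro: has_vector_derivative_diff)

lemma dirderiv_add:
  assumes "dirderiv v f f'" "dirderiv v g g'"
  shows "dirderiv v (\<lambda>x. f x + g x) (\<lambda>x. f' x + g' x)"
  using assms by (auto simp: dirderiv_def intro: has_vector_derivative_add)

lemma dirderiv_partial:
  assumes "\<And>x. f differentiable at x"
  shows "dirderiv (axis i 1) f (partial i f)"
  unfolding dirderiv_def
proof
  fix x :: "real^'a"
  have f: "(f has_derivative frechet_derivative f (at x)) (at x)"
    using assms frechet_derivative_works by blast
  have "((\<lambda>s. x + s *\<^sub>R axis i 1) has_derivative (\<lambda>s. s *\<^sub>R axis i 1)) (at 0)"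
    by (auto intro!: derivative_eq_intros)
  from has_derivative_compose[OF this, of f "frechet_derivative f (at x)"] f
  have "((\<lambda>s. f (x + s *\<^sub>R axis i 1)) has_derivative (\<lambda>s. frechet_derivative f (at x) (s *\<^sub>R axis i 1))) (at 0)" by simp
  then show "((\<lambda>s. f (x + s *\<^sub>R axis i 1)) has_vector_derivative partial i f x) (at 0)"
    unfolding has_vector_derivative_def partial_def
    by (simp add: linear_scale[OF has_derivative_linear[OF f]])
qed

lemma integrable_compact_support:
  fixes f :: "'a::euclidean_space \<Rightarrow> complex"
  assumes "continuous_on UNIV f" "\<And>x. norm x > R \<Longrightarrow> f x = 0"
  shows "integrable lborel f" "\<exists>M\<ge>0. \<forall>x. norm (f x) \<le> M"
proof -
  have "integrable lborel (\<lambda>x. indicator (cball 0 R) x *\<^sub>R f x)"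
    using assms(1) by (intro borel_integrable_compact) (auto intro: continuous_on_subset)
  moreover have "(\<lambda>x. indicator (cball 0 R) x *\<^sub>R f x) = f"
    using assms(2) by (auto simp: indicator_def fun_eq_iff)
  ultimately show "integrable lborel f" by simp
  have "compact (f ` cball 0 R)"
    by (intro compact_continuous_image continuous_on_subset[OF assms(1)]) auto
  then have "bounded (f ` cball 0 R)" by (rule compact_imp_bounded)
  then obtain M where M: "M > 0" "\<forall>y \<in> f ` cball 0 R. norm y \<le> M" unfolding bounded_pos by (elim exE conjE)
  have "norm (f x) \<le> M" for x
  proof (cases "norm x > R")
    case True
    then show ?thesis using assms(2)[of x] M(1) by simp
  next
    case False
    then have "f x \<in> f ` cball 0 R" by simp
    then show ?thesis using M(2) by blast
  qed
  then show "\<exists>M\<ge>0. \<forall>x. norm (f x) \<le> M" using M(1) by (intro exI[of _ M]) simp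
qed

lemma integral_dirderiv_compact_support_eq_0:
  fixes F F' :: "'a::euclidean_space \<Rightarrow> complex"
  assumes v: "norm v = 1" and d: "dirderiv v F F'"
    and cont: "continuous_on UNIV F" "continuous_on UNIV F'"
    and supp: "\<And>x. norm x > R \<Longrightarrow> F x = 0" "\<And>x. norm x > R \<Longrightarrow> F' x = 0"
  shows "integral\<^sup>L lborel F' = 0"
proof -
  obtain M where M: "M \<ge> 0" "\<And>x. norm (F' x) \<le> M"
    using integrable_compact_support(2)[OF cont(2) supp(2)] by blast
  show ?thesis
  proof (rule integral_directional_derivative_eq_0[where v=v and F=F and G="\<lambda>x. M * indicator (cball 0 (R + 1)) x"])
    show "integrable lborel F" by (rule integrable_compact_support(1)[OF cont(1) supp(1)])
    show "F' \<in> borel_measurable borel" by (rule borel_measurable_continuous_onI[OF cont(2)])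
    show "integrable lborel (\<lambda>x. M * indicat_real (cball 0 (R + 1)) x)"
      by (intro integrable_mult_right integrable_real_indicator emeasure_compact_finite compact_cball) simp
    show "((\<lambda>s. F (x + s *\<^sub>R v)) has_vector_derivative F' (x + s *\<^sub>R v)) (at s)" for x s by (rule dirderiv_at[OF d])
    fix x and s :: real assume s: "0 \<le> s" "s \<le> 1"
    show "norm (F' (x + s *\<^sub>R v)) \<le> M * indicator (cball 0 (R + 1)) x"
    proof (cases "norm x \<le> R + 1")
      case True then show ?thesis using M by simp
    next
      case False
      have "norm x \<le> norm (x + s *\<^sub>R v) + norm (s *\<^sub>R v)" using norm_triangle_ineq4[of "x + s *\<^sub>R v" "s *\<^sub>R v"] by simp
      also have "norm (s *\<^sub>R v) \<le> 1" using s v by simp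
      finally have "norm (x + s *\<^sub>R v) > R" using False by simp
      then show ?thesis using supp(2) False by simp
    qed
  qed
qed

text \<open>The third power of this function is a twice continuously differentiable cutoff which is
  given by a polynomial on its support.\<close>

definition cut :: "real \<Rightarrow> real^'n::finite \<Rightarrow> real" where
  "cut R x = max 0 (1 - (norm x)\<^sup>2 / R\<^sup>2)"

lemma cut_bounds: "0 \<le> cut R x" "cut R x \<le> 1"
  by (auto simp: cut_def)

lemma cut_zero: "R > 0 \<Longrightarrow> R < norm x \<Longrightarrow> cut R x = 0"
proof -
  assume "R > 0" "R < norm x"
  then have "R\<^sup>2 \<le> (norm x)\<^sup>2" by (intro power_mono) auto
  then show ?thesis using \<open>R > 0\<close> by (simp add: cut_def)
qed

lemma continuous_cut: "continuous_on UNIV (cut R)"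
  unfolding cut_def[abs_def] divide_inverse by (intro continuous_intros)

lemma norm_axis_shift: "(norm (x + s *\<^sub>R axis i 1))\<^sup>2 = (norm (x::real^'n::finite))\<^sup>2 + 2 * s * x $ i + s\<^sup>2"
proof -
  have "(norm (x + s *\<^sub>R axis i 1))\<^sup>2 = (x + s *\<^sub>R axis i 1) \<bullet> (x + s *\<^sub>R axis i 1)"
    by (rule power2_norm_eq_inner)
  also have "\<dots> = x \<bullet> x + 2 * s * x $ i + s\<^sup>2"
    by (simp add: inner_add_left inner_add_right inner_axis inner_axis' inner_axis_axis power2_eq_square distrib_left)
  finally show ?thesis by (simp add: power2_norm_eq_inner)
qed

lemma cut_power_dirderiv:
  assumes "k \<ge> 1"
  shows "dirderiv (axis i 1) (\<lambda>x. complex_of_real (cut R x ^ Suc k))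
    (\<lambda>x. complex_of_real (- 2 * real (Suc k) / R\<^sup>2 * (cut R x ^ k * x $ i)))"
  unfolding dirderiv_def
proof
  fix x :: "real^'a"
  define g where "g s = 1 - ((norm x)\<^sup>2 + 2 * s * x $ i + s\<^sup>2) / R\<^sup>2" for s
  have g0: "max 0 (g 0) = cut R x" by (simp add: g_def cut_def)
  have "(g has_real_derivative (- (2 * x $ i) / R\<^sup>2)) (at 0)"
    unfolding g_def by (auto intro!: derivative_eq_intros simp: divide_inverse)
  from DERIV_chain2[OF max_power_has_derivative[OF assms] this]
  have "((\<lambda>s. max 0 (g s) ^ Suc k) has_real_derivative (real (Suc k) * max 0 (g 0) ^ k * (- (2 * x $ i) / R\<^sup>2))) (at 0)" .
  then have "((\<lambda>s. max 0 (g s) ^ Suc k) has_real_derivative (- 2 * real (Suc k) / R\<^sup>2 * (cut R x ^ k * x $ i))) (at 0)"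
    unfolding g0 by (rule DERIV_cong) (simp add: algebra_simps diff_divide_distrib add_divide_distrib)
  from has_vector_derivative_of_real[OF this]
  show "((\<lambda>s. complex_of_real (cut R (x + s *\<^sub>R axis i 1) ^ Suc k)) has_vector_derivative
    complex_of_real (- 2 * real (Suc k) / R\<^sup>2 * (cut R x ^ k * x $ i))) (at 0)"
    unfolding cut_def norm_axis_shift g_def .
qed

lemma coordinate_dirderiv: "dirderiv (axis i 1) (\<lambda>x. complex_of_real (x $ i)) (\<lambda>x. 1)"
  unfolding dirderiv_def
proof
  fix x :: "real^'a"
  have "((\<lambda>s. x $ i + s) has_real_derivative 1) (at 0)" by (auto intro!: derivative_eq_intros)
  from has_vector_derivative_of_real[OF this]
  show "((\<lambda>s. complex_of_real ((x + s *\<^sub>R axis i 1) $ i)) has_vector_derivative 1) (at 0)" by (simp add: axis_def)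
qed

text \<open>Here \<open>dcutoff\<close> and \<open>ddcutoff\<close> are the first and second derivatives of the cutoff along the
  \<open>i\<close>-th axis.\<close>

definition cutoff :: "real \<Rightarrow> real^'n::finite \<Rightarrow> complex" where
  "cutoff R x = complex_of_real (cut R x ^ 3)"

definition dcutoff :: "real \<Rightarrow> 'n \<Rightarrow> real^'n::finite \<Rightarrow> complex" where
  "dcutoff R i x = complex_of_real (- 6 / R\<^sup>2 * (cut R x ^ 2 * x $ i))"

definition ddcutoff :: "real \<Rightarrow> 'n \<Rightarrow> real^'n::finite \<Rightarrow> complex" where
  "ddcutoff R i x = complex_of_real (- 6 / R\<^sup>2 * (cut R x ^ 2 - 4 / R\<^sup>2 * cut R x * (x $ i)\<^sup>2))"

lemma cutoff_dirderiv:
  "dirderiv (axis i 1) (cutoff R) (dcutoff R i)"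
  using cut_power_dirderiv[of 2 i R] by (simp add: cutoff_def[abs_def] dcutoff_def[abs_def] eval_nat_numeral)

lemma dcutoff_dirderiv:
  fixes i :: "'n::finite"
  shows "dirderiv (axis i 1) (dcutoff R i) (ddcutoff R i)"
proof -
  have c: "dirderiv (axis i 1) (\<lambda>x. complex_of_real (cut R x ^ 2)) (\<lambda>x. complex_of_real (- 4 / R\<^sup>2 * (cut R x * x $ i)))"
    using cut_power_dirderiv[of 1 i R] by (simp add: eval_nat_numeral)
  have k: "dirderiv (axis i 1) (\<lambda>x::real^'n. complex_of_real (- 6 / R\<^sup>2)) (\<lambda>x. 0)"
    by (simp add: dirderiv_def)
  from dirderiv_mult[OF k dirderiv_mult[OF c coordinate_dirderiv]]
  have "dirderiv (axis i 1) (dcutoff R i) (\<lambda>x. complex_of_real (- 6 / R\<^sup>2) * (complex_of_real ((cut R x)\<^sup>2) * 1 + complex_of_real (- 4 / R\<^sup>2 * (cut R x * x $ i)) * complex_of_real (x $ i)) + 0 * (complex_of_real ((cut R x)\<^sup>2) * complex_of_real (x $ i)))"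
    by (simp add: dcutoff_def[abs_def])
  moreover have "(\<lambda>x. complex_of_real (- 6 / R\<^sup>2) * (complex_of_real ((cut R x)\<^sup>2) * 1 + complex_of_real (- 4 / R\<^sup>2 * (cut R x * x $ i)) * complex_of_real (x $ i)) + 0 * (complex_of_real ((cut R x)\<^sup>2) * complex_of_real (x $ i))) = ddcutoff R i"
    unfolding ddcutoff_def[abs_def] of_real_mult[symmetric] of_real_add[symmetric] mult_zero_left add_0_right mult_1_right
    by (rule ext, rule arg_cong[where f=complex_of_real]) (simp add: power2_eq_square algebra_simps)
  ultimately show ?thesis by simp
qed

lemma continuous_cutoff: "continuous_on UNIV (cutoff R)" "continuous_on UNIV (dcutoff R i)" "continuous_on UNIV (ddcutoff R i)"
  unfolding cutoff_def[abs_def] dcutoff_def[abs_def] ddcutoff_def[abs_def]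
  by (intro continuous_intros continuous_cut)+

text \<open>On the support each factor \<open>x\<^sub>i\<close> is at most \<open>R\<close>, so that every derivative gains a factor \<open>1
  / R\<close>. For the second derivative the decay \<open>1 / R\<close> suffices in place of \<open>1 / R\<^sup>2\<close>: \<open>6 (1 + 4) =
  30\<close>.\<close>

lemma cutoff_bounds:
  assumes R: "R \<ge> 1"
  shows "cmod (cutoff R x) \<le> 1" "cmod (dcutoff R i x) \<le> 6 / R" "cmod (ddcutoff R i x) \<le> 30 / R"
proof -
  have c: "0 \<le> cut R x ^ k" "cut R x ^ k \<le> 1" for k using cut_bounds[of R x] by (auto intro: power_le_one)
  show "cmod (cutoff R x) \<le> 1" using c[of 3] by (simp add: cutoff_def del: of_real_power)
  have b: "\<bar>cut R x ^ k * x $ i ^ m\<bar> \<le> R ^ m" if "k \<ge> 1" for k m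
  proof (cases "norm x > R")
    case True then show ?thesis using cut_zero[of R x] R that by (simp add: power_0_left)
  next
    case False
    have "\<bar>x $ i\<bar> \<le> R" using component_le_norm_cart[of x i] False by simp
    then have "\<bar>x $ i\<bar> ^ m \<le> R ^ m" by (intro power_mono) auto
    moreover have "\<bar>cut R x ^ k * x $ i ^ m\<bar> \<le> 1 * \<bar>x $ i\<bar> ^ m" unfolding abs_mult power_abs using c[of k] cut_bounds[of R x] by (intro mult_right_mono) auto
    ultimately show ?thesis by simp
  qed
  have "cmod (dcutoff R i x) = 6 / R\<^sup>2 * \<bar>cut R x ^ 2 * x $ i ^ 1\<bar>" by (simp add: dcutoff_def norm_mult norm_divide abs_mult norm_power)
  also have "\<dots> \<le> 6 / R\<^sup>2 * R ^ 1" by (intro mult_left_mono b) auto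
  also have "\<dots> = 6 / R" using R by (simp add: power2_eq_square)
  finally show "cmod (dcutoff R i x) \<le> 6 / R" .
  have "cmod (ddcutoff R i x) = 6 / R\<^sup>2 * \<bar>cut R x ^ 2 - 4 / R\<^sup>2 * (cut R x * (x $ i)\<^sup>2)\<bar>"
    unfolding ddcutoff_def norm_of_real abs_mult by (simp add: mult.assoc)
  also have "\<dots> \<le> 6 / R\<^sup>2 * (1 + 4 / R\<^sup>2 * R\<^sup>2)"
  proof (intro mult_left_mono)
    have "\<bar>cut R x ^ 2 - 4 / R\<^sup>2 * (cut R x * (x $ i)\<^sup>2)\<bar> \<le> \<bar>cut R x ^ 2\<bar> + 4 / R\<^sup>2 * \<bar>cut R x ^ 1 * x $ i ^ 2\<bar>"
      using abs_triangle_ineq4[of "cut R x ^ 2" "4 / R\<^sup>2 * (cut R x * (x $ i)\<^sup>2)"] by (simp add: abs_mult)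
    also have "\<dots> \<le> 1 + 4 / R\<^sup>2 * R\<^sup>2" using c[of 2] by (intro add_mono mult_left_mono b) auto
    finally show "\<bar>cut R x ^ 2 - 4 / R\<^sup>2 * (cut R x * (x $ i)\<^sup>2)\<bar> \<le> 1 + 4 / R\<^sup>2 * R\<^sup>2" .
  qed auto
  also have "\<dots> = 30 / R\<^sup>2" using R by simp
  also have "\<dots> \<le> 30 / R" using R by (simp add: field_simps power2_eq_square)
  finally show "cmod (ddcutoff R i x) \<le> 30 / R" .
qed

lemma cutoff_zero: "R > 0 \<Longrightarrow> R < norm x \<Longrightarrow> cutoff R x = 0 \<and> dcutoff R i x = 0 \<and> ddcutoff R i x = 0"
  by (simp add: cutoff_def dcutoff_def ddcutoff_def cut_zero)

lemma C1_imp: "C1 f \<Longrightarrow> continuous_on UNIV f" "C1 f \<Longrightarrow> dirderiv (axis i 1) f (partial i f)"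
  by (auto simp: C1_def intro: dirderiv_partial intro!: continuous_at_imp_continuous_on differentiable_imp_continuous_within)

lemma C2_imp:
  assumes "C2 f"
  shows "continuous_on UNIV f" "continuous_on UNIV (partial i f)" "continuous_on UNIV (partial i (partial i f))"
    "dirderiv (axis i 1) f (partial i f)" "dirderiv (axis i 1) (partial i f) (partial i (partial i f))"
proof -
  have c: "C1 f" "C1 (partial i f)" using assms by (auto simp: C2_def)
  show "continuous_on UNIV f" "continuous_on UNIV (partial i f)"
    "dirderiv (axis i 1) f (partial i f)" "dirderiv (axis i 1) (partial i f) (partial i (partial i f))"
    by (rule C1_imp c)+
  show "continuous_on UNIV (partial i (partial i f))" using c(2) unfolding C1_def by blast
qed

text \<open>The integrand is the derivative along the \<open>i\<close>-th axis of \<open>u \<partial>\<^sub>i(\<chi> h) - \<chi> h \<partial>\<^sub>i u\<close>, where \<open>\<chi>\<close>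
  denotes the cutoff.\<close>

lemma Green_coordinate:
  fixes u h :: "real^'n::finite \<Rightarrow> complex"
  assumes u: "C2 u" and h: "C2 h" and R: "R > 0"
  shows "integral\<^sup>L lborel (\<lambda>x. u x * (ddcutoff R i x * h x + 2 * dcutoff R i x * partial i h x + cutoff R x * partial i (partial i h) x)
      - cutoff R x * h x * partial i (partial i u) x) = 0"
    and "integrable lborel (\<lambda>x. u x * (ddcutoff R i x * h x + 2 * dcutoff R i x * partial i h x + cutoff R x * partial i (partial i h) x)
      - cutoff R x * h x * partial i (partial i u) x)"
proof -
  let ?p = "\<lambda>x. cutoff R x * partial i h x + dcutoff R i x * h x"
  let ?F = "\<lambda>x. u x * ?p x - cutoff R x * h x * partial i u x"
  let ?F' = "\<lambda>x. u x * (ddcutoff R i x * h x + 2 * dcutoff R i x * partial i h x + cutoff R x * partial i (partial i h) x)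
      - cutoff R x * h x * partial i (partial i u) x"
  have phi: "dirderiv (axis i 1) (\<lambda>x. cutoff R x * h x) ?p"
    by (rule dirderiv_mult[OF cutoff_dirderiv C2_imp(4)[OF h]])
  have p: "dirderiv (axis i 1) ?p (\<lambda>x. (cutoff R x * partial i (partial i h) x + dcutoff R i x * partial i h x)
      + (dcutoff R i x * partial i h x + ddcutoff R i x * h x))"
    by (intro dirderiv_add dirderiv_mult cutoff_dirderiv dcutoff_dirderiv C2_imp(4,5)[OF h])
  have "dirderiv (axis i 1) ?F (\<lambda>x. (u x * ((cutoff R x * partial i (partial i h) x + dcutoff R i x * partial i h x)
      + (dcutoff R i x * partial i h x + ddcutoff R i x * h x)) + partial i u x * ?p x)
      - (cutoff R x * h x * partial i (partial i u) x + ?p x * partial i u x))"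
    by (intro dirderiv_diff dirderiv_mult[OF C2_imp(4)[OF u] p] dirderiv_mult[OF phi C2_imp(5)[OF u]])
  moreover have "(\<lambda>x. (u x * ((cutoff R x * partial i (partial i h) x + dcutoff R i x * partial i h x)
      + (dcutoff R i x * partial i h x + ddcutoff R i x * h x)) + partial i u x * ?p x)
      - (cutoff R x * h x * partial i (partial i u) x + ?p x * partial i u x)) = ?F'"
    by (rule ext) (simp add: algebra_simps)
  ultimately have d: "dirderiv (axis i 1) ?F ?F'" by (simp only:)
  have c: "continuous_on UNIV ?F" "continuous_on UNIV ?F'"
    by (intro continuous_intros continuous_cutoff C2_imp(1-3)[OF u] C2_imp(1-3)[OF h])+
  have z: "norm x > R \<Longrightarrow> ?F x = 0" "norm x > R \<Longrightarrow> ?F' x = 0" for x using cutoff_zero[OF R, of x i] by auto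
  show "integral\<^sup>L lborel ?F' = 0"
    by (rule integral_dirderiv_compact_support_eq_0[OF _ d c z]) auto
  show "integrable lborel ?F'" by (rule integrable_compact_support(1)[OF c(2) z(2)])
qed

lemma hermite_op_eq: "hermite_op u x = e * u x \<Longrightarrow> (\<Sum>i\<in>UNIV. partial i (partial i u) x) = (complex_of_real ((norm x)\<^sup>2) - e) * u x"
  unfolding hermite_op_def by (simp add: algebra_simps)

text \<open>The sum over \<open>i\<close> of Green's identity for \<open>u\<close> and \<open>\<chi> h\<^sub>\<alpha>\<close> gives the difference of the
  eigenvalues times the integral of \<open>\<chi> u h\<^sub>\<alpha>\<close>, up to an error \<open>E\<close> from the derivatives of the
  cutoff. In this form the error contains derivatives of \<open>h\<^sub>\<alpha>\<close>, which are rapidly decreasing, but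
  none of \<open>u\<close>, on which square integrability of \<open>u\<close> gives no immediate control. Hence the error is
  \<open>O(1/R)\<close>.\<close>

lemma eigenfunction_orthogonal:
  fixes u :: "real^'n::finite \<Rightarrow> complex"
  assumes u: "C2 u" and u2: "integrable lborel (\<lambda>x. (cmod (u x))\<^sup>2)"
    and eig: "\<And>x. hermite_op u x = of_nat (2 * k + CARD('n)) * u x" and ne: "deg \<alpha> \<noteq> k"
  shows "integral\<^sup>L lborel (\<lambda>x. u x * cHerm \<alpha> x) = 0"
proof -
  define h where "h x = cHerm \<alpha> x" for x :: "real^'n"
  have h: "C2 h" unfolding h_def[abs_def] by (rule Herm_C2)
  have um: "u \<in> borel_measurable borel" by (rule borel_measurable_continuous_onI[OF C2_imp(1)[OF u]])
  have hsp: "integrable lborel (\<lambda>x. u x * complex_of_real (f x))" if "f \<in> hspan" for f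
    by (rule integrable_mult_hspan[OF um u2 that])
  have pd: "\<exists>g\<in>hspan. partial i h = (\<lambda>x. complex_of_real (g x))" for i
  proof
    let ?g = "\<lambda>x. (sqrt (\<alpha> i) / sqrt 2) * Herm (\<alpha>(i := \<alpha> i - 1)) x + (- sqrt (Suc (\<alpha> i)) / sqrt 2) * Herm (\<alpha>(i := Suc (\<alpha> i))) x"
    show "?g \<in> hspan" by (intro hspan.intros)
    show "partial i h = (\<lambda>x. complex_of_real (?g x))"
      unfolding h_def[abs_def] Herm_partial dHerm_eq by (rule ext) (simp add: diff_divide_distrib del: of_nat_Suc)
  qed
  have uh: "integrable lborel (\<lambda>x. u x * h x)" unfolding h_def by (rule hsp[OF hspan_Herm])
  have up: "integrable lborel (\<lambda>x. u x * partial i h x)" for i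
    using pd[of i] hsp by auto
  define \<mu> where "\<mu> = complex_of_nat (2 * k + CARD('n)) - of_nat (2 * deg \<alpha> + CARD('n))"
  have \<mu>: "\<mu> \<noteq> 0"
  proof
    assume "\<mu> = 0"
    then have "2 * k + CARD('n) = 2 * deg \<alpha> + CARD('n)" by (simp only: \<mu>_def right_minus_eq of_nat_eq_iff)
    then show False using ne by simp
  qed
  define K where "K = (\<Sum>i\<in>UNIV. 30 * integral\<^sup>L lborel (\<lambda>x. cmod (u x * h x)) + 12 * integral\<^sup>L lborel (\<lambda>x. cmod (u x * partial i h x)))"
  define E where "E R x = (\<Sum>i\<in>UNIV. u x * (ddcutoff R i x * h x + 2 * dcutoff R i x * partial i h x))" for R x
  have cm: "cutoff R \<in> borel_measurable borel" "dcutoff R i \<in> borel_measurable borel" "ddcutoff R i \<in> borel_measurable borel" "h \<in> borel_measurable borel" "partial i h \<in> borel_measurable borel" for R i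
    by (intro borel_measurable_continuous_onI continuous_cutoff C2_imp(1-3)[OF h])+
  note [measurable] = cm um
  have main: "cmod (\<mu> * integral\<^sup>L lborel (\<lambda>x. cutoff R x * (u x * h x))) \<le> K / R" if R: "R \<ge> 1" for R
  proof -
    have R0: "R > 0" using R by simp
    have cuh: "integrable lborel (\<lambda>x. cutoff R x * (u x * h x))"
      using uh cutoff_bounds(1)[OF R] 
      by (rule_tac Bochner_Integration.integrable_bound[OF integrable_norm[OF uh]])
         (auto intro!: AE_I2 mult_left_le_one_le simp: norm_mult)
    have Ei: "integrable lborel (E R)"
    proof (rule integrable_compact_support(1))
      show "continuous_on UNIV (E R)" unfolding E_def[abs_def] by (intro continuous_intros continuous_cutoff C2_imp(1-3)[OF u] C2_imp(1-3)[OF h])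
      show "norm x > R \<Longrightarrow> E R x = 0" for x using cutoff_zero[OF R0, of x] by (simp add: E_def)
    qed
    have "0 = integral\<^sup>L lborel (\<lambda>x. \<Sum>i\<in>UNIV. u x * (ddcutoff R i x * h x + 2 * dcutoff R i x * partial i h x + cutoff R x * partial i (partial i h) x)
      - cutoff R x * h x * partial i (partial i u) x)"
      using Green_coordinate[OF u h R0] by (subst Bochner_Integration.integral_sum) auto
    also have "\<dots> = integral\<^sup>L lborel (\<lambda>x. E R x + \<mu> * (cutoff R x * (u x * h x)))"
    proof (rule Bochner_Integration.integral_cong[OF refl])
      fix x
      have "(\<Sum>i\<in>UNIV. u x * (ddcutoff R i x * h x + 2 * dcutoff R i x * partial i h x + cutoff R x * partial i (partial i h) x)
        - cutoff R x * h x * partial i (partial i u) x)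
        = E R x + u x * cutoff R x * (\<Sum>i\<in>UNIV. partial i (partial i h) x) - cutoff R x * h x * (\<Sum>i\<in>UNIV. partial i (partial i u) x)"
        unfolding E_def sum_distrib_left sum.distrib[symmetric] sum_subtractf[symmetric]
        by (intro sum.cong refl) (simp add: algebra_simps)
      also have "(\<Sum>i\<in>UNIV. partial i (partial i h) x) = (complex_of_real ((norm x)\<^sup>2) - of_nat (2 * deg \<alpha> + CARD('n))) * h x"
        by (rule hermite_op_eq) (unfold h_def, rule Herm_eigen)
      also have "(\<Sum>i\<in>UNIV. partial i (partial i u) x) = (complex_of_real ((norm x)\<^sup>2) - of_nat (2 * k + CARD('n))) * u x"
        by (rule hermite_op_eq[OF eig])
      finally show "(\<Sum>i\<in>UNIV. u x * (ddcutoff R i x * h x + 2 * dcutoff R i x * partial i h x + cutoff R x * partial i (partial i h) x)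
        - cutoff R x * h x * partial i (partial i u) x) = E R x + \<mu> * (cutoff R x * (u x * h x))"
        by (simp add: \<mu>_def algebra_simps)
    qed
    also have "\<dots> = integral\<^sup>L lborel (E R) + \<mu> * integral\<^sup>L lborel (\<lambda>x. cutoff R x * (u x * h x))"
      using Ei cuh by (subst Bochner_Integration.integral_add) auto
    finally have "\<mu> * integral\<^sup>L lborel (\<lambda>x. cutoff R x * (u x * h x)) = - integral\<^sup>L lborel (E R)"
      by (simp add: eq_neg_iff_add_eq_0 add.commute)
    then have "cmod (\<mu> * integral\<^sup>L lborel (\<lambda>x. cutoff R x * (u x * h x))) = cmod (integral\<^sup>L lborel (E R))" by simp
    also have "\<dots> \<le> integral\<^sup>L lborel (\<lambda>x. \<Sum>i\<in>UNIV. (30 / R) * cmod (u x * h x) + (12 / R) * cmod (u x * partial i h x))"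
    proof (rule Bochner_Integration.integral_norm_bound_integral)
      show "integrable lborel (E R)" by (rule Ei)
      show "integrable lborel (\<lambda>x. \<Sum>i\<in>UNIV. (30 / R) * cmod (u x * h x) + (12 / R) * cmod (u x * partial i h x))"
        by (intro Bochner_Integration.integrable_sum Bochner_Integration.integrable_add integrable_mult_right integrable_norm uh up)
      fix x
      show "norm (E R x) \<le> (\<Sum>i\<in>UNIV. (30 / R) * cmod (u x * h x) + (12 / R) * cmod (u x * partial i h x))"
        unfolding E_def
      proof (rule order_trans[OF norm_sum], rule sum_mono)
        fix i
        have "u x * (ddcutoff R i x * h x + 2 * dcutoff R i x * partial i h x) = ddcutoff R i x * (u x * h x) + 2 * dcutoff R i x * (u x * partial i h x)"
          by (simp add: algebra_simps)
        also have "cmod \<dots> \<le> cmod (ddcutoff R i x) * cmod (u x * h x) + 2 * cmod (dcutoff R i x) * cmod (u x * partial i h x)"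
          by (rule order_trans[OF norm_triangle_ineq]) (simp add: norm_mult)
        also have "\<dots> \<le> (30 / R) * cmod (u x * h x) + 2 * (6 / R) * cmod (u x * partial i h x)"
          using cutoff_bounds[OF R] by (intro add_mono mult_right_mono mult_left_mono) auto
        finally show "cmod (u x * (ddcutoff R i x * h x + 2 * dcutoff R i x * partial i h x)) \<le> (30 / R) * cmod (u x * h x) + (12 / R) * cmod (u x * partial i h x)"
          by simp
      qed
    qed
    also have "\<dots> = K / R"
      using uh up by (subst Bochner_Integration.integral_sum)
        (auto simp: K_def sum_divide_distrib add_divide_distrib intro!: sum.cong integrable_norm)
    finally show ?thesis .
  qed
  have lim: "(\<lambda>m. integral\<^sup>L lborel (\<lambda>x. cutoff (real (Suc m)) x * (u x * h x))) \<longlonglongrightarrow> integral\<^sup>L lborel (\<lambda>x. u x * h x)"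
  proof (rule integral_dominated_convergence[where w="\<lambda>x. cmod (u x * h x)"])
    show "integrable lborel (\<lambda>x. cmod (u x * h x))" using uh by (rule integrable_norm)
    show "AE x in lborel. (\<lambda>m. cutoff (real (Suc m)) x * (u x * h x)) \<longlonglongrightarrow> u x * h x"
    proof (rule AE_I2)
      fix x :: "real^'n"
      define a where "a m = (norm x)\<^sup>2 * (inverse (real (Suc m)))\<^sup>2" for m
      have "a \<longlonglongrightarrow> (norm x)\<^sup>2 * 0\<^sup>2"
        unfolding a_def by (intro tendsto_intros LIMSEQ_inverse_real_of_nat)
      then have "(\<lambda>m. complex_of_real (max 0 (1 - a m) ^ 3)) \<longlonglongrightarrow> complex_of_real (max 0 (1 - (norm x)\<^sup>2 * 0\<^sup>2) ^ 3)"
        by (intro tendsto_intros)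
      moreover have "cutoff (real (Suc m)) x = complex_of_real (max 0 (1 - a m) ^ 3)" for m
        unfolding cutoff_def cut_def a_def divide_inverse power_inverse ..
      ultimately have "(\<lambda>m. cutoff (real (Suc m)) x) \<longlonglongrightarrow> 1" by simp
      then have "(\<lambda>m. cutoff (real (Suc m)) x * (u x * h x)) \<longlonglongrightarrow> 1 * (u x * h x)" by (intro tendsto_intros)
      then show "(\<lambda>m. cutoff (real (Suc m)) x * (u x * h x)) \<longlonglongrightarrow> u x * h x" by simp
    qed
    show "AE x in lborel. norm (cutoff (real (Suc m)) x * (u x * h x)) \<le> cmod (u x * h x)" for m
      using cutoff_bounds(1)[of "real (Suc m)"] by (intro AE_I2) (auto intro!: mult_left_le_one_le simp: norm_mult)
  qed measurable
  have "(\<lambda>m. \<mu> * integral\<^sup>L lborel (\<lambda>x. cutoff (real (Suc m)) x * (u x * h x))) \<longlonglongrightarrow> \<mu> * integral\<^sup>L lborel (\<lambda>x. u x * h x)"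
    by (intro tendsto_intros lim)
  moreover have "(\<lambda>m. \<mu> * integral\<^sup>L lborel (\<lambda>x. cutoff (real (Suc m)) x * (u x * h x))) \<longlonglongrightarrow> 0"
  proof (rule Lim_null_comparison)
    show "\<forall>\<^sub>F m in sequentially. norm (\<mu> * integral\<^sup>L lborel (\<lambda>x. cutoff (real (Suc m)) x * (u x * h x))) \<le> K * inverse (real (Suc m))"
      using main[of "real (Suc m)" for m] by (intro always_eventually allI) (simp add: divide_inverse)
    have "(\<lambda>m. K * inverse (real (Suc m))) \<longlonglongrightarrow> K * 0" by (intro tendsto_intros LIMSEQ_inverse_real_of_nat)
    then show "(\<lambda>m. K * inverse (real (Suc m))) \<longlonglongrightarrow> 0" by simp
  qed
  ultimately have "\<mu> * integral\<^sup>L lborel (\<lambda>x. u x * h x) = 0" by (rule LIMSEQ_unique)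
  then show ?thesis using \<mu> by (simp add: h_def)
qed

lemma square_integrable_lborel:
  assumes "continuous_on UNIV u" "square_integrable u"
  shows "integrable lborel (\<lambda>x. (cmod (u x))\<^sup>2)"
proof -
  have "u \<in> borel_measurable borel" by (rule borel_measurable_continuous_onI[OF assms(1)])
  then have "(\<lambda>x. (cmod (u x))\<^sup>2) \<in> borel_measurable lborel" by measurable
  then show ?thesis using assms(2) unfolding square_integrable_def by (simp add: integrable_completion)
qed

lemma square_integrable_mult:
  fixes u v :: "real^'n::finite \<Rightarrow> complex"
  assumes "square_integrable u" "square_integrable v"
  shows "integrable lebesgue (\<lambda>x. u x * v x)"
proof (rule integrable_dominated)
  show "integrable lebesgue (\<lambda>x. (cmod (u x))\<^sup>2 + (cmod (v x))\<^sup>2)"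
    using assms by (auto simp: square_integrable_def)
  show "(\<lambda>x. u x * v x) \<in> borel_measurable lebesgue"
    using assms by (auto simp: square_integrable_def)
  show "norm (u x * v x) \<le> (cmod (u x))\<^sup>2 + (cmod (v x))\<^sup>2" for x
    using sum_squares_bound[of "cmod (u x)" "cmod (v x)"] mult_nonneg_nonneg[OF norm_ge_zero[of "u x"] norm_ge_zero[of "v x"]]
    unfolding norm_mult by linarith
qed

lemma square_integrable_add:
  fixes u v :: "real^'n::finite \<Rightarrow> complex"
  assumes "square_integrable u" "square_integrable v"
  shows "square_integrable (\<lambda>x. u x + v x)"
proof -
  have m: "(\<lambda>x. u x + v x) \<in> borel_measurable lebesgue" using assms by (auto simp: square_integrable_def)
  have "integrable lebesgue (\<lambda>x. (cmod (u x + v x))\<^sup>2)"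
  proof (rule integrable_dominated)
    show "integrable lebesgue (\<lambda>x. 2 * (cmod (u x))\<^sup>2 + 2 * (cmod (v x))\<^sup>2)"
      using assms by (auto simp: square_integrable_def)
    show "(\<lambda>x. (cmod (u x + v x))\<^sup>2) \<in> borel_measurable lebesgue" using m by measurable
    show "norm ((cmod (u x + v x))\<^sup>2) \<le> 2 * (cmod (u x))\<^sup>2 + 2 * (cmod (v x))\<^sup>2" for x
      using sum_squares_bound[of "cmod (u x)" "cmod (v x)"] power_mono[OF norm_triangle_ineq[of "u x" "v x"] norm_ge_zero, of 2]
      by (simp add: power2_sum)
  qed
  with m show ?thesis by (simp add: square_integrable_def)
qed

lemma square_integrable_cmult: "square_integrable u \<Longrightarrow> square_integrable (\<lambda>x. c * u x)"
  by (auto simp: square_integrable_def norm_mult power_mult_distrib)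

lemma integrable_mult_Herm:
  "square_integrable f \<Longrightarrow> integrable lebesgue (\<lambda>x. f x * cHerm \<alpha> x)"
  by (rule square_integrable_mult[OF _ Herm_sq_integrable])

text \<open>Hermite functions are real, so no conjugation is needed. The coefficient exists for
  functions far beyond \<open>L\<^sup>2\<close>, which is what makes \<open>hproj\<close> an extension of the spectral
  projection.\<close>

definition hcoeff :: "(real^'n::finite \<Rightarrow> complex) \<Rightarrow> ('n \<Rightarrow> nat) \<Rightarrow> complex" where
  "hcoeff f \<alpha> = (LINT x|lebesgue. f x * cHerm \<alpha> x)"

definition hproj :: "nat \<Rightarrow> (real^'n::finite \<Rightarrow> complex) \<Rightarrow> real^'n \<Rightarrow> complex" where
  "hproj k f x = (\<Sum>\<alpha> | deg \<alpha> = k. hcoeff f \<alpha> * cHerm \<alpha> x)"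

lemma C1_add: 
  assumes "C1 f" "C1 g" shows "C1 (\<lambda>x. f x + g x)" "partial i (\<lambda>x. f x + g x) = (\<lambda>x. partial i f x + partial i g x)"
proof -
  have fg: "(f has_derivative frechet_derivative f (at x)) (at x)" "(g has_derivative frechet_derivative g (at x)) (at x)" for x
    using assms frechet_derivative_works unfolding C1_def by blast+
  have D: "((\<lambda>x. f x + g x) has_derivative (\<lambda>h. frechet_derivative f (at x) h + frechet_derivative g (at x) h)) (at x)" for x
    by (intro has_derivative_add fg)
  show p: "partial i (\<lambda>x. f x + g x) = (\<lambda>x. partial i f x + partial i g x)" for i
    by (rule ext) (simp add: partial_eqI[OF D] partial_def)
  show "C1 (\<lambda>x. f x + g x)"
    unfolding C1_def p using assms D unfolding C1_def differentiable_def by (blast intro: continuous_on_add)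
qed

lemma C1_cmult: 
  assumes "C1 f" shows "C1 (\<lambda>x. c * f x)" "partial i (\<lambda>x. c * f x) = (\<lambda>x. c * partial i f x)"
proof -
  have fg: "(f has_derivative frechet_derivative f (at x)) (at x)" for x
    using assms frechet_derivative_works unfolding C1_def by blast
  have D: "((\<lambda>x. c * f x) has_derivative (\<lambda>h. c * frechet_derivative f (at x) h)) (at x)" for x
    by (intro has_derivative_mult_right fg)
  show p: "partial i (\<lambda>x. c * f x) = (\<lambda>x. c * partial i f x)" for i
    by (rule ext) (simp add: partial_eqI[OF D] partial_def)
  show "C1 (\<lambda>x. c * f x)"
    unfolding C1_def p using assms D unfolding C1_def differentiable_def by (blast intro: continuous_on_mult_left)
qed

lemma eigenspace_add:
  assumes "f \<in> hermite_eigenspace k" "g \<in> hermite_eigenspace k"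
  shows "(\<lambda>x. f x + g x) \<in> hermite_eigenspace k"
proof -
  have C: "C1 f" "C1 g" "\<And>i. C1 (partial i f)" "\<And>i. C1 (partial i g)"
    using assms by (auto simp: hermite_eigenspace_def C2_def)
  have p: "partial i (\<lambda>x. f x + g x) = (\<lambda>x. partial i f x + partial i g x)" for i by (rule C1_add(2)[OF C(1,2)])
  have "C2 (\<lambda>x. f x + g x)"
    unfolding C2_def p using C by (auto intro: C1_add(1))
  moreover have "square_integrable (\<lambda>x. f x + g x)"
    using assms by (intro square_integrable_add) (auto simp: hermite_eigenspace_def)
  moreover have "hermite_op (\<lambda>x. f x + g x) x = of_nat (2 * k + CARD('a)) * (f x + g x)" for x
  proof -
    have "hermite_op (\<lambda>x. f x + g x) x = hermite_op f x + hermite_op g x"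
      unfolding hermite_op_def p C1_add(2)[OF C(3,4)] by (simp add: sum.distrib algebra_simps)
    then show ?thesis using assms by (simp add: hermite_eigenspace_def distrib_left)
  qed
  ultimately show ?thesis by (simp add: hermite_eigenspace_def)
qed

lemma eigenspace_cmult:
  assumes "f \<in> hermite_eigenspace k"
  shows "(\<lambda>x. c * f x) \<in> hermite_eigenspace k"
proof -
  have C: "C1 f" "\<And>i. C1 (partial i f)"
    using assms by (auto simp: hermite_eigenspace_def C2_def)
  have p: "partial i (\<lambda>x. c * f x) = (\<lambda>x. c * partial i f x)" for i by (rule C1_cmult(2)[OF C(1)])
  have "C2 (\<lambda>x. c * f x)" unfolding C2_def p using C by (auto intro: C1_cmult(1))
  moreover have "square_integrable (\<lambda>x. c * f x)"
    using assms by (intro square_integrable_cmult) (simp add: hermite_eigenspace_def)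
  moreover have "hermite_op (\<lambda>x. c * f x) x = of_nat (2 * k + CARD('a)) * (c * f x)" for x
  proof -
    have "hermite_op (\<lambda>x. c * f x) x = c * hermite_op f x"
      unfolding hermite_op_def p C1_cmult(2)[OF C(2)] by (simp add: sum_distrib_left algebra_simps)
    then show ?thesis using assms by (simp add: hermite_eigenspace_def)
  qed
  ultimately show ?thesis by (simp add: hermite_eigenspace_def)
qed

lemma eigenspace_sum:
  assumes "finite A" "A \<noteq> {}" "\<And>a. a \<in> A \<Longrightarrow> f a \<in> hermite_eigenspace k"
  shows "(\<lambda>x. \<Sum>a\<in>A. f a x) \<in> hermite_eigenspace k"
  using assms
proof (induction A rule: finite_ne_induct)
  case (singleton a)
  then show ?case by simp
next
  case (insert a F)
  have "(\<lambda>x. f a x + (\<Sum>a\<in>F. f a x)) \<in> hermite_eigenspace k"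
    using insert by (intro eigenspace_add) auto
  then show ?case using insert by simp
qed

lemma deg_nonempty: "{\<alpha> :: 'n::finite \<Rightarrow> nat. deg \<alpha> = k} \<noteq> {}"
proof -
  obtain i :: 'n where True by simp
  have "deg ((\<lambda>_. 0)(i := k)) = k" unfolding deg_def by (subst sum.remove[of _ i]) auto
  then show ?thesis by blast
qed

lemma hproj_in_eigenspace: "hproj k f \<in> hermite_eigenspace k"
proof -
  have "(\<lambda>x. \<Sum>\<alpha> | deg \<alpha> = k. hcoeff f \<alpha> * cHerm \<alpha> x) \<in> hermite_eigenspace k"
    using Herm_in_eigenspace by (intro eigenspace_sum finite_deg deg_nonempty eigenspace_cmult) auto
  then show ?thesis unfolding hproj_def[abs_def] .
qed

lemma hcoeff_hproj: "hcoeff (hproj k f) \<beta> = (if deg \<beta> = k then hcoeff f \<beta> else 0)"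
proof -
  have "hcoeff (hproj k f) \<beta> = (LINT x|lebesgue. (\<Sum>\<alpha> | deg \<alpha> = k. hcoeff f \<alpha> * complex_of_real (Herm \<alpha> x * Herm \<beta> x)))"
    unfolding hcoeff_def[of "hproj k f"] hproj_def by (simp add: sum_distrib_right mult.assoc)
  also have "\<dots> = (\<Sum>\<alpha> | deg \<alpha> = k. hcoeff f \<alpha> * (LINT x|lebesgue. complex_of_real (Herm \<alpha> x * Herm \<beta> x)))"
    using integrable_Herm_mult by (subst Bochner_Integration.integral_sum) (auto intro!: integrable_mult_right integrable_of_real simp del: of_real_mult)
  also have "\<dots> = (\<Sum>\<alpha> | deg \<alpha> = k. if \<alpha> = \<beta> then hcoeff f \<alpha> else 0)"
    unfolding integral_complex_of_real Herm_orthonormal by (intro sum.cong) auto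
  also have "\<dots> = (if deg \<beta> = k then hcoeff f \<beta> else 0)" using finite_deg by (subst sum.delta) auto
  finally show ?thesis .
qed

lemma hcoeff_diff:
  "square_integrable f \<Longrightarrow> square_integrable g \<Longrightarrow> hcoeff (\<lambda>x. f x - g x) \<alpha> = hcoeff f \<alpha> - hcoeff g \<alpha>"
  unfolding hcoeff_def left_diff_distrib by (intro Bochner_Integration.integral_diff integrable_mult_Herm)

text \<open>The difference of \<open>u\<close> and its expansion is orthogonal to the \<open>h\<^sub>\<alpha>\<close> of degree \<open>k\<close> by
  construction and, being an eigenfunction, to all others; completeness shows that it vanishes.\<close>

lemma eigenspace_eq_hproj:
  fixes u :: "real^'n::finite \<Rightarrow> complex"
  assumes "u \<in> hermite_eigenspace k"
  shows "u = hproj k u"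
proof -
  have u: "C2 u" "square_integrable u" "\<And>x. hermite_op u x = of_nat (2 * k + CARD('n)) * u x"
    using assms by (auto simp: hermite_eigenspace_def)
  define v where "v x = u x - hproj k u x" for x
  have "(\<lambda>x. u x + (- 1) * hproj k u x) \<in> hermite_eigenspace k"
    by (intro eigenspace_add eigenspace_cmult assms hproj_in_eigenspace)
  then have vE: "v \<in> hermite_eigenspace k" by (simp add: v_def[abs_def])
  then have v: "C2 v" "square_integrable v" "\<And>x. hermite_op v x = of_nat (2 * k + CARD('n)) * v x"
    by (auto simp: hermite_eigenspace_def)
  have vm: "v \<in> borel_measurable borel" by (rule borel_measurable_continuous_onI[OF C2_imp(1)[OF v(1)]])
  have v2: "integrable lborel (\<lambda>x. (cmod (v x))\<^sup>2)" by (rule square_integrable_lborel[OF C2_imp(1)[OF v(1)] v(2)])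
  have "integral\<^sup>L lborel (\<lambda>x. v x * cHerm \<alpha> x) = 0" for \<alpha>
  proof (cases "deg \<alpha> = k")
    case False
    then show ?thesis by (rule eigenfunction_orthogonal[OF v(1) v2 v(3)])
  next
    case True
    have hm: "(\<lambda>x. cHerm \<alpha> x) \<in> borel_measurable borel" by measurable
    have "integral\<^sup>L lborel (\<lambda>x. v x * cHerm \<alpha> x) = hcoeff v \<alpha>"
      unfolding hcoeff_def by (rule integral_completion[symmetric]) (simp add: borel_measurable_times vm hm)
    also have "\<dots> = hcoeff u \<alpha> - hcoeff (hproj k u) \<alpha>"
      unfolding v_def[abs_def] using u(2) hproj_in_eigenspace[of k u] by (intro hcoeff_diff) (auto simp: hermite_eigenspace_def)
    also have "\<dots> = 0" using True by (simp add: hcoeff_hproj)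
    finally show ?thesis .
  qed
  from Herm_complete[OF vm v2 this C2_imp(1)[OF v(1)]] have "v y = 0" for y .
  then show ?thesis by (simp add: v_def fun_eq_iff)
qed

text \<open>As the eigenspace is spanned by the orthonormal \<open>h\<^sub>\<alpha>\<close> with \<open>|\<alpha>| = k\<close>, orthogonality of \<open>f -
  g\<close> to it fixes all coefficients of \<open>g\<close> and so \<open>g\<close> itself.\<close>

lemma hermite_proj_eq_hproj:
  assumes f: "square_integrable f"
  shows "hermite_proj k f = hproj k f"
  unfolding hermite_proj_def
proof (rule the_equality)
  have sq: "square_integrable g" if "g \<in> hermite_eigenspace k" for g using that by (simp add: hermite_eigenspace_def)
  have inner: "(LINT x|lebesgue. (f x - g x) * cnj (cHerm \<alpha> x)) = hcoeff f \<alpha> - hcoeff g \<alpha>"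
    if "g \<in> hermite_eigenspace k" for g \<alpha>
    using hcoeff_diff[OF f sq[OF that], of \<alpha>] unfolding hcoeff_def complex_cnj_complex_of_real .
  show "hproj k f \<in> hermite_eigenspace k \<and> (\<forall>h\<in>hermite_eigenspace k. (LINT x|lebesgue. (f x - hproj k f x) * cnj (h x)) = 0)"
  proof (intro conjI ballI hproj_in_eigenspace)
    fix h :: "real^'a \<Rightarrow> complex" assume h: "h \<in> hermite_eigenspace k"
    have d: "square_integrable (\<lambda>x. f x - hproj k f x)"
      using square_integrable_add[OF f square_integrable_cmult[OF sq[OF hproj_in_eigenspace], of "- 1"]] by simp
    have hx: "cnj (h x) = (\<Sum>\<alpha> | deg \<alpha> = k. cnj (hcoeff h \<alpha>) * cnj (cHerm \<alpha> x))" for x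
      by (subst eigenspace_eq_hproj[OF h]) (simp add: hproj_def)
    have "(LINT x|lebesgue. (f x - hproj k f x) * cnj (h x)) =
      (LINT x|lebesgue. (\<Sum>\<alpha> | deg \<alpha> = k. cnj (hcoeff h \<alpha>) * ((f x - hproj k f x) * cnj (cHerm \<alpha> x))))"
      unfolding hx sum_distrib_left by (simp add: mult.left_commute)
    also have "\<dots> = (\<Sum>\<alpha> | deg \<alpha> = k. cnj (hcoeff h \<alpha>) * (LINT x|lebesgue. (f x - hproj k f x) * cnj (cHerm \<alpha> x)))"
      using integrable_mult_Herm[OF d] by (subst Bochner_Integration.integral_sum) (auto intro!: integrable_mult_right)
    also have "\<dots> = 0"
      unfolding inner[OF hproj_in_eigenspace] by (simp add: hcoeff_hproj)
    finally show "(LINT x|lebesgue. (f x - hproj k f x) * cnj (h x)) = 0" .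
  qed
  fix g :: "real^'a \<Rightarrow> complex"
  assume g: "g \<in> hermite_eigenspace k \<and> (\<forall>h\<in>hermite_eigenspace k. (LINT x|lebesgue. (f x - g x) * cnj (h x)) = 0)"
  have "hcoeff g \<alpha> = hcoeff f \<alpha>" if "deg \<alpha> = k" for \<alpha>
  proof -
    have "(\<lambda>x. cHerm \<alpha> x) \<in> hermite_eigenspace k" using Herm_in_eigenspace[of \<alpha>] that by simp
    from bspec[OF conjunct2[OF g] this]
    have "(LINT x|lebesgue. (f x - g x) * cnj (cHerm \<alpha> x)) = 0" .
    then show ?thesis using inner[of g \<alpha>] g by simp
  qed
  then have "hproj k g = hproj k f" by (simp add: hproj_def fun_eq_iff)
  then show "g = hproj k f" using eigenspace_eq_hproj[of g k] g by simp
qed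

section \<open>Averages of weighted functions\<close>

lemma bernoulli_powr:
  assumes "q > 1" "0 \<le> (z::real)"
  shows "1 + q * (z - 1) \<le> z powr q"
proof (cases "z = 0")
  case True then show ?thesis using assms by simp
next
  case False
  then have z: "z > 0" using assms by simp
  have "(z powr q) powr (1 / q) * 1 powr (1 - 1 / q) \<le> (1 / q) * z powr q + (1 - 1 / q) * 1"
    using assms z by (intro Youngs_inequality_0) auto
  then have "z \<le> (1 / q) * z powr q + (1 - 1 / q)" using assms z by (simp add: powr_powr)
  then have "q * z \<le> q * ((1 / q) * z powr q + (1 - 1 / q))" using assms by (intro mult_left_mono) auto
  then show ?thesis using assms by (simp add: algebra_simps)
qed

lemma powr_tangent:
  assumes "q > (1::real)" "0 \<le> (h::real)" "0 < c"
  shows "c powr q + q * c powr (q - 1) * (h - c) \<le> h powr q"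
proof -
  have "1 + q * (h / c - 1) \<le> (h / c) powr q" using assms by (intro bernoulli_powr) auto
  then have "c powr q * (1 + q * (h / c - 1)) \<le> c powr q * (h / c) powr q" by (intro mult_left_mono) auto
  also have "c powr q * (h / c) powr q = h powr q" using assms by (simp add: powr_divide)
  also have "c powr q * (1 + q * (h / c - 1)) = c powr q + q * c powr (q - 1) * (h - c)"
    using assms by (simp add: powr_diff field_simps)
  finally show ?thesis .
qed

text \<open>The tangent inequality for the power function at the mean \<open>c\<close> of \<open>h\<close>, integrated against
  \<open>s\<close>.\<close>

lemma jensen_powr:
  assumes q: "q > (1::real)" and s: "integrable M s" "AE x in M. 0 \<le> s x" and \<sigma>: "integral\<^sup>L M s > 0"
    and h: "h \<in> borel_measurable M" "\<And>x. 0 \<le> h x" and hq: "integrable M (\<lambda>x. h x powr q * s x)"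
  shows "integrable M (\<lambda>x. h x * s x)"
    "(integral\<^sup>L M (\<lambda>x. h x * s x)) powr q \<le> integral\<^sup>L M (\<lambda>x. h x powr q * s x) * (integral\<^sup>L M s) powr (q - 1)"
proof -
  show hs: "integrable M (\<lambda>x. h x * s x)"
  proof (rule Bochner_Integration.integrable_bound)
    show "integrable M (\<lambda>x. h x powr q * s x + s x)" using hq s by auto
    show "(\<lambda>x. h x * s x) \<in> borel_measurable M" using h s by measurable
    show "AE x in M. norm (h x * s x) \<le> norm (h x powr q * s x + s x)"
      using s(2)
    proof eventually_elim
      case (elim x)
      have "h x \<le> h x powr q + 1"
      proof (cases "h x \<le> 1")
        case False
        then have "h x powr 1 \<le> h x powr q" using q powr_mono[of 1 q "h x"] by simp
        then show ?thesis using False by simp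
      qed (simp add: add_increasing)
      then have "h x * s x \<le> (h x powr q + 1) * s x" using elim by (intro mult_right_mono) auto
      moreover have "0 \<le> h x * s x" using elim h(2)[of x] by simp
      ultimately show ?case by (simp add: algebra_simps)
    qed
  qed
  define S where "S = integral\<^sup>L M s"
  define I where "I = integral\<^sup>L M (\<lambda>x. h x * s x)"
  have I0: "0 \<le> I" unfolding I_def using s(2) h(2) by (intro integral_nonneg_AE) (auto elim!: eventually_mono)
  have J0: "0 \<le> integral\<^sup>L M (\<lambda>x. h x powr q * s x)" using s(2) by (intro integral_nonneg_AE) (auto elim!: eventually_mono)
  show "I powr q \<le> integral\<^sup>L M (\<lambda>x. h x powr q * s x) * S powr (q - 1)"
  proof (cases "I = 0")
    case True then show ?thesis using J0 q by simp
  next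
    case False
    then have I: "I > 0" using I0 by simp
    have S: "S > 0" using \<sigma> by (simp add: S_def)
    define c where "c = I / S"
    have c: "c > 0" using I S by (simp add: c_def)
    define k where "k = q * c powr (q - 1)"
    have int: "integrable M (\<lambda>x. (c powr q - k * c) * s x + k * (h x * s x))"
      using s hs by auto
    have "c powr q * S = (c powr q - k * c) * S + k * I" using S by (simp add: c_def algebra_simps)
    also have "\<dots> = integral\<^sup>L M (\<lambda>x. (c powr q - k * c) * s x + k * (h x * s x))"
      using s hs by (simp add: S_def I_def)
    also have "\<dots> \<le> integral\<^sup>L M (\<lambda>x. h x powr q * s x)"
    proof (rule integral_mono_AE[OF int hq])
      show "AE x in M. (c powr q - k * c) * s x + k * (h x * s x) \<le> h x powr q * s x"
        using s(2)
      proof eventually_elim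
        case (elim x)
        from mult_right_mono[OF powr_tangent[OF q h(2) c, of x] elim]
        show ?case by (simp add: k_def algebra_simps)
      qed
    qed
    finally have *: "c powr q * S \<le> integral\<^sup>L M (\<lambda>x. h x powr q * s x)" .
    have "I powr q = c powr q * S powr q" using I S by (simp add: c_def powr_divide)
    also have "S powr q = S * S powr (q - 1)" using S by (simp add: powr_diff)
    also have "c powr q * (S * S powr (q - 1)) = (c powr q * S) * S powr (q - 1)" by simp
    also have "\<dots> \<le> integral\<^sup>L M (\<lambda>x. h x powr q * s x) * S powr (q - 1)" by (intro mult_right_mono *) auto
    finally show ?thesis .
  qed
qed

lemma sigma_finite_lebesgue: "sigma_finite_measure (lebesgue :: 'a::euclidean_space measure)"
proof
  obtain A :: "'a set set" where A: "countable A" "A \<subseteq> sets lborel" "\<Union>A = space lborel" "\<forall>a\<in>A. emeasure lborel a \<noteq> \<infinity>"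
    using lborel.sigma_finite_countable by blast
  show "\<exists>A::'a set set. countable A \<and> A \<subseteq> sets lebesgue \<and> \<Union>A = space lebesgue \<and> (\<forall>a\<in>A. emeasure lebesgue a \<noteq> \<infinity>)"
    using A by (intro exI[of _ A]) (auto simp: emeasure_completion subset_iff)
qed

lemma borel_lebesgue: "f \<in> borel_measurable borel \<Longrightarrow> f \<in> borel_measurable lebesgue"
  by (rule measurable_completion) simp

lemma measurable_ball_lebesgue2:
  "(\<lambda>p. indicator (ball (fst p) r) (snd p) :: ennreal) \<in> borel_measurable (lebesgue \<Otimes>\<^sub>M lebesgue)"
proof -
  have i: "(\<lambda>x. x) \<in> borel_measurable (lebesgue :: 'a::euclidean_space measure)" by (rule borel_lebesgue) simp
  have f: "fst \<in> borel_measurable (lebesgue \<Otimes>\<^sub>M lebesgue :: ('a \<times> 'a) measure)"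
    using measurable_compose[OF measurable_fst[of lebesgue lebesgue] i] by simp
  have g: "snd \<in> borel_measurable (lebesgue \<Otimes>\<^sub>M lebesgue :: ('a \<times> 'a) measure)"
    using measurable_compose[OF measurable_snd[of lebesgue lebesgue] i] by simp
  have "(\<lambda>p. dist (fst p) (snd p)) \<in> borel_measurable (lebesgue \<Otimes>\<^sub>M lebesgue :: ('a \<times> 'a) measure)"
    by (rule borel_measurable_dist[OF f g])
  then have "{p \<in> space (lebesgue \<Otimes>\<^sub>M lebesgue). dist (fst p) (snd p :: 'a) < r} \<in> sets (lebesgue \<Otimes>\<^sub>M lebesgue)"
    by measurable
  moreover have "(\<lambda>p. indicator (ball (fst p) r) (snd p) :: ennreal) = indicator {p \<in> space (lebesgue \<Otimes>\<^sub>M lebesgue). dist (fst p) (snd p :: 'a) < r}"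
    by (auto simp: indicator_def fun_eq_iff space_pair_measure)
  ultimately show ?thesis by simp
qed

lemma measurable_ball_integral:
  fixes f :: "'a::euclidean_space \<Rightarrow> ennreal"
  assumes [measurable]: "f \<in> borel_measurable lebesgue"
  shows "(\<lambda>x. \<integral>\<^sup>+y. f y * indicator (ball x r) y \<partial>lebesgue) \<in> borel_measurable lebesgue"
proof -
  interpret L: sigma_finite_measure "lebesgue :: 'a measure" by (rule sigma_finite_lebesgue)
  have "(\<lambda>(x, y). f y * indicator (ball x r) y) \<in> borel_measurable (lebesgue \<Otimes>\<^sub>M (lebesgue :: 'a measure))"
    using measurable_ball_lebesgue2[of r] unfolding case_prod_beta' by measurable
  then show ?thesis by (rule L.borel_measurable_nn_integral)
qed

text \<open>The number of balls of half the radius in some cover of a ball; by scaling and translation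
  one choice serves all balls.\<close>

definition overlap_number :: "'a::euclidean_space itself \<Rightarrow> nat" where
  "overlap_number _ = (SOME m. \<exists>k. finite k \<and> card k = m \<and> cball (0::'a) 1 \<subseteq> (\<Union>x\<in>k. ball x (1 / 2)))"

lemma ball_half_cover:
  fixes y :: "'a::euclidean_space"
  assumes r: "0 < r"
  obtains S where "finite S" "card S \<le> overlap_number TYPE('a)" "ball y r \<subseteq> (\<Union>c\<in>S. ball c (r / 2))"
proof -
  let ?P = "\<lambda>m. \<exists>k. finite k \<and> card k = m \<and> cball (0::'a) 1 \<subseteq> (\<Union>x\<in>k. ball x (1 / 2))"
  have "\<forall>e>0. \<exists>k. finite k \<and> cball (0::'a) 1 \<subseteq> (\<Union>x\<in>k. ball x e)"
    using compact_eq_totally_bounded[of "cball (0::'a) 1"] compact_cball by auto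
  then have "\<exists>m. ?P m" by (auto dest: spec[of _ "1/2"])
  then have "?P (overlap_number TYPE('a))" unfolding overlap_number_def by (rule someI_ex)
  then obtain k where k: "finite k" "card k = overlap_number TYPE('a)" "cball (0::'a) 1 \<subseteq> (\<Union>x\<in>k. ball x (1/2))" by blast
  show ?thesis
  proof (rule that[of "(\<lambda>c. y + r *\<^sub>R c) ` k"])
    show "finite ((\<lambda>c. y + r *\<^sub>R c) ` k)" using k by simp
    show "card ((\<lambda>c. y + r *\<^sub>R c) ` k) \<le> overlap_number TYPE('a)" using k card_image_le by metis
    show "ball y r \<subseteq> (\<Union>c\<in>(\<lambda>c. y + r *\<^sub>R c) ` k. ball c (r / 2))"
    proof
      fix z assume z: "z \<in> ball y r"
      define v where "v = (1 / r) *\<^sub>R (z - y)"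
      have "norm v \<le> 1" using z r by (simp add: v_def dist_norm norm_minus_commute)
      then obtain c where c: "c \<in> k" "v \<in> ball c (1/2)" using k(3) by (auto simp: subset_iff)
      have "z - (y + r *\<^sub>R c) = r *\<^sub>R (v - c)" using r by (simp add: v_def algebra_simps)
      then have "dist (y + r *\<^sub>R c) z = r * norm (v - c)" using r by (simp add: dist_norm norm_minus_commute)
      also have "\<dots> < r * (1 / 2)" using c(2) r by (intro mult_strict_left_mono) (auto simp: dist_norm norm_minus_commute)
      finally have "z \<in> ball (y + r *\<^sub>R c) (r / 2)" by simp
      then show "z \<in> (\<Union>c\<in>(\<lambda>c. y + r *\<^sub>R c) ` k. ball c (r / 2))" using c(1) by blast
    qed
  qed
qed

lemma ennreal_divide_left_mono:
  assumes "b \<le> (c::ennreal)" shows "a / c \<le> a / b"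
proof -
  have "inverse c \<le> inverse b"
  proof (cases "b = 0 \<or> c = top")
    case False
    then obtain \<gamma> where c: "c = ennreal \<gamma>" "0 \<le> \<gamma>" by (cases c) auto
    obtain \<beta> where b: "b = ennreal \<beta>" "0 \<le> \<beta>" using assms c by (cases b) (auto simp: top_unique)
    have "0 < \<beta>" using False b by (cases "\<beta> = 0") auto
    moreover have "\<beta> \<le> \<gamma>" using assms b c by simp
    ultimately show ?thesis using b c by (simp add: inverse_ennreal ennreal_leI le_imp_inverse_le)
  qed auto
  then show ?thesis unfolding divide_ennreal_def by (rule mult_left_mono) simp
qed

lemma ennreal_divide_self_le: "(a::ennreal) / a \<le> 1"
proof (cases "a = 0 \<or> a = top")
  case False
  then have "a / a = 1" by (intro ennreal_divide_self) (auto simp: less_top)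
  then show ?thesis by simp
qed auto

text \<open>Interchanging the integrals leaves, for each \<open>y\<close>, the integral of \<open>w(x) / w(B(x,r))\<close> over
  the ball \<open>B(y,r)\<close>. Cover this ball by balls of radius \<open>r / 2\<close>. Each of them is contained in
  \<open>B(x,r)\<close> for all of its points \<open>x\<close> and therefore contributes at most 1. This makes averaging at
  a fixed scale bounded on \<open>L\<^sup>1(w dx)\<close> for every weight.\<close>

lemma average_ratio_le:
  fixes w G :: "'a::euclidean_space \<Rightarrow> ennreal"
  assumes r: "0 < r" and wm[measurable]: "w \<in> borel_measurable lebesgue" and Gm[measurable]: "G \<in> borel_measurable lebesgue"
  shows "(\<integral>\<^sup>+x. w x * ((\<integral>\<^sup>+y. G y * indicator (ball x r) y \<partial>lebesgue) / (\<integral>\<^sup>+y. w y * indicator (ball x r) y \<partial>lebesgue)) \<partial>lebesgue)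
      \<le> of_nat (overlap_number TYPE('a)) * (\<integral>\<^sup>+y. G y \<partial>lebesgue)"
proof -
  interpret L: sigma_finite_measure "lebesgue :: 'a measure" by (rule sigma_finite_lebesgue)
  interpret LL: pair_sigma_finite "lebesgue :: 'a measure" "lebesgue :: 'a measure" ..
  define W where "W x = (\<integral>\<^sup>+y. w y * indicator (ball x r) y \<partial>lebesgue)" for x
  have ballm[measurable]: "ball c s \<in> sets lebesgue" for c :: 'a and s by simp
  have ind: "(\<lambda>(x, y). indicator (ball x r) y :: ennreal) \<in> borel_measurable (lebesgue \<Otimes>\<^sub>M (lebesgue :: 'a measure))"
    using measurable_ball_lebesgue2[of r] by (simp add: case_prod_beta')
  have Wm[measurable]: "W \<in> borel_measurable lebesgue"
    unfolding W_def[abs_def] by (rule measurable_ball_integral[OF wm])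
  have inner: "(\<integral>\<^sup>+x. w x / W x * indicator (ball y r) x \<partial>lebesgue) \<le> of_nat (overlap_number TYPE('a))" for y
  proof -
    obtain S where S: "finite S" "card S \<le> overlap_number TYPE('a)" "ball y r \<subseteq> (\<Union>c\<in>S. ball c (r / 2))" by (rule ball_half_cover[OF r])
    have "(\<integral>\<^sup>+x. w x / W x * indicator (ball y r) x \<partial>lebesgue) \<le> (\<integral>\<^sup>+x. (\<Sum>c\<in>S. w x / W x * indicator (ball c (r / 2)) x) \<partial>lebesgue)"
    proof (rule nn_integral_mono)
      fix x
      show "w x / W x * indicator (ball y r) x \<le> (\<Sum>c\<in>S. w x / W x * indicator (ball c (r / 2)) x)"
      proof (cases "x \<in> ball y r")
        case True
        then obtain c where c: "c \<in> S" "x \<in> ball c (r / 2)" using S(3) by blast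
        have "w x / W x * indicator (ball c (r / 2)) x \<le> (\<Sum>c\<in>S. w x / W x * indicator (ball c (r / 2)) x)"
          using c S(1) by (intro member_le_sum) auto
        then show ?thesis using True c by simp
      qed simp
    qed
    also have "\<dots> = (\<Sum>c\<in>S. \<integral>\<^sup>+x. w x / W x * indicator (ball c (r / 2)) x \<partial>lebesgue)"
      by (intro nn_integral_sum) measurable
    also have "\<dots> \<le> (\<Sum>c\<in>S. 1)"
    proof (rule sum_mono)
      fix c
      define V where "V = (\<integral>\<^sup>+x. w x * indicator (ball c (r / 2)) x \<partial>lebesgue)"
      have "(\<integral>\<^sup>+x. w x / W x * indicator (ball c (r / 2)) x \<partial>lebesgue) \<le> (\<integral>\<^sup>+x. (w x * indicator (ball c (r / 2)) x) / V \<partial>lebesgue)"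
      proof (rule nn_integral_mono)
        fix x
        show "w x / W x * indicator (ball c (r / 2)) x \<le> (w x * indicator (ball c (r / 2)) x) / V"
        proof (cases "x \<in> ball c (r / 2)")
          case True
          have "V \<le> W x" unfolding V_def W_def
          proof (rule nn_integral_mono)
            fix z
            have "z \<in> ball x r" if "z \<in> ball c (r / 2)"
              using True that dist_triangle[of x z c] by (simp add: dist_commute)
            then show "w z * indicator (ball c (r / 2)) z \<le> w z * indicator (ball x r) z"
              by (intro mult_left_mono) (auto simp: indicator_def)
          qed
          then have "w x / W x \<le> w x / V" by (rule ennreal_divide_left_mono)
          then show ?thesis using True by simp
        qed simp
      qed
      also have "\<dots> = V / V" unfolding V_def by (rule nn_integral_divide) measurable
      also have "\<dots> \<le> 1" by (rule ennreal_divide_self_le)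
      finally show "(\<integral>\<^sup>+x. w x / W x * indicator (ball c (r / 2)) x \<partial>lebesgue) \<le> 1" .
    qed
    also have "\<dots> \<le> of_nat (overlap_number TYPE('a))" using S(2) by simp
    finally show ?thesis .
  qed
  have jm: "(\<lambda>(x, y). w x / W x * (G y * indicator (ball x r) y)) \<in> borel_measurable (lebesgue \<Otimes>\<^sub>M (lebesgue :: 'a measure))"
    using ind unfolding case_prod_beta' by measurable
  have "(\<integral>\<^sup>+x. w x * ((\<integral>\<^sup>+y. G y * indicator (ball x r) y \<partial>lebesgue) / W x) \<partial>lebesgue)
     = (\<integral>\<^sup>+x. (\<integral>\<^sup>+y. w x / W x * (G y * indicator (ball x r) y) \<partial>lebesgue) \<partial>lebesgue)"
  proof (rule nn_integral_cong)
    fix x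
    have "(\<integral>\<^sup>+y. w x / W x * (G y * indicator (ball x r) y) \<partial>lebesgue) = w x / W x * (\<integral>\<^sup>+y. G y * indicator (ball x r) y \<partial>lebesgue)"
      by (intro nn_integral_cmult) (auto intro!: borel_measurable_times_ennreal)
    then show "w x * ((\<integral>\<^sup>+y. G y * indicator (ball x r) y \<partial>lebesgue) / W x) = (\<integral>\<^sup>+y. w x / W x * (G y * indicator (ball x r) y) \<partial>lebesgue)"
      by (simp add: divide_ennreal_def mult_ac)
  qed
  also have "\<dots> = (\<integral>\<^sup>+y. (\<integral>\<^sup>+x. w x / W x * (G y * indicator (ball x r) y) \<partial>lebesgue) \<partial>lebesgue)"
    using LL.Fubini'[OF jm] by simp
  also have "\<dots> = (\<integral>\<^sup>+y. G y * (\<integral>\<^sup>+x. w x / W x * indicator (ball y r) x \<partial>lebesgue) \<partial>lebesgue)"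
  proof (rule nn_integral_cong)
    fix y
    have "(\<integral>\<^sup>+x. w x / W x * (G y * indicator (ball x r) y) \<partial>lebesgue) = (\<integral>\<^sup>+x. G y * (w x / W x * indicator (ball y r) x) \<partial>lebesgue)"
      by (intro nn_integral_cong) (auto simp: indicator_def dist_commute mult_ac)
    also have "\<dots> = G y * (\<integral>\<^sup>+x. w x / W x * indicator (ball y r) x \<partial>lebesgue)"
      by (intro nn_integral_cmult) measurable
    finally show "(\<integral>\<^sup>+x. w x / W x * (G y * indicator (ball x r) y) \<partial>lebesgue) = G y * (\<integral>\<^sup>+x. w x / W x * indicator (ball y r) x \<partial>lebesgue)" .
  qed
  also have "\<dots> \<le> (\<integral>\<^sup>+y. of_nat (overlap_number TYPE('a)) * G y \<partial>lebesgue)"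
    using inner by (intro nn_integral_mono) (metis mult.commute mult_left_mono zero_le)
  also have "\<dots> = of_nat (overlap_number TYPE('a)) * (\<integral>\<^sup>+y. G y \<partial>lebesgue)" by (rule nn_integral_cmult) measurable
  finally show ?thesis unfolding W_def .
qed

lemma ball_integral_pos:
  fixes f :: "'a::euclidean_space \<Rightarrow> real"
  assumes f: "set_integrable lebesgue (ball x r) f" and pos: "AE y in lebesgue. 0 < f y" and r: "r > 0"
  shows "(LINT y:ball x r|lebesgue. f y) > 0"
proof (rule ccontr)
  let ?h = "\<lambda>y. indicator (ball x r) y *\<^sub>R f y"
  assume "\<not> (LINT y:ball x r|lebesgue. f y) > 0"
  moreover have nn: "AE y in lebesgue. 0 \<le> ?h y" using pos by eventually_elim (simp add: indicator_def)
  then have "0 \<le> integral\<^sup>L lebesgue ?h" by (rule integral_nonneg_AE)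
  ultimately have "integral\<^sup>L lebesgue ?h = 0" by (simp add: set_lebesgue_integral_def)
  then have "AE y in lebesgue. ?h y = 0"
    using integral_nonneg_eq_0_iff_AE[OF f[unfolded set_integrable_def] nn] by simp
  then have "AE y in lebesgue. y \<notin> ball x r" using pos
    by eventually_elim (auto simp: indicator_def)
  then have "emeasure lebesgue (ball x r) = 0" by (subst (asm) AE_iff_measurable[OF _ refl]) (auto simp: ball_def)
  then have "measure lebesgue (ball x r) = 0" by (simp add: measure_def)
  then show False using content_ball_pos[OF r, of x] by simp
qed

text \<open>Jensen's inequality with respect to the dual weight \<open>s = w\<close> to the power \<open>- 1 / (q - 1)\<close>:
  for \<open>g = h s\<close> one has \<open>h\<^sup>q s = g\<^sup>q w\<close>, and the \<open>A\<^sub>q\<close> condition trades the resulting power of the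
  mass of \<open>s\<close> for the reciprocal of the mass of \<open>w\<close>.\<close>

lemma muckenhoupt_average:
  fixes w :: "real^'n::finite \<Rightarrow> real"
  assumes q: "q > 1" and w: "w \<in> muckenhoupt q"
    and C0: "\<And>c r. 0 < r \<Longrightarrow> ((LINT x:ball c r|lebesgue. w x) / measure lebesgue (ball c r)) *
        ((LINT x:ball c r|lebesgue. w x powr (- 1 / (q - 1))) / measure lebesgue (ball c r)) powr (q - 1) \<le> C"
    and gm[measurable]: "g \<in> borel_measurable lebesgue" and g0: "\<And>y. 0 \<le> g y"
    and gi: "integrable lebesgue (\<lambda>y. g y powr q * w y)" and r: "0 < r"
  shows "set_integrable lebesgue (ball x r) g"
    "(LINT y:ball x r|lebesgue. g y) powr q \<le> C * measure lebesgue (ball x r) powr q *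
       ((LINT y:ball x r|lebesgue. g y powr q * w y) / (LINT y:ball x r|lebesgue. w y))"
proof -
  define s where "s y = w y powr (- 1 / (q - 1))" for y
  have wm[measurable]: "w \<in> borel_measurable lebesgue" and wpos: "AE y in lebesgue. 0 < w y"
    and wi: "\<And>c r. set_integrable lebesgue (ball c r) w" and si: "\<And>c r. set_integrable lebesgue (ball c r) s"
    using w unfolding muckenhoupt_def mem_Collect_eq s_def[abs_def] by blast+
  have spos: "AE y in lebesgue. 0 < s y" using wpos by eventually_elim (simp add: s_def)
  let ?B = "ball x r"
  define t where "t y = indicator ?B y *\<^sub>R s y" for y
  have sm[measurable]: "s \<in> borel_measurable lebesgue" unfolding s_def[abs_def] by measurable
  define h where "h y = g y / s y" for y
  have B[measurable]: "?B \<in> sets lebesgue" by simp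
  have tint: "integrable lebesgue t" using si[of x r] by (simp add: set_integrable_def t_def[abs_def])
  have t0: "AE y in lebesgue. 0 \<le> t y" using spos by eventually_elim (simp add: t_def)
  have eq1: "AE y in lebesgue. h y * t y = indicator ?B y *\<^sub>R g y"
    using spos by eventually_elim (simp add: h_def t_def indicator_def)
  have eq2: "AE y in lebesgue. h y powr q * t y = indicator ?B y *\<^sub>R (g y powr q * w y)"
    using wpos
  proof eventually_elim
    case (elim y)
    have sp: "s y > 0" using elim by (simp add: s_def)
    have "s y powr (1 - q) = w y powr ((- 1 / (q - 1)) * (1 - q))" by (simp add: s_def powr_powr)
    also have "(- 1 / (q - 1)) * (1 - q) = 1" using q by (simp add: field_simps)
    finally have sw: "s y powr (1 - q) = w y" using elim by simp
    have "(g y / s y) powr q * s y = g y powr q * (s y / s y powr q)" using sp g0[of y] by (simp add: powr_divide)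
    also have "s y / s y powr q = s y powr (1 - q)" using sp by (simp add: powr_diff)
    finally show ?case unfolding sw by (auto simp: h_def t_def indicator_def)
  qed
  have Gint: "integrable lebesgue (\<lambda>y. indicator ?B y *\<^sub>R (g y powr q * w y))"
    by (rule integrable_mult_indicator[OF B gi])
  have hm[measurable]: "h \<in> borel_measurable lebesgue" unfolding h_def[abs_def] by measurable
  have tm[measurable]: "t \<in> borel_measurable lebesgue" using tint by auto
  have hq: "integrable lebesgue (\<lambda>y. h y powr q * t y)"
    by (subst integrable_cong_AE[OF _ _ eq2]) (use Gint in auto)
  define S where "S = (LINT y:?B|lebesgue. s y)"
  define W where "W = (LINT y:?B|lebesgue. w y)"
  define V where "V = measure lebesgue ?B"
  define G where "G = (LINT y:?B|lebesgue. g y powr q * w y)"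
  have S: "S > 0" unfolding S_def by (rule ball_integral_pos[OF si spos r])
  have W: "W > 0" unfolding W_def by (rule ball_integral_pos[OF wi wpos r])
  have V: "V > 0" unfolding V_def using content_ball_pos[OF r, of x] by simp
  have tS: "integral\<^sup>L lebesgue t = S" by (simp add: S_def set_lebesgue_integral_def t_def[abs_def])
  have hqG: "integral\<^sup>L lebesgue (\<lambda>y. h y powr q * t y) = G"
    unfolding G_def set_lebesgue_integral_def by (rule integral_cong_AE[OF _ _ eq2]) (use Gint in auto)
  have G0: "G \<ge> 0" unfolding G_def set_lebesgue_integral_def using wpos
    by (intro integral_nonneg_AE) (auto elim!: eventually_mono simp: indicator_def)
  have h0: "0 \<le> h y" for y using g0[of y] by (simp add: h_def s_def)
  have gset: "(\<lambda>y. indicator ?B y *\<^sub>R g y) \<in> borel_measurable lebesgue" by measurable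
  have St: "0 < integral\<^sup>L lebesgue t" using S tS by simp
  note J = jensen_powr[OF q tint t0 St hm h0 hq]
  have "integrable lebesgue (\<lambda>y. indicator ?B y *\<^sub>R g y)"
    by (subst integrable_cong_AE[OF gset _ AE_symmetric[OF eq1]]) (use J(1) in auto)
  then have 1: "set_integrable lebesgue ?B g" by (simp add: set_integrable_def)
  have "(LINT y:?B|lebesgue. g y) = integral\<^sup>L lebesgue (\<lambda>y. h y * t y)"
    unfolding set_lebesgue_integral_def by (rule integral_cong_AE[OF gset _ AE_symmetric[OF eq1]]) (use J(1) in auto)
  then have "(LINT y:?B|lebesgue. g y) powr q \<le> G * S powr (q - 1)"
    using J(2) by (simp add: hqG tS)
  also have "S powr (q - 1) \<le> C * V powr q / W"
  proof -
    have "(W / V) * (S / V) powr (q - 1) \<le> C" using C0[OF r, of x] by (simp add: W_def V_def S_def s_def)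
    moreover have "(W / V) * (S / V) powr (q - 1) = W * S powr (q - 1) / V powr q"
      using S V by (simp add: powr_divide powr_diff)
    ultimately have "W * S powr (q - 1) / V powr q \<le> C" by (simp only:)
    moreover have "0 < V powr q" using V by simp
    ultimately have "W * S powr (q - 1) \<le> C * V powr q" by (simp only: pos_divide_le_eq)
    then show ?thesis using W by (simp add: pos_le_divide_eq mult.commute)
  qed
  then have "G * S powr (q - 1) \<le> G * (C * V powr q / W)" using G0 by (rule mult_left_mono)
  finally have 2: "(LINT y:?B|lebesgue. g y) powr q \<le> C * V powr q * (G / W)" by (simp add: mult_ac)
  show "set_integrable lebesgue ?B g" by (rule 1)
  show "(LINT y:?B|lebesgue. g y) powr q \<le> C * measure lebesgue ?B powr q *
       ((LINT y:?B|lebesgue. g y powr q * w y) / (LINT y:?B|lebesgue. w y))"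
    using 2 by (simp add: V_def G_def W_def)
qed

text \<open>The term of the smallest \<open>j\<close> with \<open>|z| < 2\<^sup>j\<close> suffices: if \<open>j > 0\<close> then \<open>2\<^sup>j \<le> 2 (1 + |z|)\<close>,
  and the factor 2 accounts for \<open>4\<^sup>l\<close>.\<close>

lemma kernel_le_dyadic:
  fixes z :: "'a::euclidean_space"
  shows "ennreal (1 / (1 + norm z) ^ (2 * l)) \<le> (\<Sum>j. ennreal (4 ^ l * (1 / 4 ^ l) ^ j) * indicator (ball 0 (2 ^ j)) z)"
proof -
  define P where "P j \<longleftrightarrow> norm z < 2 ^ j" for j :: nat
  define j where "j = (LEAST j. P j)"
  have "\<exists>j. P j" unfolding P_def using real_arch_pow[of 2 "norm z"] by auto
  then have Pj: "P j" unfolding j_def by (rule LeastI_ex)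
  have "1 / (1 + norm z) ^ (2 * l) \<le> 4 ^ l * (1 / 4 ^ l) ^ j"
  proof (cases j)
    case 0
    have "1 \<le> (1 + norm z) ^ (2 * l)" by (intro one_le_power) simp
    then have "1 / (1 + norm z) ^ (2 * l) \<le> 1" by (subst divide_le_eq_1_pos) linarith+
    also have "1 \<le> (4::real) ^ l" by simp
    finally show ?thesis using 0 by simp
  next
    case (Suc i)
    have "\<not> P i" using Suc not_less_Least[of i P] by (simp add: j_def)
    then have "2 ^ i \<le> 1 + norm z" by (simp add: P_def)
    then have "(2 ^ i) ^ (2 * l) \<le> (1 + norm z) ^ (2 * l)" by (intro power_mono) auto
    then have "1 / (1 + norm z) ^ (2 * l) \<le> 1 / (2 ^ i) ^ (2 * l)" by (intro frac_le) auto
    also have "((2::real) ^ i) ^ (2 * l) = (4 ^ l) ^ i"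
    proof -
      have "((2::real) ^ i) ^ (2 * l) = (2 ^ 2) ^ (l * i)" by (simp only: power_mult[symmetric] mult_ac)
      then show ?thesis by (simp add: power_mult)
    qed
    also have "1 / ((4::real) ^ l) ^ i = 4 ^ l * (1 / 4 ^ l) ^ j" by (simp add: Suc power_divide)
    finally show ?thesis .
  qed
  then have "ennreal (1 / (1 + norm z) ^ (2 * l)) \<le> ennreal (4 ^ l * (1 / 4 ^ l) ^ j) * indicator (ball 0 (2 ^ j)) z"
    using Pj by (simp add: P_def ennreal_leI)
  also have "\<dots> \<le> (\<Sum>j. ennreal (4 ^ l * (1 / 4 ^ l) ^ j) * indicator (ball 0 (2 ^ j)) z)"
  proof -
    define f where "f j = ennreal (4 ^ l * (1 / 4 ^ l) ^ j) * indicator (ball 0 (2 ^ j)) z" for j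
    have "f j \<le> suminf f" using sum_le_suminf[OF summableI, of "{j}" f] by simp
    then show ?thesis unfolding f_def .
  qed
  finally show ?thesis .
qed

text \<open>The \<open>j\<close>-th dyadic term is \<open>4\<close> to the power \<open>- l j\<close> times the integral of \<open>g\<close> over the ball
  of radius \<open>2\<^sup>j\<close>, hence at most \<open>(1 / 2)\<^sup>j\<close> times a normalized average \<open>b\<^sub>j\<close>, because \<open>2\<^sup>n / 4\<^sup>l
  \<le> 1 / 2\<close>. By \<open>muckenhoupt_average\<close> the power \<open>b\<^sub>j\<^sup>q\<close> is at most a constant times \<open>H\<^sub>j\<close>, an
  average of \<open>g\<^sup>q\<close> with respect to \<open>w dx\<close>, and by \<open>average_ratio_le\<close> the functions \<open>H\<^sub>j\<close> are
  uniformly bounded in \<open>L\<^sup>1(w dx)\<close>.\<close>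

lemma muckenhoupt_tail_bound:
  fixes w :: "real^'n::finite \<Rightarrow> real"
  assumes q: "q > 1" and w: "w \<in> muckenhoupt q" and l: "CARD('n) < 2 * l"
  shows "\<exists>C\<ge>0. \<forall>g. g \<in> borel_measurable lebesgue \<longrightarrow> (\<forall>y. 0 \<le> g y) \<longrightarrow> integrable lebesgue (\<lambda>y. g y powr q * w y) \<longrightarrow>
    (\<forall>x. integrable lebesgue (\<lambda>y. g y / wt l x y)) \<and>
    (\<integral>\<^sup>+x. ennreal ((LINT y|lebesgue. g y / wt l x y) powr q * w x) \<partial>lebesgue)
      \<le> ennreal (C * (LINT y|lebesgue. g y powr q * w y))"
proof -
  have wm[measurable]: "w \<in> borel_measurable lebesgue" and wpos: "AE y in lebesgue. 0 < w y"
    and wi: "\<And>c r. set_integrable lebesgue (ball c r) w"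
    using w unfolding muckenhoupt_def mem_Collect_eq by blast+
  obtain C where C: "\<And>c r. 0 < r \<Longrightarrow> ((LINT x:ball c r|lebesgue. w x) / measure lebesgue (ball c r)) *
        ((LINT x:ball c r|lebesgue. w x powr (- 1 / (q - 1))) / measure lebesgue (ball c r)) powr (q - 1) \<le> C"
    using w unfolding muckenhoupt_def by auto
  define C0 where "C0 = max 0 C"
  have C0: "C0 \<ge> 0" by (simp add: C0_def)
  have "((LINT x:ball c r|lebesgue. w x) / measure lebesgue (ball c r)) *
        ((LINT x:ball c r|lebesgue. w x powr (- 1 / (q - 1))) / measure lebesgue (ball c r)) powr (q - 1) \<le> C0" if "0 < r" for c r
    unfolding C0_def by (rule order_trans[OF C[OF that] max.cobounded2])
  note av = muckenhoupt_average[OF q w this]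
  define m where "m = overlap_number TYPE(real^'n)"
  define n where "n = CARD('n)"
  define v1 where "v1 = measure lebesgue (ball (0::real^'n) 1)"
  have v1: "v1 > 0" unfolding v1_def using content_ball_pos[of 1 "0::real^'n"] by simp
  have vol: "measure lebesgue (ball x (2 ^ j)) = v1 * (2 ^ j) ^ n" for x :: "real^'n" and j :: nat
    by (simp add: v1_def n_def content_ball)
  define C1 where "C1 = C0 * v1 powr q"
  have C1: "C1 \<ge> 0" using C0 by (simp add: C1_def)
  define C where "C = (3 * 4 ^ l) powr q * C1 * (4 * real m)"
  have C: "C \<ge> 0" using C1 by (simp add: C_def)
  have "(\<forall>x. integrable lebesgue (\<lambda>y. g y / wt l x y)) \<and>
    (\<integral>\<^sup>+x. ennreal ((LINT y|lebesgue. g y / wt l x y) powr q * w x) \<partial>lebesgue)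
      \<le> ennreal (C * (LINT y|lebesgue. g y powr q * w y))"
    if gm[measurable]: "g \<in> borel_measurable lebesgue" and g0: "\<And>y. 0 \<le> g y" and gi: "integrable lebesgue (\<lambda>y. g y powr q * w y)"
    for g
  proof -
    define F where "F y = g y powr q * w y" for y
    have Fi: "integrable lebesgue F" using gi by (simp add: F_def[abs_def])
    have Fm[measurable]: "F \<in> borel_measurable lebesgue" using Fi by auto
    have F0: "AE y in lebesgue. 0 \<le> F y" using wpos by eventually_elim (simp add: F_def)
    have ballm[measurable]: "ball c s \<in> sets lebesgue" for c :: "real^'n" and s by simp
    define I where "I j x = (LINT y:ball x (2 ^ j)|lebesgue. g y)" for j :: nat and x
    define G where "G j x = (LINT y:ball x (2 ^ j)|lebesgue. F y)" for j :: nat and x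
    define W where "W j x = (LINT y:ball x (2 ^ j)|lebesgue. w y)" for j :: nat and x
    define H where "H j x = G j x / W j x" for j x
    define b where "b j x = I j x / (2 ^ j) ^ n" for j x
    have gset: "set_integrable lebesgue (ball x (2 ^ j)) g" for x and j :: nat by (rule av(1)[OF _ gm g0 gi]) simp_all
    have Fset: "set_integrable lebesgue (ball x (2 ^ j)) F" for x and j :: nat
      unfolding set_integrable_def by (rule integrable_mult_indicator[OF ballm Fi])
    have W0: "W j x > 0" for j x unfolding W_def by (rule ball_integral_pos[OF wi wpos]) simp
    have G0: "G j x \<ge> 0" for j x unfolding G_def set_lebesgue_integral_def using F0
      by (intro integral_nonneg_AE) (auto elim!: eventually_mono simp: indicator_def)
    have I0: "I j x \<ge> 0" for j x unfolding I_def set_lebesgue_integral_def using g0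
      by (intro integral_nonneg_AE AE_I2) (auto simp: indicator_def)
    have H0: "H j x \<ge> 0" for j x using G0[of j x] W0[of j x] by (simp add: H_def)
    have b0: "b j x \<ge> 0" for j x using I0[of j x] by (simp add: b_def)
    have bH: "b j x powr q \<le> C1 * H j x" for j x
    proof -
      have "I j x powr q \<le> C0 * (v1 * (2 ^ j) ^ n) powr q * H j x"
        using av(2)[OF _ gm g0 gi, of "2 ^ j" x] by (simp add: vol I_def G_def W_def H_def F_def)
      also have "\<dots> = (C1 * H j x) * ((2 ^ j) ^ n) powr q" using v1 by (simp add: C1_def powr_mult)
      finally have "I j x powr q / ((2 ^ j) ^ n) powr q \<le> C1 * H j x" by (simp add: pos_divide_le_eq)
      then show ?thesis using I0[of j x] by (simp add: b_def powr_divide)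
    qed
    define Gt where "Gt = integral\<^sup>L lebesgue F"
    have Gt0: "0 \<le> Gt" unfolding Gt_def by (rule integral_nonneg_AE[OF F0])
    have GG: "G j x \<le> Gt" for j x unfolding G_def Gt_def set_lebesgue_integral_def
      using F0 by (intro integral_mono_AE[OF Fset[unfolded set_integrable_def] Fi]) (auto elim!: eventually_mono simp: indicator_def)
    have WW: "W 0 x \<le> W j x" for j x unfolding W_def set_lebesgue_integral_def
    proof (rule integral_mono_AE[OF wi[unfolded set_integrable_def] wi[unfolded set_integrable_def]])
      have "dist x y < 2 ^ j" if "dist x y < 1" for y
        using that one_le_power[of "2::real" j] by linarith
      then show "AE y in lebesgue. indicat_real (ball x (2 ^ 0)) y *\<^sub>R w y \<le> indicat_real (ball x (2 ^ j)) y *\<^sub>R w y"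
        using wpos by (auto elim!: eventually_mono simp: indicator_def)
    qed
    have HB: "H j x \<le> Gt / W 0 x" for j x
      unfolding H_def using GG WW W0 Gt0 by (intro frac_le) auto
    \<comment> \<open>A sum over the scales that is still integrable against \<open>w\<close>. It gives \<open>b\<^sub>j \<le> (4 / 3)\<^sup>j R\<close>
      with \<open>R\<close> independent of \<open>j\<close>, so that the dyadic sum is a geometric series of ratio \<open>(1 / 2)
      (4 / 3)\<close>; any number between \<open>1 / 2\<close> and 1 could replace \<open>3 / 4\<close>.\<close>
    define T where "T x = (\<Sum>j. (3 / 4) ^ j * H j x)" for x
    have Tsum: "summable (\<lambda>j. (3 / 4) ^ j * H j x)" for x
    proof (rule summable_comparison_test')
      show "summable (\<lambda>j. (3 / 4) ^ j * (Gt / W 0 x))" by (intro summable_mult2 summable_geometric) simp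
      show "norm ((3 / 4) ^ j * H j x) \<le> (3 / 4) ^ j * (Gt / W 0 x)" for j
        using mult_left_mono[OF HB[of j x], of "(3 / 4) ^ j"] H0[of j x] by (simp add: abs_mult)
    qed
    have T0: "0 \<le> T x" for x unfolding T_def using H0 by (intro suminf_nonneg Tsum) auto
    have HT: "(3 / 4) ^ j * H j x \<le> T x" for j x
      using sum_le_suminf[OF Tsum, of "{j}" x] H0 by (simp add: T_def)
    define R where "R x = (C1 * T x) powr (1 / q)" for x
    have R0: "0 \<le> R x" for x by (simp add: R_def)
    have Rq: "R x powr q = C1 * T x" for x using q C1 T0[of x] by (simp add: R_def powr_powr)
    have bR: "b j x \<le> (4 / 3) ^ j * R x" for j x
    proof (rule ccontr)
      assume "\<not> ?thesis"
      then have "((4 / 3) ^ j * R x) powr q < b j x powr q" using q R0[of x] by (intro powr_less_mono2) auto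
      also have "\<dots> \<le> C1 * H j x" by (rule bH)
      also have "\<dots> = (4 / 3) ^ j * (C1 * ((3 / 4) ^ j * H j x))" by (simp add: power_divide)
      also have "\<dots> \<le> (4 / 3) ^ j * (C1 * T x)" using HT[of j x] C1 by (intro mult_left_mono) auto
      also have "\<dots> = (4 / 3) ^ j * R x powr q" by (simp add: Rq)
      also have "(4 / 3) ^ j \<le> ((4 / 3 :: real) ^ j) powr q"
        using q powr_mono[of 1 q "(4 / 3) ^ j"] by (simp add: one_le_power)
      then have "(4 / 3) ^ j * R x powr q \<le> ((4 / 3) ^ j) powr q * R x powr q" by (intro mult_right_mono) auto
      also have "\<dots> = ((4 / 3) ^ j * R x) powr q" using R0[of x] by (simp add: powr_mult)
      finally show False by simp
    qed
    have Phi: "(\<integral>\<^sup>+y. ennreal (g y / wt l x y) \<partial>lebesgue) \<le> ennreal (3 * 4 ^ l * R x)" for x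
    proof -
      have "(\<integral>\<^sup>+y. ennreal (g y / wt l x y) \<partial>lebesgue)
        \<le> (\<integral>\<^sup>+y. (\<Sum>j. ennreal (4 ^ l * (1 / 4 ^ l) ^ j) * (ennreal (g y) * indicator (ball x (2 ^ j)) y)) \<partial>lebesgue)"
      proof (rule nn_integral_mono)
        fix y
        have "ennreal (g y / wt l x y) = ennreal (g y) * ennreal (1 / wt l x y)"
          using g0[of y] by (subst ennreal_mult[symmetric]) auto
        also have "\<dots> \<le> ennreal (g y) * (\<Sum>j. ennreal (4 ^ l * (1 / 4 ^ l) ^ j) * indicator (ball 0 (2 ^ j)) (x - y))"
          by (intro mult_left_mono kernel_le_dyadic) simp
        also have "\<dots> = (\<Sum>j. ennreal (g y) * (ennreal (4 ^ l * (1 / 4 ^ l) ^ j) * indicator (ball 0 (2 ^ j)) (x - y)))"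
          by simp
        also have "\<dots> = (\<Sum>j. ennreal (4 ^ l * (1 / 4 ^ l) ^ j) * (ennreal (g y) * indicator (ball x (2 ^ j)) y))"
        proof -
          have "indicator (ball 0 (2 ^ j)) (x - y) = (indicator (ball x (2 ^ j)) y :: ennreal)" for j :: nat
            by (simp add: indicator_def dist_norm norm_minus_commute)
          then show ?thesis by (simp add: mult.left_commute)
        qed
        finally show "ennreal (g y / wt l x y) \<le> (\<Sum>j. ennreal (4 ^ l * (1 / 4 ^ l) ^ j) * (ennreal (g y) * indicator (ball x (2 ^ j)) y))" .
      qed
      also have "\<dots> = (\<Sum>j. \<integral>\<^sup>+y. ennreal (4 ^ l * (1 / 4 ^ l) ^ j) * (ennreal (g y) * indicator (ball x (2 ^ j)) y) \<partial>lebesgue)"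
        by (rule nn_integral_suminf) measurable
      also have "\<dots> \<le> (\<Sum>j. ennreal (4 ^ l * R x * (2 / 3) ^ j))"
      proof (rule suminf_le[OF _ summableI summableI])
        fix j
        have "(\<integral>\<^sup>+y. ennreal (4 ^ l * (1 / 4 ^ l) ^ j) * (ennreal (g y) * indicator (ball x (2 ^ j)) y) \<partial>lebesgue)
          = ennreal (4 ^ l * (1 / 4 ^ l) ^ j) * (\<integral>\<^sup>+y. ennreal (g y) * indicator (ball x (2 ^ j)) y \<partial>lebesgue)"
          by (rule nn_integral_cmult) measurable
        also have "(\<integral>\<^sup>+y. ennreal (g y) * indicator (ball x (2 ^ j)) y \<partial>lebesgue) = (\<integral>\<^sup>+y. ennreal (indicator (ball x (2 ^ j)) y *\<^sub>R g y) \<partial>lebesgue)"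
          by (intro nn_integral_cong) (auto simp: indicator_def)
        also have "\<dots> = ennreal (I j x)" unfolding I_def set_lebesgue_integral_def
          using g0 by (intro nn_integral_eq_integral gset[unfolded set_integrable_def] AE_I2) (auto simp: indicator_def)
        also have "ennreal (4 ^ l * (1 / 4 ^ l) ^ j) * ennreal (I j x) = ennreal (4 ^ l * (1 / 4 ^ l) ^ j * I j x)"
          using I0[of j x] by (intro ennreal_mult[symmetric]) auto
        also have "\<dots> \<le> ennreal (4 ^ l * R x * (2 / 3) ^ j)"
        proof (rule ennreal_leI)
          have "(2::real) ^ n \<le> 4 ^ l / 2"
          proof -
            have "(2::real) ^ Suc n \<le> 2 ^ (2 * l)" using l by (intro power_increasing) (auto simp: n_def)
            then show ?thesis by (simp add: power_mult)
          qed
          then have "2 ^ n / 4 ^ l \<le> (1 / 2 :: real)" by (simp add: field_simps)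
          then have "(2 ^ n / 4 ^ l) ^ j \<le> (1 / 2 :: real) ^ j" by (intro power_mono) auto
          then have P: "(1 / 4 ^ l) ^ j * (2 ^ j) ^ n \<le> (1 / 2 :: real) ^ j"
            by (simp add: power_divide power_mult[symmetric] mult.commute)
          have "4 ^ l * (1 / 4 ^ l) ^ j * I j x = 4 ^ l * ((1 / 4 ^ l) ^ j * (2 ^ j) ^ n * b j x)" by (simp add: b_def)
          also have "\<dots> \<le> 4 ^ l * ((1 / 2) ^ j * ((4 / 3) ^ j * R x))"
            using P bR[of j x] b0[of j x] by (intro mult_left_mono mult_mono) auto
          also have "\<dots> = 4 ^ l * R x * ((1 / 2) * (4 / 3)) ^ j" by (simp only: power_mult_distrib mult_ac)
          also have "(1 / 2) * (4 / 3) = (2 / 3 :: real)" by simp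
          finally show "4 ^ l * (1 / 4 ^ l) ^ j * I j x \<le> 4 ^ l * R x * (2 / 3) ^ j" .
        qed
        finally show "(\<integral>\<^sup>+y. ennreal (4 ^ l * (1 / 4 ^ l) ^ j) * (ennreal (g y) * indicator (ball x (2 ^ j)) y) \<partial>lebesgue) \<le> ennreal (4 ^ l * R x * (2 / 3) ^ j)" .
      qed
      also have "\<dots> = ennreal (4 ^ l * R x * 3)"
      proof (rule suminf_ennreal_eq)
        show "(\<lambda>j. 4 ^ l * R x * (2 / 3) ^ j) sums (4 ^ l * R x * 3)"
          using sums_mult[OF geometric_sums[of "2 / 3 :: real"], of "4 ^ l * R x"] by simp
      qed (use R0 in auto)
      finally show ?thesis by (simp add: mult_ac)
    qed
    have nn: "0 \<le> g y / wt l x y" for x y using g0[of y] by simp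
    have km: "(\<lambda>y. g y / wt l x y) \<in> borel_measurable lebesgue" for x
    proof -
      have "(\<lambda>y. wt l x y) \<in> borel_measurable lebesgue" by (rule measurable_completion) measurable
      then show ?thesis by measurable
    qed
    have int: "integrable lebesgue (\<lambda>y. g y / wt l x y)" for x
    proof (rule integrableI_nonneg[OF km AE_I2[OF nn]])
      show "(\<integral>\<^sup>+y. ennreal (g y / wt l x y) \<partial>lebesgue) < \<infinity>"
        by (rule le_less_trans[OF Phi]) simp
    qed
    have PhiR: "(LINT y|lebesgue. g y / wt l x y) powr q \<le> (3 * 4 ^ l) powr q * C1 * T x" for x
    proof -
      have "ennreal (LINT y|lebesgue. g y / wt l x y) \<le> ennreal (3 * 4 ^ l * R x)"
        using Phi[of x] nn_integral_eq_integral[OF int AE_I2[OF nn], of x] by simp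
      then have le: "(LINT y|lebesgue. g y / wt l x y) \<le> 3 * 4 ^ l * R x"
        using R0[of x] by (subst (asm) ennreal_le_iff) auto
      have "0 \<le> (LINT y|lebesgue. g y / wt l x y)" using nn by (intro integral_nonneg_AE AE_I2)
      with le have "(LINT y|lebesgue. g y / wt l x y) powr q \<le> (3 * 4 ^ l * R x) powr q"
        using q by (intro powr_mono2) auto
      also have "\<dots> = (3 * 4 ^ l) powr q * (R x powr q)" using R0[of x] by (simp add: powr_mult)
      finally show ?thesis by (simp add: Rq mult.assoc)
    qed
    \<comment> \<open>The extended nonnegative versions of \<open>W\<close> and \<open>G\<close>, to which Tonelli's theorem applies.\<close>
    define We where "We j x = (\<integral>\<^sup>+y. ennreal (w y) * indicator (ball x (2 ^ j)) y \<partial>lebesgue)" for j :: nat and x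
    define Ge where "Ge j x = (\<integral>\<^sup>+y. ennreal (F y) * indicator (ball x (2 ^ j)) y \<partial>lebesgue)" for j :: nat and x
    have WeW: "We j x = ennreal (W j x)" for j x
    proof -
      have "We j x = (\<integral>\<^sup>+y. ennreal (indicator (ball x (2 ^ j)) y *\<^sub>R w y) \<partial>lebesgue)"
        unfolding We_def by (intro nn_integral_cong) (auto simp: indicator_def)
      also have "\<dots> = ennreal (W j x)" unfolding W_def set_lebesgue_integral_def using wpos
        by (intro nn_integral_eq_integral wi[unfolded set_integrable_def]) (auto elim!: eventually_mono simp: indicator_def)
      finally show ?thesis .
    qed
    have GeG: "Ge j x = ennreal (G j x)" for j x
    proof -
      have "Ge j x = (\<integral>\<^sup>+y. ennreal (indicator (ball x (2 ^ j)) y *\<^sub>R F y) \<partial>lebesgue)"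
        unfolding Ge_def by (intro nn_integral_cong) (auto simp: indicator_def)
      also have "\<dots> = ennreal (G j x)" unfolding G_def set_lebesgue_integral_def using F0
        by (intro nn_integral_eq_integral Fset[unfolded set_integrable_def]) (auto elim!: eventually_mono simp: indicator_def)
      finally show ?thesis .
    qed
    have He: "Ge j x / We j x = ennreal (H j x)" for j x
      unfolding WeW GeG H_def using G0[of j x] W0[of j x] by (rule divide_ennreal)
    have Wem[measurable]: "We j \<in> borel_measurable lebesgue" and Gem[measurable]: "Ge j \<in> borel_measurable lebesgue" for j
      unfolding We_def[abs_def] Ge_def[abs_def] by (rule measurable_ball_integral; measurable)+
    have Te: "ennreal (T x) = (\<Sum>j. ennreal ((3 / 4) ^ j) * (Ge j x / We j x))" for x
    proof -
      have "(\<Sum>j. ennreal ((3 / 4) ^ j * H j x)) = ennreal (T x)"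
        unfolding T_def using H0 by (intro suminf_ennreal2 Tsum) auto
      then show ?thesis using H0 by (simp add: He ennreal_mult)
    qed
    let ?K = "(3 * 4 ^ l) powr q * C1"
    have K0: "0 \<le> ?K" using C1 by simp
    have "(\<integral>\<^sup>+x. ennreal ((LINT y|lebesgue. g y / wt l x y) powr q * w x) \<partial>lebesgue)
      \<le> (\<integral>\<^sup>+x. ennreal ?K * (\<Sum>j. ennreal ((3 / 4) ^ j) * (ennreal (w x) * (Ge j x / We j x))) \<partial>lebesgue)"
    proof (rule nn_integral_mono_AE)
      show "AE x in lebesgue. ennreal ((LINT y|lebesgue. g y / wt l x y) powr q * w x)
        \<le> ennreal ?K * (\<Sum>j. ennreal ((3 / 4) ^ j) * (ennreal (w x) * (Ge j x / We j x)))"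
        using wpos
      proof eventually_elim
        case (elim x)
        have "(LINT y|lebesgue. g y / wt l x y) powr q * w x \<le> ?K * T x * w x"
          using elim PhiR[of x] by (intro mult_right_mono) auto
        then have "ennreal ((LINT y|lebesgue. g y / wt l x y) powr q * w x) \<le> ennreal (?K * T x * w x)"
          by (rule ennreal_leI)
        also have "\<dots> = ennreal ?K * (ennreal (w x) * ennreal (T x))"
        proof -
          have e1: "ennreal (?K * T x * w x) = ennreal (?K * T x) * ennreal (w x)"
            using K0 T0[of x] elim by (intro ennreal_mult) auto
          have e2: "ennreal (?K * T x) = ennreal ?K * ennreal (T x)" using K0 T0[of x] by (intro ennreal_mult) auto
          show ?thesis unfolding e1 e2 by (simp only: mult_ac)
        qed
        also have "ennreal (w x) * ennreal (T x) = (\<Sum>j. ennreal (w x) * (ennreal ((3 / 4) ^ j) * (Ge j x / We j x)))"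
          unfolding Te by simp
        also have "\<dots> = (\<Sum>j. ennreal ((3 / 4) ^ j) * (ennreal (w x) * (Ge j x / We j x)))"
          by (simp only: mult.left_commute)
        finally show ?case .
      qed
    qed
    also have "\<dots> = ennreal ?K * (\<Sum>j. ennreal ((3 / 4) ^ j) * (\<integral>\<^sup>+x. ennreal (w x) * (Ge j x / We j x) \<partial>lebesgue))"
      by (subst nn_integral_cmult, measurable, subst nn_integral_suminf, measurable, subst nn_integral_cmult, measurable)
    also have "\<dots> \<le> ennreal ?K * (\<Sum>j. ennreal ((3 / 4) ^ j) * (of_nat m * ennreal Gt))"
    proof (intro mult_left_mono suminf_le summableI)
      fix j
      have "(\<integral>\<^sup>+x. ennreal (w x) * (Ge j x / We j x) \<partial>lebesgue) \<le> of_nat m * (\<integral>\<^sup>+y. ennreal (F y) \<partial>lebesgue)"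
        unfolding Ge_def We_def m_def by (rule average_ratio_le) auto
      also have "(\<integral>\<^sup>+y. ennreal (F y) \<partial>lebesgue) = ennreal Gt"
        unfolding Gt_def by (rule nn_integral_eq_integral[OF Fi F0])
      finally show "(\<integral>\<^sup>+x. ennreal (w x) * (Ge j x / We j x) \<partial>lebesgue) \<le> of_nat m * ennreal Gt" .
    qed auto
    also have "(\<Sum>j. ennreal ((3 / 4) ^ j) * (of_nat m * ennreal Gt)) = (\<Sum>j. ennreal ((3 / 4) ^ j)) * (of_nat m * ennreal Gt)" by simp
    also have "(\<Sum>j. ennreal ((3 / 4) ^ j)) = ennreal 4"
      by (rule suminf_ennreal_eq) (use geometric_sums[of "3 / 4 :: real"] in auto)
    also have "ennreal ?K * (ennreal 4 * (of_nat m * ennreal Gt)) = ennreal (C * Gt)"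
      using K0 Gt0 C1 unfolding C_def ennreal_of_nat_eq_real_of_nat by (simp only: ennreal_mult[symmetric] mult_nonneg_nonneg of_nat_0_le_iff zero_le_numeral mult_ac)
    finally show ?thesis using int unfolding Gt_def F_def by blast
  qed
  then show ?thesis using C by blast
qed

section \<open>Fourier coefficients\<close>

lemma nderiv_0: "nderiv 0 g = g" by (simp add: nderiv_def)

lemma nderiv_Suc: "nderiv (Suc j) g = (\<lambda>t. vector_derivative (nderiv j g) (at t))"
  by (simp add: nderiv_def)

lemma nderiv_has_vector_derivative:
  assumes "times_differentiable N g" "j < N"
  shows "(nderiv j g has_vector_derivative nderiv (Suc j) g t) (at t)"
proof -
  have "nderiv j g differentiable (at t)" using assms by (simp add: times_differentiable_def)
  then show ?thesis unfolding nderiv_Suc by (simp add: vector_derivative_works)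
qed

lemma nderiv_periodic:
  assumes "times_differentiable N g" "j < N" "\<And>t. g (t + p) = g t"
  shows "nderiv j g (t + p) = nderiv j g t"
  using assms(2)
proof (induction j arbitrary: t)
  case 0
  show ?case using assms(3) by (simp add: nderiv_0)
next
  case (Suc j)
  have j: "j < N" using Suc.prems by simp
  have "((\<lambda>s. s + p) has_vector_derivative 1) (at t)" by (auto intro!: derivative_eq_intros simp: has_vector_derivative_def)
  moreover have "(nderiv j g has_vector_derivative nderiv (Suc j) g (t + p)) (at (t + p))"
    by (rule nderiv_has_vector_derivative[OF assms(1) j])
  ultimately have "(nderiv j g \<circ> (\<lambda>s. s + p) has_vector_derivative 1 *\<^sub>R nderiv (Suc j) g (t + p)) (at t)"
    by (intro vector_diff_chain_at) auto
  moreover have "nderiv j g \<circ> (\<lambda>s. s + p) = nderiv j g" using Suc.IH[OF j] by (simp add: fun_eq_iff)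
  ultimately have "(nderiv j g has_vector_derivative nderiv (Suc j) g (t + p)) (at t)" by simp
  then show ?case using nderiv_has_vector_derivative[OF assms(1) j, of t] by (rule vector_derivative_unique_at)
qed

lemma cis_has_vector_derivative:
  "((\<lambda>t. cis (- (c * t))) has_vector_derivative - (\<i> * complex_of_real c) * cis (- (c * t))) (at t)"
proof -
  have "((\<lambda>z. exp (- (\<i> * complex_of_real c) * z)) has_field_derivative exp (- (\<i> * complex_of_real c) * complex_of_real t) * - (\<i> * complex_of_real c)) (at (complex_of_real t))"
    by (auto intro!: derivative_eq_intros)
  from has_vector_derivative_real_field[OF this]
  have "((\<lambda>t. exp (- (\<i> * complex_of_real c) * complex_of_real t)) has_vector_derivative exp (- (\<i> * complex_of_real c) * complex_of_real t) * - (\<i> * complex_of_real c)) (at t)" .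
  moreover have "exp (- (\<i> * complex_of_real c) * complex_of_real t) = cis (- (c * t))" for t
    by (simp add: cis_conv_exp mult.assoc)
  ultimately show ?thesis by (simp add: mult.commute)
qed

text \<open>Integration by parts, with boundary terms that cancel by periodicity. The derivative of the
  top order need not be continuous; the gauge integral integrates any derivative, and so covers
  the last step.\<close>

lemma nderiv_cis_has_integral:
  assumes td: "times_differentiable N g" and per: "\<And>t. g (t + 2 * pi) = g t" and "j \<le> N" and "N > 0"
  shows "((\<lambda>t. nderiv j g t * cis (- (real k * t))) has_integral
     (\<i> * of_nat k) ^ j * integral {0..2*pi} (\<lambda>t. g t * cis (- (real k * t)))) {0..2*pi}"
  using \<open>j \<le> N\<close>
proof (induction j)
  case 0
  have "continuous_on {0..2*pi} g"
    using nderiv_has_vector_derivative[OF td \<open>N > 0\<close>] unfolding nderiv_0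
    by (intro continuous_at_imp_continuous_on ballI has_vector_derivative_continuous)
  then have "(\<lambda>t. g t * cis (- (real k * t))) integrable_on {0..2*pi}"
    by (intro integrable_continuous_real continuous_intros)
  then show ?case by (simp add: nderiv_0 integrable_integral)
next
  case (Suc j)
  have j: "j < N" using Suc.prems by simp
  let ?e = "\<lambda>t. cis (- (real k * t))"
  let ?I = "(\<i> * of_nat k) ^ j * integral {0..2*pi} (\<lambda>t. g t * ?e t)"
  have D: "((\<lambda>t. nderiv j g t * ?e t) has_vector_derivative (nderiv j g t * (- (\<i> * complex_of_real (real k)) * ?e t) + nderiv (Suc j) g t * ?e t)) (at t)" for t
    by (intro has_vector_derivative_mult nderiv_has_vector_derivative[OF td j] cis_has_vector_derivative)
  have "((\<lambda>t. nderiv j g t * (- (\<i> * complex_of_real (real k)) * ?e t) + nderiv (Suc j) g t * ?e t) has_integral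
     (nderiv j g (2*pi) * ?e (2*pi) - nderiv j g 0 * ?e 0)) {0..2*pi}"
    using D by (intro fundamental_theorem_of_calculus) (auto intro: has_vector_derivative_at_within)
  moreover have "nderiv j g (2*pi) * ?e (2*pi) - nderiv j g 0 * ?e 0 = 0"
  proof -
    have "?e (2*pi) = 1"
      using cis_multiple_2pi[of "- of_int (int k)"] by (simp add: mult_ac)
    moreover have "nderiv j g (2*pi) = nderiv j g 0" using nderiv_periodic[OF td j per, of 0] by simp
    ultimately show ?thesis by simp
  qed
  moreover have "((\<lambda>t. (\<i> * of_nat k) * (nderiv j g t * ?e t)) has_integral (\<i> * of_nat k) * ?I) {0..2*pi}"
    using Suc.IH j by (intro has_integral_mult_right) auto
  ultimately have "((\<lambda>t. (nderiv j g t * (- (\<i> * complex_of_real (real k)) * ?e t) + nderiv (Suc j) g t * ?e t) + (\<i> * of_nat k) * (nderiv j g t * ?e t)) has_integral 0 + (\<i> * of_nat k) * ?I) {0..2*pi}"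
    by (intro has_integral_add) auto
  then show ?case by (simp add: algebra_simps)
qed

lemma fourier_coeff_eq_integral:
  assumes "continuous_on UNIV (a x)"
  shows "fourier_coeff a x k = integral {0..2*pi} (\<lambda>t. a x t * cis (- (real k * t)))"
  unfolding fourier_coeff_def
  by (intro set_lebesgue_integral_eq_integral(2) absolutely_integrable_continuous_real continuous_intros
      continuous_on_subset[OF assms]) auto

lemma fourier_coeff_bound:
  assumes td: "times_differentiable N (a x)" and per: "\<And>t. a x (t + 2 * pi) = a x t" and N: "N > 0"
    and M: "\<And>t. cmod (nderiv N (a x) t) \<le> M"
  shows "cmod (fourier_coeff a x k) * real k ^ N \<le> 2 * pi * M"
proof -
  have c: "continuous_on UNIV (a x)"
    using nderiv_has_vector_derivative[OF td N] unfolding nderiv_0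
    by (intro continuous_at_imp_continuous_on ballI has_vector_derivative_continuous)
  have M0: "0 \<le> M" using M[of 0] norm_ge_zero order_trans by blast
  have "cmod ((\<i> * of_nat k) ^ N * fourier_coeff a x k) \<le> M * measure lborel (cbox 0 (2*pi))"
    unfolding fourier_coeff_eq_integral[of a x, OF c]
  proof (rule has_integral_bound[OF M0])
    show "((\<lambda>t. nderiv N (a x) t * cis (- (real k * t))) has_integral
     (\<i> * of_nat k) ^ N * integral {0..2*pi} (\<lambda>t. a x t * cis (- (real k * t)))) (cbox 0 (2*pi))"
      using nderiv_cis_has_integral[OF td per order_refl N, of k] by simp
    show "norm (nderiv N (a x) t * cis (- (real k * t))) \<le> M" for t using M[of t] by (simp add: norm_mult)
  qed
  then show ?thesis by (simp add: norm_mult norm_power mult_ac)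
qed

lemma continuous_fourier_coeff:
  assumes cx: "\<And>t. continuous_on UNIV (\<lambda>x. a x t)" and ct: "\<And>x. continuous_on UNIV (a x)"
    and M: "\<And>x t. cmod (a x t) \<le> M"
  shows "continuous_on UNIV (\<lambda>x. fourier_coeff a x k)"
proof (rule continuous_at_imp_continuous_on, rule ballI)
  fix x :: "real^'a"
  show "isCont (\<lambda>x. fourier_coeff a x k) x"
    unfolding continuous_at_sequentially
  proof (intro allI impI)
    fix X assume X: "X \<longlonglongrightarrow> x"
    show "((\<lambda>x. fourier_coeff a x k) \<circ> X) \<longlonglongrightarrow> fourier_coeff a x k"
      unfolding fourier_coeff_def set_lebesgue_integral_def o_def
    proof (rule integral_dominated_convergence[where w="\<lambda>t. indicator {0..2*pi} t * M"])
      have m: "(\<lambda>t. a y t * cis (- (real k * t))) \<in> borel_measurable borel" for y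
        by (intro borel_measurable_continuous_onI continuous_intros ct)
      have m2: "(\<lambda>t. indicat_real {0..2*pi} t *\<^sub>R (a y t * cis (- (real k * t)))) \<in> borel_measurable lebesgue" for y
        by (rule measurable_completion) (use m[of y] in measurable)
      show "(\<lambda>t. indicat_real {0..2*pi} t *\<^sub>R (a x t * cis (- (real k * t)))) \<in> borel_measurable lebesgue"
        "(\<lambda>t. indicat_real {0..2*pi} t *\<^sub>R (a (X i) t * cis (- (real k * t)))) \<in> borel_measurable lebesgue" for i
        by (rule m2)+
      show "integrable lebesgue (\<lambda>t. indicat_real {0..2*pi} t * M)"
        by (intro integrable_mult_left integrable_real_indicator) auto
      show "AE t in lebesgue. (\<lambda>i. indicat_real {0..2*pi} t *\<^sub>R (a (X i) t * cis (- (real k * t)))) \<longlonglongrightarrow> indicat_real {0..2*pi} t *\<^sub>R (a x t * cis (- (real k * t)))"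
      proof (rule AE_I2)
        fix t
        have "isCont (\<lambda>x. a x t) x" using cx[of t] by (simp add: continuous_on_eq_continuous_at)
        then have "(\<lambda>i. a (X i) t) \<longlonglongrightarrow> a x t" using X by (rule isCont_tendsto_compose)
        then show "(\<lambda>i. indicat_real {0..2*pi} t *\<^sub>R (a (X i) t * cis (- (real k * t)))) \<longlonglongrightarrow> indicat_real {0..2*pi} t *\<^sub>R (a x t * cis (- (real k * t)))"
          by (intro tendsto_intros)
      qed
      show "AE t in lebesgue. norm (indicat_real {0..2*pi} t *\<^sub>R (a (X i) t * cis (- (real k * t)))) \<le> indicat_real {0..2*pi} t * M" for i
        using M by (intro AE_I2) (auto simp: norm_mult indicator_def)
    qed
  qed
qed

section \<open>The pseudo-multiplier\<close>

text \<open>The right choice is \<open>t = c / A\<close>; for \<open>A = 0\<close> large \<open>t\<close> force \<open>c = 0\<close>.\<close>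

lemma sq_le_mult_of_weighted_means:
  fixes A B c :: real
  assumes "0 \<le> A" "0 \<le> B" "0 \<le> c" and t: "\<And>t. 0 < t \<Longrightarrow> 2 * t * c \<le> t\<^sup>2 * A + B"
  shows "c\<^sup>2 \<le> A * B"
proof (cases "c = 0")
  case True then show ?thesis using assms by simp
next
  case False
  then have c: "c > 0" using assms by simp
  show ?thesis
  proof (cases "A = 0")
    case True
    have "2 * ((B + 1) / (2 * c)) * c \<le> B" using t[of "(B + 1) / (2 * c)"] True c assms by simp
    then show ?thesis using c by simp
  next
    case False
    then have A: "A > 0" using assms by simp
    have "2 * (c / A) * c \<le> (c / A)\<^sup>2 * A + B" using A c by (intro t) simp
    also have "(c / A)\<^sup>2 * A = c\<^sup>2 / A" using A by (simp add: power2_eq_square)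
    finally have "c\<^sup>2 / A \<le> B" by (simp add: power2_eq_square)
    then show ?thesis using A by (simp add: field_simps)
  qed
qed

lemma Cauchy_Schwarz_weighted:
  fixes f U :: "'a \<Rightarrow> complex"
  assumes m: "f \<in> borel_measurable M" "U \<in> borel_measurable M" and \<omega>: "\<And>y. 0 < \<omega> y"
    and fi: "integrable M (\<lambda>y. (cmod (f y))\<^sup>2 / \<omega> y)" and Ui: "integrable M (\<lambda>y. \<omega> y * (cmod (U y))\<^sup>2)"
  shows "integrable M (\<lambda>y. f y * U y)"
    "(cmod (LINT y|M. f y * U y))\<^sup>2 \<le> (LINT y|M. (cmod (f y))\<^sup>2 / \<omega> y) * (LINT y|M. \<omega> y * (cmod (U y))\<^sup>2)"
proof -
  have am: "2 * t * cmod (f y * U y) \<le> t\<^sup>2 * ((cmod (f y))\<^sup>2 / \<omega> y) + \<omega> y * (cmod (U y))\<^sup>2" for t y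
  proof -
    have "2 * (t * cmod (f y) / sqrt (\<omega> y)) * (sqrt (\<omega> y) * cmod (U y)) \<le> (t * cmod (f y) / sqrt (\<omega> y))\<^sup>2 + (sqrt (\<omega> y) * cmod (U y))\<^sup>2"
      by (rule sum_squares_bound)
    then show ?thesis using \<omega>[of y] by (simp add: power_mult_distrib power_divide norm_mult mult_ac)
  qed
  have int: "integrable M (\<lambda>y. t\<^sup>2 * ((cmod (f y))\<^sup>2 / \<omega> y) + \<omega> y * (cmod (U y))\<^sup>2)" for t
    by (intro Bochner_Integration.integrable_add integrable_mult_right fi Ui)
  show fU: "integrable M (\<lambda>y. f y * U y)"
  proof (rule integrable_dominated[OF int[of 1]])
    show "(\<lambda>y. f y * U y) \<in> borel_measurable M" using m by measurable
    show "norm (f y * U y) \<le> 1\<^sup>2 * ((cmod (f y))\<^sup>2 / \<omega> y) + \<omega> y * (cmod (U y))\<^sup>2" for y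
      using am[of 1 y] norm_ge_zero[of "f y * U y"] by linarith
  qed
  show "(cmod (LINT y|M. f y * U y))\<^sup>2 \<le> (LINT y|M. (cmod (f y))\<^sup>2 / \<omega> y) * (LINT y|M. \<omega> y * (cmod (U y))\<^sup>2)"
  proof (rule sq_le_mult_of_weighted_means)
    show "0 \<le> (LINT y|M. (cmod (f y))\<^sup>2 / \<omega> y)" "0 \<le> (LINT y|M. \<omega> y * (cmod (U y))\<^sup>2)"
      using \<omega> by (auto intro!: integral_nonneg_AE AE_I2 simp: less_imp_le)
    fix t :: real assume t: "0 < t"
    have "2 * t * cmod (LINT y|M. f y * U y) \<le> 2 * t * (LINT y|M. cmod (f y * U y))"
      using t by (intro mult_left_mono integral_norm_bound) auto
    also have "\<dots> = (LINT y|M. 2 * t * cmod (f y * U y))" by simp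
    also have "\<dots> \<le> (LINT y|M. t\<^sup>2 * ((cmod (f y))\<^sup>2 / \<omega> y) + \<omega> y * (cmod (U y))\<^sup>2)"
      by (intro integral_mono integrable_mult_right integrable_norm fU int am)
    also have "\<dots> = t\<^sup>2 * (LINT y|M. (cmod (f y))\<^sup>2 / \<omega> y) + (LINT y|M. \<omega> y * (cmod (U y))\<^sup>2)"
      by (subst Bochner_Integration.integral_add[OF integrable_mult_right[OF fi] Ui]) (simp only: integral_mult_right_zero)
    finally show "2 * t * cmod (LINT y|M. f y * U y) \<le> t\<^sup>2 * (LINT y|M. (cmod (f y))\<^sup>2 / \<omega> y) + (LINT y|M. \<omega> y * (cmod (U y))\<^sup>2)" .
  qed simp
qed

lemma weight_pos: "0 < (1 + norm (z::'a::real_normed_vector)) ^ m"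
  by (intro zero_less_power) (simp add: add_pos_nonneg)

lemma tail_integrable_mult_Herm:
  fixes f :: "real^'n::finite \<Rightarrow> complex"
  assumes f: "f \<in> borel_measurable lebesgue" and fi: "integrable lebesgue (\<lambda>y. (cmod (f y))\<^sup>2 / wt l x y)"
  shows "integrable lebesgue (\<lambda>y. f y * cHerm \<alpha> y)"
proof (rule Cauchy_Schwarz_weighted(1)[OF f _ _ fi])
  show "(\<lambda>y. cHerm \<alpha> y) \<in> borel_measurable lebesgue" by (rule measurable_completion) measurable
  show "integrable lebesgue (\<lambda>y. wt l x y * (cmod (cHerm \<alpha> y))\<^sup>2)"
    using Herm_expansion_weight[of "{\<alpha>}" x l "\<lambda>_. 1"] by (simp add: integral_at_most_def)
qed (rule weight_pos)

text \<open>The mean that controls the operator at \<open>x\<close>. Its finiteness also ensures that \<open>f\<close> has Hermite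
  coefficients.\<close>

definition tail_mean :: "nat \<Rightarrow> (real^'n::finite \<Rightarrow> complex) \<Rightarrow> real^'n \<Rightarrow> real" where
  "tail_mean l f x = (LINT y|lebesgue. (cmod (f y))\<^sup>2 / wt l x y)"

lemma tail_mean_nonneg: "0 \<le> tail_mean l f x"
  unfolding tail_mean_def
  using weight_pos[of "x - _" "2 * l"] by (intro integral_nonneg_AE AE_I2) (auto intro!: divide_nonneg_pos)

text \<open>The leading 2 accounts for the real and imaginary parts of the multiplier, which are
  estimated separately.\<close>

definition kernel_const :: "'n::finite itself \<Rightarrow> nat \<Rightarrow> real" where
  "kernel_const _ l = 2 * ((1 + 2 * real CARD('n)) ^ (2 * l) * (1 + real CARD('n) * moment_const l))"

lemma kernel_const_nonneg: "0 \<le> kernel_const TYPE('n::finite) l"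
  by (simp add: kernel_const_def moment_const_nonneg)

text \<open>The sum is the integral of \<open>f\<close> against the truncated kernel \<open>U\<close>, to which the weighted
  Cauchy-Schwarz inequality applies. Arbitrary finite sets of degrees are allowed in order to
  obtain the Cauchy criterion from the same estimate.\<close>

lemma hproj_sum_bound:
  fixes f :: "real^'n::finite \<Rightarrow> complex"
  assumes f: "f \<in> borel_measurable lebesgue"
    and fi: "integrable lebesgue (\<lambda>y. (cmod (f y))\<^sup>2 / wt l x y)"
    and mk: "\<And>k. cmod (m k) \<le> M / real (Suc k) ^ l" and K: "finite K"
  shows "(cmod (\<Sum>k\<in>K. m k * hproj k f x))\<^sup>2
    \<le> kernel_const TYPE('n) l * M\<^sup>2 * (\<Sum>k\<in>K. \<Sum>\<alpha> | deg \<alpha> = k. hweight l \<alpha> x) * tail_mean l f x"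
proof -
  define A where "A = (\<Union>k\<in>K. {\<alpha> :: 'n \<Rightarrow> nat. deg \<alpha> = k})"
  have A: "finite A" unfolding A_def using K finite_deg by auto
  have sumA: "(\<Sum>\<alpha>\<in>A. F \<alpha>) = (\<Sum>k\<in>K. \<Sum>\<alpha> | deg \<alpha> = k. F \<alpha>)" for F :: "_ \<Rightarrow> 'b::comm_monoid_add"
    unfolding A_def using K finite_deg by (intro sum.UNION_disjoint) auto
  define U where "U y = (\<Sum>\<alpha>\<in>A. m (deg \<alpha>) * complex_of_real (Herm \<alpha> x * Herm \<alpha> y))" for y
  let ?w = "\<lambda>y. wt l x y"
  let ?H = "\<Sum>\<alpha>\<in>A. hweight l \<alpha> x"
  have Um: "U \<in> borel_measurable lebesgue" unfolding U_def[abs_def] by (rule measurable_completion) measurable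
  have "(cmod (U y))\<^sup>2 = (\<Sum>\<alpha>\<in>A. Re (m (deg \<alpha>)) * Herm \<alpha> x * Herm \<alpha> y)\<^sup>2 + (\<Sum>\<alpha>\<in>A. Im (m (deg \<alpha>)) * Herm \<alpha> x * Herm \<alpha> y)\<^sup>2" for y
    unfolding cmod_power2 U_def by (simp add: mult.assoc)
  moreover have "\<bar>Re (m (deg \<alpha>))\<bar> \<le> M / deg1 \<alpha> ^ l" "\<bar>Im (m (deg \<alpha>))\<bar> \<le> M / deg1 \<alpha> ^ l" for \<alpha> :: "'n \<Rightarrow> nat"
    using order_trans[OF abs_Re_le_cmod mk] order_trans[OF abs_Im_le_cmod mk] by auto
  note r = Herm_expansion_weighted[OF A this(1), of x] and i = Herm_expansion_weighted[OF A this(2), of x]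
  ultimately have U: "integral_at_most lebesgue (\<lambda>y. ?w y * (cmod (U y))\<^sup>2) (kernel_const TYPE('n) l * M\<^sup>2 * ?H)"
    using integral_at_most_add[OF r i] by (simp add: distrib_left kernel_const_def mult_ac)
  then have Ui: "integrable lebesgue (\<lambda>y. ?w y * (cmod (U y))\<^sup>2)" by (simp add: integral_at_most_def)
  have "(\<Sum>k\<in>K. m k * hproj k f x) = (\<Sum>k\<in>K. \<Sum>\<alpha> | deg \<alpha> = k. m (deg \<alpha>) * (hcoeff f \<alpha> * cHerm \<alpha> x))"
    unfolding hproj_def sum_distrib_left by (intro sum.cong refl) auto
  also have "\<dots> = (\<Sum>\<alpha>\<in>A. m (deg \<alpha>) * (hcoeff f \<alpha> * cHerm \<alpha> x))" by (rule sumA[symmetric])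
  also have "\<dots> = (\<Sum>\<alpha>\<in>A. (LINT y|lebesgue. (m (deg \<alpha>) * cHerm \<alpha> x) * (f y * cHerm \<alpha> y)))"
    unfolding hcoeff_def integral_mult_right_zero by (simp only: mult_ac)
  also have "\<dots> = (LINT y|lebesgue. (\<Sum>\<alpha>\<in>A. (m (deg \<alpha>) * cHerm \<alpha> x) * (f y * cHerm \<alpha> y)))"
    by (intro Bochner_Integration.integral_sum[symmetric] integrable_mult_right tail_integrable_mult_Herm[OF f fi])
  also have "\<dots> = (LINT y|lebesgue. f y * U y)"
    unfolding U_def sum_distrib_left by (simp add: mult_ac)
  finally have "(cmod (\<Sum>k\<in>K. m k * hproj k f x))\<^sup>2 \<le> tail_mean l f x * (LINT y|lebesgue. ?w y * (cmod (U y))\<^sup>2)"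
    unfolding tail_mean_def using Cauchy_Schwarz_weighted(2)[OF f Um weight_pos fi Ui] by simp
  also have "\<dots> \<le> tail_mean l f x * (kernel_const TYPE('n) l * M\<^sup>2 * ?H)"
    using U by (intro mult_left_mono tail_mean_nonneg) (simp add: integral_at_most_def)
  finally show ?thesis unfolding sumA by (simp only: mult_ac)
qed

lemma series_bound:
  fixes a :: "nat \<Rightarrow> complex" and Q :: "nat \<Rightarrow> real"
  assumes Q0: "\<And>k. 0 \<le> Q k" and QB: "\<And>n. (\<Sum>k<n. Q k) \<le> B" and D: "0 \<le> D"
    and le: "\<And>K. finite K \<Longrightarrow> (cmod (\<Sum>k\<in>K. a k))\<^sup>2 \<le> D * (\<Sum>k\<in>K. Q k)"
  shows "summable a" "(cmod (\<Sum>k. a k))\<^sup>2 \<le> D * B"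
proof -
  have "summable Q"
  proof (rule summableI_nonneg_bounded[OF Q0])
    show "(\<Sum>k<n. Q k) \<le> B" for n by (rule QB)
  qed
  then have Qc: "\<And>e. 0 < e \<Longrightarrow> \<exists>N. \<forall>m\<ge>N. \<forall>n. norm (\<Sum>k\<in>{m..<n}. Q k) < e" unfolding summable_Cauchy by blast
  show sa: "summable a"
    unfolding summable_Cauchy
  proof (intro allI impI)
    fix e :: real assume e: "0 < e"
    have "0 < e\<^sup>2 / (D + 1)" using e D by simp
    then obtain N where N: "\<forall>m\<ge>N. \<forall>n. norm (\<Sum>k\<in>{m..<n}. Q k) < e\<^sup>2 / (D + 1)" using Qc by blast
    have "norm (\<Sum>k\<in>{m..<n}. a k) < e" if "m \<ge> N" for m n
    proof -
      have q: "(\<Sum>k\<in>{m..<n}. Q k) < e\<^sup>2 / (D + 1)" using N that by (simp add: abs_less_iff)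
      have q0: "0 \<le> (\<Sum>k\<in>{m..<n}. Q k)" using Q0 by (intro sum_nonneg)
      have "(cmod (\<Sum>k\<in>{m..<n}. a k))\<^sup>2 \<le> D * (\<Sum>k\<in>{m..<n}. Q k)" by (rule le) simp
      also have "\<dots> \<le> (D + 1) * (\<Sum>k\<in>{m..<n}. Q k)" using q0 by (intro mult_right_mono) auto
      also have "\<dots> < (D + 1) * (e\<^sup>2 / (D + 1))" using q D by (intro mult_strict_left_mono) auto
      also have "\<dots> = e\<^sup>2" using D by simp
      finally show ?thesis using e by (simp add: power_less_imp_less_base less_imp_le)
    qed
    then show "\<exists>N. \<forall>m\<ge>N. \<forall>n. norm (\<Sum>k\<in>{m..<n}. a k) < e" by blast
  qed
  have "(\<lambda>n. (cmod (\<Sum>k<n. a k))\<^sup>2) \<longlonglongrightarrow> (cmod (\<Sum>k. a k))\<^sup>2"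
    by (intro tendsto_intros summable_LIMSEQ sa)
  moreover have "(cmod (\<Sum>k<n. a k))\<^sup>2 \<le> D * B" for n
  proof -
    have "(cmod (\<Sum>k<n. a k))\<^sup>2 \<le> D * (\<Sum>k<n. Q k)" by (rule le) simp
    also have "\<dots> \<le> D * B" by (intro mult_left_mono QB D)
    finally show ?thesis .
  qed
  ultimately show "(cmod (\<Sum>k. a k))\<^sup>2 \<le> D * B" by (intro LIMSEQ_le_const2) auto
qed

text \<open>The constant depends neither on \<open>x\<close> nor on the multiplier, so that the multiplier may be
  chosen afresh at each point \<open>x\<close>. This is how the dependence of the symbol on \<open>x\<close> is handled.\<close>

lemma hproj_series_bound:
  assumes l: "CARD('n::finite) < 2 * l"
  shows "\<exists>D\<ge>0. \<forall>(f :: real^'n \<Rightarrow> complex) x m M. f \<in> borel_measurable lebesgue \<longrightarrow>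
     integrable lebesgue (\<lambda>y. (cmod (f y))\<^sup>2 / wt l x y) \<longrightarrow>
     (\<forall>k. cmod (m k) \<le> M / real (Suc k) ^ l) \<longrightarrow>
     summable (\<lambda>k. m k * hproj k f x) \<and> (cmod (\<Sum>k. m k * hproj k f x))\<^sup>2 \<le> D * M\<^sup>2 * tail_mean l f x"
proof -
  obtain B0 where B0: "\<forall>(x::real^'n) A. finite A \<longrightarrow> (\<Sum>\<alpha>\<in>A. hweight l \<alpha> x) \<le> B0"
    using sum_hweight_bounded[OF l] by blast
  define B where "B = max 0 B0"
  define D where "D = kernel_const TYPE('n) l"
  define Q where "Q x k = (\<Sum>\<alpha> | deg \<alpha> = k. hweight l \<alpha> x)" for x :: "real^'n" and k
  have D0: "0 \<le> D" by (simp add: D_def kernel_const_nonneg)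
  have Q0: "0 \<le> Q x k" for x k unfolding Q_def by (intro sum_nonneg hweight_nonneg)
  have QB: "(\<Sum>k<n. Q x k) \<le> B" for x n
  proof -
    have "(\<Sum>k<n. Q x k) = (\<Sum>\<alpha>\<in>(\<Union>k\<in>{..<n}. {\<alpha>. deg \<alpha> = k}). hweight l \<alpha> x)"
      unfolding Q_def using finite_deg by (intro sum.UNION_disjoint[symmetric]) auto
    also have "\<dots> \<le> B0" using finite_deg by (intro B0[rule_format]) auto
    finally show ?thesis by (simp add: B_def)
  qed
  have "summable (\<lambda>k. m k * hproj k f x) \<and> (cmod (\<Sum>k. m k * hproj k f x))\<^sup>2 \<le> (D * B) * M\<^sup>2 * tail_mean l f x"
    if f: "f \<in> borel_measurable lebesgue" and fi: "integrable lebesgue (\<lambda>y. (cmod (f y))\<^sup>2 / wt l x y)"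
      and mk: "\<forall>k. cmod (m k) \<le> M / real (Suc k) ^ l"
    for f :: "real^'n \<Rightarrow> complex" and x m M
  proof -
    have E: "0 \<le> D * M\<^sup>2 * tail_mean l f x"
      by (intro mult_nonneg_nonneg D0 tail_mean_nonneg) simp
    have le: "(cmod (\<Sum>k\<in>K. m k * hproj k f x))\<^sup>2 \<le> (D * M\<^sup>2 * tail_mean l f x) * (\<Sum>k\<in>K. Q x k)" if "finite K" for K
      using hproj_sum_bound[OF f fi mk[rule_format] that] unfolding D_def Q_def by (simp only: mult_ac)
    note sb = series_bound[of "Q x" B "D * M\<^sup>2 * tail_mean l f x" "\<lambda>k. m k * hproj k f x", OF Q0 QB E le]
    show ?thesis using sb by (simp only: mult_ac simp_thms)
  qed
  moreover have "0 \<le> D * B" using D0 by (simp add: B_def)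
  ultimately show ?thesis by blast
qed

lemma powr_sq: "0 \<le> (t::real) \<Longrightarrow> (t\<^sup>2) powr (p / 2) = t powr p"
  by (cases "t = 0") (simp_all add: powr_powr flip: powr_numeral)

lemma measurable_tail:
  fixes f :: "real^'n::finite \<Rightarrow> complex"
  assumes f[measurable]: "f \<in> borel_measurable lebesgue"
  shows "tail_mean l f \<in> borel_measurable lebesgue"
proof -
  interpret L: sigma_finite_measure "lebesgue :: (real^'n) measure" by (rule sigma_finite_lebesgue)
  have i: "(\<lambda>x. x) \<in> borel_measurable (lebesgue :: (real^'n) measure)" by (rule borel_lebesgue) simp
  have 1: "fst \<in> borel_measurable (lebesgue \<Otimes>\<^sub>M lebesgue :: ((real^'n) \<times> (real^'n)) measure)"
    using measurable_compose[OF measurable_fst[of lebesgue lebesgue] i] by simp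
  have 2: "snd \<in> borel_measurable (lebesgue \<Otimes>\<^sub>M lebesgue :: ((real^'n) \<times> (real^'n)) measure)"
    using measurable_compose[OF measurable_snd[of lebesgue lebesgue] i] by simp
  have 3: "(\<lambda>p. norm (fst p - snd p)) \<in> borel_measurable (lebesgue \<Otimes>\<^sub>M lebesgue :: ((real^'n) \<times> (real^'n)) measure)"
    by (rule measurable_compose[OF borel_measurable_diff[OF 1 2] borel_measurable_norm])
  have 4: "(\<lambda>p. cmod (f (snd p))) \<in> borel_measurable (lebesgue \<Otimes>\<^sub>M lebesgue :: ((real^'n) \<times> (real^'n)) measure)"
    by (rule measurable_compose[OF measurable_compose[OF measurable_snd f] borel_measurable_norm])
  have "(\<lambda>p. (cmod (f (snd p)))\<^sup>2 / (1 + norm (fst p - snd p)) ^ (2 * l)) \<in> borel_measurable (lebesgue \<Otimes>\<^sub>M lebesgue :: ((real^'n) \<times> (real^'n)) measure)"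
    by (intro borel_measurable_divide borel_measurable_power borel_measurable_add borel_measurable_const 3 4)
  then have "(\<lambda>(x, y). (cmod (f y))\<^sup>2 / wt l x y) \<in> borel_measurable (lebesgue \<Otimes>\<^sub>M lebesgue :: ((real^'n) \<times> (real^'n)) measure)"
    by (simp add: case_prod_beta')
  then show ?thesis unfolding tail_mean_def[abs_def] by (rule L.borel_measurable_lebesgue_integral)
qed

theorem corollary1p5:
  fixes a :: "real^'n::finite \<Rightarrow> real \<Rightarrow> complex"
    and N :: nat and p :: real and w :: "real^'n \<Rightarrow> real"
  assumes "CARD('n) \<ge> 2"
    and "N \<ge> CARD('n) div 2 + 1"
    and "\<And>x t. a x (t + 2 * pi) = a x t"
    and "\<And>x t. (\<lambda>y. a y t) differentiable (at x)"
    and "\<And>x. times_differentiable N (\<lambda>t. a x t)"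
    and "\<And>i x. times_differentiable N (\<lambda>t. partial i (\<lambda>y. a y t) x)"
    and "\<And>j. j \<le> N \<Longrightarrow> \<exists>M. \<forall>x t. cmod (nderiv j (\<lambda>s. a x s) t) \<le> M"
    and "\<And>i j. j \<le> N \<Longrightarrow>
           \<exists>M. \<forall>x t. cmod (nderiv j (\<lambda>s. partial i (\<lambda>y. a y s) x) t) \<le> M"
    and "p > 2"
    and "w \<in> muckenhoupt (p / 2)"
  shows "\<exists>T. extends_pseudo_multiplier a p w T \<and>
    (\<exists>C. \<forall>f\<in>weighted_Lp p w.
       (LINT x|lebesgue. cmod (T f x) powr p * w x) \<le> C * (LINT x|lebesgue. cmod (f x) powr p * w x))"
proof -
  define l where "l = CARD('n) div 2 + 1"
  define q where "q = p / 2"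
  have l: "CARD('n) < 2 * l" "l > 0" "l \<le> N" using assms(2) by (auto simp: l_def)
  have q: "q > 1" using assms(9) by (simp add: q_def)
  have w: "w \<in> muckenhoupt q" using assms(10) by (simp add: q_def)
  have wm[measurable]: "w \<in> borel_measurable lebesgue" and wpos: "AE y in lebesgue. 0 < w y"
    using w unfolding muckenhoupt_def mem_Collect_eq by blast+
  have td: "times_differentiable l (a x)" for x
    using assms(5)[of x] l(3) by (simp add: times_differentiable_def)
  have cx: "continuous_on UNIV (\<lambda>x. a x t)" for t
    using assms(4) by (intro continuous_at_imp_continuous_on ballI differentiable_imp_continuous_within) auto
  have ct: "continuous_on UNIV (a x)" for x
    using nderiv_has_vector_derivative[OF td l(2)] unfolding nderiv_0
    by (intro continuous_at_imp_continuous_on ballI has_vector_derivative_continuous)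
  obtain M0 where "\<forall>x t. cmod (nderiv 0 (\<lambda>s. a x s) t) \<le> M0" using assms(7)[of 0] by auto
  then have M0: "\<And>x t. cmod (a x t) \<le> M0" by (simp add: nderiv_0)
  obtain M1 where M1: "\<forall>x t. cmod (nderiv l (\<lambda>s. a x s) t) \<le> M1" using assms(7)[OF l(3)] by auto
  define m where "m x k = fourier_coeff a x (2 * k + CARD('n))" for x k
  define M where "M = max 0 (2 * pi * M1)"
  have M: "0 \<le> M" by (simp add: M_def)
  have mk: "cmod (m x k) \<le> M / real (Suc k) ^ l" for x k
  proof -
    have "cmod (m x k) * real (Suc k) ^ l \<le> cmod (m x k) * real (2 * k + CARD('n)) ^ l"
      using assms(1) by (intro mult_left_mono power_mono) auto
    also have "\<dots> \<le> 2 * pi * M1" unfolding m_def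
      by (rule fourier_coeff_bound[of l a x, OF td assms(3) l(2)]) (use M1 in auto)
    also have "\<dots> \<le> M" by (simp add: M_def)
    finally show ?thesis by (simp add: pos_le_divide_eq)
  qed
  have mm: "(\<lambda>x. m x k) \<in> borel_measurable borel" for k unfolding m_def
    by (rule borel_measurable_continuous_onI[OF continuous_fourier_coeff[OF cx ct M0]])
  \<comment> \<open>The extension: \<open>hproj\<close> agrees with the spectral projection on \<open>L\<^sup>2\<close> and is defined on the
    whole weighted space.\<close>
  define T where "T f x = (\<Sum>k. m x k * hproj k f x)" for f x
  obtain D where D0: "D \<ge> 0" and DD: "\<forall>(f :: real^'n \<Rightarrow> complex) x m M. f \<in> borel_measurable lebesgue \<longrightarrow>
     integrable lebesgue (\<lambda>y. (cmod (f y))\<^sup>2 / wt l x y) \<longrightarrow>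
     (\<forall>k. cmod (m k) \<le> M / real (Suc k) ^ l) \<longrightarrow>
     summable (\<lambda>k. m k * hproj k f x) \<and> (cmod (\<Sum>k. m k * hproj k f x))\<^sup>2 \<le> D * M\<^sup>2 * tail_mean l f x"
    using hproj_series_bound[OF l(1)] by auto
  obtain C where C0: "C \<ge> 0" and CC: "\<forall>g. g \<in> borel_measurable lebesgue \<longrightarrow> (\<forall>y. 0 \<le> g y) \<longrightarrow> integrable lebesgue (\<lambda>y. g y powr q * w y) \<longrightarrow>
    (\<forall>x. integrable lebesgue (\<lambda>y. g y / wt l x y)) \<and>
    (\<integral>\<^sup>+x. ennreal ((LINT y|lebesgue. g y / wt l x y) powr q * w x) \<partial>lebesgue)
      \<le> ennreal (C * (LINT y|lebesgue. g y powr q * w y))"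
    using muckenhoupt_tail_bound[OF q w l(1)] by auto
  have fm: "f \<in> borel_measurable lebesgue" if "f \<in> weighted_Lp p w" for f using that by (simp add: weighted_Lp_def)
  have sqp: "((cmod z)\<^sup>2) powr q = cmod z powr p" for z unfolding q_def by (rule powr_sq) simp
  have tail: "integrable lebesgue (\<lambda>y. (cmod (f y))\<^sup>2 / wt l x y)"
    "(\<integral>\<^sup>+x. ennreal (tail_mean l f x powr q * w x) \<partial>lebesgue) \<le> ennreal (C * (LINT y|lebesgue. cmod (f y) powr p * w y))"
    if f: "f \<in> weighted_Lp p w" for f x
  proof -
    have 1: "(\<lambda>y. (cmod (f y))\<^sup>2) \<in> borel_measurable lebesgue" using fm[OF f] by measurable
    have 2: "integrable lebesgue (\<lambda>y. ((cmod (f y))\<^sup>2) powr q * w y)" unfolding sqp using f by (simp add: weighted_Lp_def)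
    have 3: "\<forall>y. 0 \<le> (cmod (f y))\<^sup>2" by simp
    note c = CC[rule_format, OF 1 3[rule_format] 2]
    show "integrable lebesgue (\<lambda>y. (cmod (f y))\<^sup>2 / wt l x y)" using conjunct1[OF c] by (rule spec)
    show "(\<integral>\<^sup>+x. ennreal (tail_mean l f x powr q * w x) \<partial>lebesgue) \<le> ennreal (C * (LINT y|lebesgue. cmod (f y) powr p * w y))"
      using conjunct2[OF c] unfolding tail_mean_def sqp .
  qed
  have S: "summable (\<lambda>k. m x k * hproj k f x)" "(cmod (T f x))\<^sup>2 \<le> D * M\<^sup>2 * tail_mean l f x"
    if f: "f \<in> weighted_Lp p w" for f x
    using DD[rule_format, OF fm[OF f] tail(1)[OF f, of x] mk[of x]] unfolding T_def by auto
  have hint: "integrable lebesgue (\<lambda>y. f y * cHerm \<alpha> y)" if f: "f \<in> weighted_Lp p w" for f \<alpha>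
    by (rule tail_integrable_mult_Herm[OF fm[OF f] tail(1)[OF f]])
  have Tm: "T f \<in> borel_measurable lebesgue" if f: "f \<in> weighted_Lp p w" for f
  proof -
    have t: "(\<lambda>x. m x k * hproj k f x) \<in> borel_measurable borel" for k
      using mm[of k] unfolding hproj_def by measurable
    have "T f \<in> borel_measurable borel"
    proof (rule borel_measurable_LIMSEQ_metric)
      show "(\<lambda>x. \<Sum>k<n. m x k * hproj k f x) \<in> borel_measurable borel" for n
        using t by (intro borel_measurable_sum)
      show "(\<lambda>n. \<Sum>k<n. m x k * hproj k f x) \<longlonglongrightarrow> T f x" for x
        unfolding T_def by (rule summable_LIMSEQ[OF S(1)[OF f]])
    qed
    then show ?thesis by (rule borel_lebesgue)
  qed
  define E where "E = (D * M\<^sup>2) powr q * C"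
  have bound: "integrable lebesgue (\<lambda>x. cmod (T f x) powr p * w x)"
    "(LINT x|lebesgue. cmod (T f x) powr p * w x) \<le> E * (LINT x|lebesgue. cmod (f x) powr p * w x)"
    if f: "f \<in> weighted_Lp p w" for f
  proof -
    define J where "J = (LINT y|lebesgue. cmod (f y) powr p * w y)"
    have J0: "0 \<le> J" unfolding J_def using wpos by (intro integral_nonneg_AE) (auto elim!: eventually_mono)
    let ?K = "(D * M\<^sup>2) powr q"
    have pt: "cmod (T f x) powr p \<le> ?K * tail_mean l f x powr q" for x
    proof -
      have "cmod (T f x) powr p = ((cmod (T f x))\<^sup>2) powr q" by (rule sqp[symmetric])
      also have "\<dots> \<le> (D * M\<^sup>2 * tail_mean l f x) powr q" using S(2)[OF f, of x] q by (intro powr_mono2) auto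
      also have "\<dots> = ?K * tail_mean l f x powr q" using D0 by (simp add: powr_mult tail_mean_nonneg)
      finally show ?thesis .
    qed
    have nn: "AE x in lebesgue. 0 \<le> cmod (T f x) powr p * w x" using wpos by eventually_elim simp
    have "(\<integral>\<^sup>+x. ennreal (cmod (T f x) powr p * w x) \<partial>lebesgue) \<le> (\<integral>\<^sup>+x. ennreal ?K * ennreal (tail_mean l f x powr q * w x) \<partial>lebesgue)"
    proof (rule nn_integral_mono_AE)
      show "AE x in lebesgue. ennreal (cmod (T f x) powr p * w x) \<le> ennreal ?K * ennreal (tail_mean l f x powr q * w x)"
        using wpos
      proof eventually_elim
        case (elim x)
        have "cmod (T f x) powr p * w x \<le> ?K * (tail_mean l f x powr q * w x)"
          using mult_right_mono[OF pt[of x], of "w x"] elim by (simp add: mult.assoc)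
        then have "ennreal (cmod (T f x) powr p * w x) \<le> ennreal (?K * (tail_mean l f x powr q * w x))" by (rule ennreal_leI)
        also have "\<dots> = ennreal ?K * ennreal (tail_mean l f x powr q * w x)" using elim by (intro ennreal_mult) auto
        finally show ?case .
      qed
    qed
    also have "\<dots> = ennreal ?K * (\<integral>\<^sup>+x. ennreal (tail_mean l f x powr q * w x) \<partial>lebesgue)"
    proof (rule nn_integral_cmult)
      have [measurable]: "tail_mean l f \<in> borel_measurable lebesgue" by (rule measurable_tail[OF fm[OF f]])
      show "(\<lambda>x. ennreal (tail_mean l f x powr q * w x)) \<in> borel_measurable lebesgue" by measurable
    qed
    also have "\<dots> \<le> ennreal ?K * ennreal (C * J)"
      using tail(2)[OF f] unfolding J_def by (intro mult_left_mono) auto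
    also have "\<dots> = ennreal (E * J)" unfolding E_def mult.assoc using C0 J0 by (intro ennreal_mult[symmetric]) auto
    finally have fin: "(\<integral>\<^sup>+x. ennreal (cmod (T f x) powr p * w x) \<partial>lebesgue) \<le> ennreal (E * J)" .
    have meas: "(\<lambda>x. cmod (T f x) powr p * w x) \<in> borel_measurable lebesgue" using Tm[OF f] by measurable
    show i: "integrable lebesgue (\<lambda>x. cmod (T f x) powr p * w x)"
      by (rule integrableI_nonneg[OF meas nn]) (use fin in \<open>auto intro: le_less_trans\<close>)
    have "0 \<le> E * J" using C0 J0 by (simp add: E_def)
    then show "(LINT x|lebesgue. cmod (T f x) powr p * w x) \<le> E * J"
      using fin nn_integral_eq_integral[OF i nn] by simp
  qed
  have "extends_pseudo_multiplier a p w T"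
    unfolding extends_pseudo_multiplier_def
  proof (intro conjI ballI allI impI AE_I2)
    fix f assume f: "f \<in> weighted_Lp p w"
    show "T f \<in> weighted_Lp p w" unfolding weighted_Lp_def using Tm[OF f] bound(1)[OF f] by simp
  next
    fix f g x assume f: "f \<in> weighted_Lp p w" and g: "g \<in> weighted_Lp p w"
    have "hcoeff (\<lambda>y. f y + g y) \<alpha> = hcoeff f \<alpha> + hcoeff g \<alpha>" for \<alpha>
      unfolding hcoeff_def distrib_right by (intro Bochner_Integration.integral_add hint f g)
    then have "hproj k (\<lambda>y. f y + g y) x = hproj k f x + hproj k g x" for k
      by (simp add: hproj_def distrib_right sum.distrib)
    then have "T (\<lambda>y. f y + g y) x = (\<Sum>k. m x k * hproj k f x + m x k * hproj k g x)"
      by (simp add: T_def distrib_left)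
    also have "\<dots> = T f x + T g x" unfolding T_def by (rule suminf_add[OF S(1)[OF f] S(1)[OF g], symmetric])
    finally show "T (\<lambda>y. f y + g y) x = T f x + T g x" .
  next
    fix c f x assume f: "f \<in> weighted_Lp p w"
    have "hcoeff (\<lambda>y. c * f y) \<alpha> = c * hcoeff f \<alpha>" for \<alpha>
      unfolding hcoeff_def mult.assoc by (rule integral_mult_right_zero)
    then have "hproj k (\<lambda>y. c * f y) x = c * hproj k f x" for k
      by (simp add: hproj_def sum_distrib_left mult.assoc)
    then have "T (\<lambda>y. c * f y) x = (\<Sum>k. c * (m x k * hproj k f x))"
      by (simp add: T_def mult.left_commute)
    also have "\<dots> = c * T f x" unfolding T_def by (rule suminf_mult[OF S(1)[OF f]])
    finally show "T (\<lambda>y. c * f y) x = c * T f x" .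
  next
    fix f x assume f: "f \<in> weighted_Lp p w" and sq: "square_integrable f"
    show "T f x = pseudo_multiplier a f x"
      unfolding T_def pseudo_multiplier_def m_def by (simp add: hermite_proj_eq_hproj[OF sq])
  qed
  then show ?thesis using bound(2) by blast
qed

end
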